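(* Let $A:\mathbb{R}\to\mathbb{R}$ be a function of locally bounded variation, vanishing on $(-\infty,1)$, such that the Mellin transform $\mathcal{A}(s):=\int_1^\infty x^{-s}\,dA(x)$ converges for $\Re s>1$. Let $T>0$, let $n$ and $m_k$ ($0\le k\le n$) be positive integers, let $c_{k,l}$ be complex numbers and let $\omega_{k,l}$, $b_k$ ($0\le k\le n$, $1\le l\le m_k$) be real numbers with $b_0=0$, $b_k>0$ for $k\ge1$, and $\omega_{k,l}>-1$. For $\Re s>0$ define $$G(s)=\frac{1}{s+1}\mathcal{A}(s+1)-\sum_{k=0}^{n}\sum_{l=1}^{m_k}\left(\frac{c_{k,l}}{(s+ib_k)^{\omega_{k,l}+1}}+\frac{\overline{c_{k,l}}}{(s-ib_k)^{\omega_{k,l}+1}}\right),$$ and for $\sigma>0$ define $$\eta(\sigma,T)=\int_{-T}^{T}|G(2\sigma+i\tau)-G(\sigma+i\tau)|\,d\tau .$$ Put $\omega:=\min_{k,l}\omega_{k,l}$ and $\Omega:=\max_{k,l}\omega_{k,l}$. Assume that $A(x)/x$ is slowly decreasing on $[1,\infty)$ and that $$\eta(\sigma,T)=O(\sigma^{-\Omega_+})\qquad(0<\sigma<1).$$ Then for $x\ge\max(e,e^{17/T},e^{17/\sqrt{T}})$ we have $$\left|A(x)-x\sum_{k=0}^{n}\sum_{l=1}^{m_k}\frac{(\log x)^{\omega_{k,l}}}{\Gamma(\omega_{k,l}+1)}\,2\Re\left(c_{k,l}e^{-ib_k\log x}\right)\right|\ll x\,\rho_T(x)$$ with $$\rho_T(x)=\sqrt{\Psi_{e^{1/T}}(1)\Psi_{e^{1/T}}(\sqrt{x})}+R_T(x)+\sqrt{\Psi_{e^{1/T}}(1)R_T(x)},$$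 $$R_T(x)=\nu\left(\frac{A(x)}{x};e^{1/T}\right)+\left(1+\frac1T\right)\eta\left(\frac{1}{\log x},T\right)+\frac{\log^{\Omega_+}x+\log\log x}{T}+\frac{1}{T^{\omega+1}\log x}+\frac{1}{T^{\Omega+1}\log x},$$ where the implicit constants only depend on $\overline{\nu}(A(x)/x;e)$, $\sup_{[1,e]}|A|$, $\mathcal{A}(2)$, the implied constant in $\eta(\sigma,T)=O(\sigma^{-\Omega_+})$, the $c_{k,l}$ and the $b_k$.
   Context: Notation: $r_+=\max(r,0)$. Powers $z^{\omega+1}$ with $\Re z>0$ are taken with the principal branch. The Stieltjes integral $\int_1^\infty x^{-s}\,dA(x)$ includes the possible jump of $A$ at $1$, so that $\mathcal{A}(s)=s\int_1^\infty A(x)x^{-s-1}\,dx$ for $\Re s>1$. For a real function $f$ on $[a,\infty)$, $a>0$, and $\lambda\ge1$, put $$\overline{\nu}(f;\lambda):=-\inf\{f(y)-f(x): a\le x\le y\le\lambda x\},\qquad \nu(f;\lambda):=-\lim_{z\to\infty}\inf\{f(y)-f(x): z\le x\le y\le\lambda x\}.$$ The function $f$ is slowly decreasing on $[a,\infty)$ if $\lim_{\lambda\downarrow1}\liminf_{x\to\infty}\inf_{x\le y\le\lambda x}\{f(y)-f(x)\}=0$, i.e. $\lim_{\lambda\downarrow1}\nu(f;\lambda)=0$. For $\lambda\ge1$, $\Psi_\lambda$ denotes a nonincreasing function on $[a,\infty)$ with $\lim_{x\to\infty}\Psi_\lambda(x)=0$ satisfying $f(y)-f(x)\ge-\nu(f;\lambda)-\Psi_\lambda(x)\ge-\overline{\nu}(f;\lambda)$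 whenever $a\le x\le y\le\lambda x$ (such a function exists whenever these quantities are finite). Here these notions are applied with $f(x)=A(x)/x$ and $a=1$. *)

theory Defs
  imports "HOL-Analysis.Analysis"
begin

definition locally_bounded_variation :: "(real \<Rightarrow> real) \<Rightarrow> bool" where
  "locally_bounded_variation A \<longleftrightarrow>
     (\<forall>a b. \<exists>M. \<forall>\<D>. \<D> division_of {a..b} \<longrightarrow> (\<Sum>K\<in>\<D>. \<bar>A (Sup K) - A (Inf K)\<bar>) \<le> M)"

text \<open>
  Riemann-Stieltjes integral of \<open>f\<close> with respect to \<open>dA\<close> over \<open>[a, b]\<close>, as the limit of the
  Riemann-Stieltjes sums for mesh tending to \<open>0\<close>: the gauge is constant, in contrast to the
  Henstock-Kurzweil integral of the library.
\<close>

definition has_stieltjes_integral ::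
    "(real \<Rightarrow> complex) \<Rightarrow> (real \<Rightarrow> real) \<Rightarrow> real \<Rightarrow> real \<Rightarrow> complex \<Rightarrow> bool" where
  "has_stieltjes_integral f A a b I \<longleftrightarrow>
     (\<forall>e>0. \<exists>d>0. \<forall>p. p tagged_division_of {a..b} \<and> (\<lambda>x. ball x d) fine p \<longrightarrow>
        norm ((\<Sum>(x, K)\<in>p. of_real (A (Sup K) - A (Inf K)) * f x) - I) < e)"

text \<open>
  The transform of a function \<open>A\<close> vanishing on \<open>(-\<infinity>, 1)\<close>. The integral from \<open>1\<close> to
  infinity is improper, and it includes the jump of \<open>A\<close> at \<open>1\<close>. This jump is \<open>A 1\<close>; it is
  not seen by the Riemann-Stieltjes sums over \<open>[1, X]\<close> and is therefore added separately.
\<close>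

definition has_mellin :: "(real \<Rightarrow> real) \<Rightarrow> complex \<Rightarrow> complex \<Rightarrow> bool" where
  "has_mellin A s L \<longleftrightarrow>
     (\<exists>I. (\<forall>X\<ge>1. has_stieltjes_integral (\<lambda>x. of_real x powr (- s)) A 1 X (I X)) \<and>
          ((\<lambda>X. of_real (A 1) + I X) \<longlongrightarrow> L) at_top)"

definition mellin :: "(real \<Rightarrow> real) \<Rightarrow> complex \<Rightarrow> complex" where
  "mellin A s = (THE L. has_mellin A s L)"

text \<open>
  The one-sided moduli of decrease are extended reals, so that they are meaningful also
  where the infima are \<open>-\<infinity>\<close>.
\<close>

definition nu_bar :: "(real \<Rightarrow> real) \<Rightarrow> real \<Rightarrow> real \<Rightarrow> ereal" where
  "nu_bar f a lam =
     - (INF (x, y)\<in>{(x, y). a \<le> x \<and> x \<le> y \<and> y \<le> lam * x}. ereal (f y - f x))"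

definition nu :: "(real \<Rightarrow> real) \<Rightarrow> real \<Rightarrow> ereal" where
  "nu f lam =
     - Lim at_top (\<lambda>z. INF (x, y)\<in>{(x, y). z \<le> x \<and> x \<le> y \<and> y \<le> lam * x}. ereal (f y - f x))"

text \<open>
  Since only the behaviour at infinity matters here, the left end point of the
  domain of \<open>f\<close> does not occur in \<open>nu\<close> and \<open>slowly_decreasing\<close>.
\<close>

definition slowly_decreasing :: "(real \<Rightarrow> real) \<Rightarrow> bool" where
  "slowly_decreasing f \<longleftrightarrow>
     ((\<lambda>lam. Liminf at_top (\<lambda>x. INF y\<in>{x..lam * x}. ereal (f y - f x))) \<longlongrightarrow> 0) (at_right 1)"

definition decrease_remainder ::
    "(real \<Rightarrow> real) \<Rightarrow> real \<Rightarrow> real \<Rightarrow> (real \<Rightarrow> real) \<Rightarrow> bool" where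
  "decrease_remainder f a lam \<Psi> \<longleftrightarrow>
     antimono_on {a..} \<Psi> \<and> (\<Psi> \<longlongrightarrow> 0) at_top \<and>
     (\<forall>x y. a \<le> x \<and> x \<le> y \<and> y \<le> lam * x \<longrightarrow>
        ereal (f y - f x) \<ge> - nu f lam - ereal (\<Psi> x) \<and>
        - nu f lam - ereal (\<Psi> x) \<ge> - nu_bar f a lam)"

definition G_fun :: "(real \<Rightarrow> real) \<Rightarrow> nat \<Rightarrow> (nat \<Rightarrow> nat) \<Rightarrow> (nat \<Rightarrow> nat \<Rightarrow> complex) \<Rightarrow>
    (nat \<Rightarrow> nat \<Rightarrow> real) \<Rightarrow> (nat \<Rightarrow> real) \<Rightarrow> complex \<Rightarrow> complex" where
  "G_fun A n m c om b s =
     1 / (s + 1) * mellin A (s + 1) -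
     (\<Sum>k=0..n. \<Sum>l=1..m k.
        c k l / (s + \<i> * of_real (b k)) powr of_real (om k l + 1) +
        cnj (c k l) / (s - \<i> * of_real (b k)) powr of_real (om k l + 1))"

definition eta :: "(complex \<Rightarrow> complex) \<Rightarrow> real \<Rightarrow> real \<Rightarrow> real" where
  "eta G \<sigma> T = integral {-T..T} (\<lambda>\<tau>. norm (G (Complex (2 * \<sigma>) \<tau>) - G (Complex \<sigma> \<tau>)))"

definition min_exponent :: "nat \<Rightarrow> (nat \<Rightarrow> nat) \<Rightarrow> (nat \<Rightarrow> nat \<Rightarrow> real) \<Rightarrow> real" where
  "min_exponent n m om = Min {om k l | k l. k \<le> n \<and> 1 \<le> l \<and> l \<le> m k}"

definition max_exponent :: "nat \<Rightarrow> (nat \<Rightarrow> nat) \<Rightarrow> (nat \<Rightarrow> nat \<Rightarrow> real) \<Rightarrow> real" where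
  "max_exponent n m om = Max {om k l | k l. k \<le> n \<and> 1 \<le> l \<and> l \<le> m k}"

definition main_term :: "nat \<Rightarrow> (nat \<Rightarrow> nat) \<Rightarrow> (nat \<Rightarrow> nat \<Rightarrow> complex) \<Rightarrow>
    (nat \<Rightarrow> nat \<Rightarrow> real) \<Rightarrow> (nat \<Rightarrow> real) \<Rightarrow> real \<Rightarrow> real" where
  "main_term n m c om b x =
     x * (\<Sum>k=0..n. \<Sum>l=1..m k.
        ln x powr om k l / Gamma (om k l + 1) * (2 * Re (c k l * exp (- \<i> * of_real (b k * ln x)))))"

text \<open>
  In the next two definitions \<open>om\<close> and \<open>Om\<close> are the minimal and the maximal exponent, \<open>f\<close> is
  the function \<open>A(x) / x\<close>, and \<open>\<Psi>\<close> belongs to the ratio \<open>exp (1 / T)\<close>. For slowly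
  decreasing, locally bounded \<open>f\<close> the modulus \<open>nu\<close> is finite.
\<close>

definition R_rem :: "(real \<Rightarrow> real) \<Rightarrow> (complex \<Rightarrow> complex) \<Rightarrow> real \<Rightarrow> real \<Rightarrow> real \<Rightarrow> real \<Rightarrow> real" where
  "R_rem f G om Om T x =
     real_of_ereal (nu f (exp (1 / T))) + (1 + 1 / T) * eta G (1 / ln x) T +
     (ln x powr max Om 0 + ln (ln x)) / T +
     1 / (T powr (om + 1) * ln x) + 1 / (T powr (Om + 1) * ln x)"

definition rho_rem :: "(real \<Rightarrow> real) \<Rightarrow> (complex \<Rightarrow> complex) \<Rightarrow> (real \<Rightarrow> real) \<Rightarrow>
    real \<Rightarrow> real \<Rightarrow> real \<Rightarrow> real \<Rightarrow> real" where
  "rho_rem f G \<Psi> om Om T x =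
     sqrt (\<Psi> 1 * \<Psi> (sqrt x)) + R_rem f G om Om T x + sqrt (\<Psi> 1 * R_rem f G om Om T x)"

end

(*
  In the variable t = log x put F(t) = A(e^t) e^{-t}, let P be the sum of the oscillating terms
  and h = F - P, whose Laplace transform is G. With X = log x and the weight
  w(t) = e^{-t/X} - e^{-2t/X}, the integrable function w h has Fourier transform
  G(1/X + i tau) - G(2/X + i tau), so every convolution of w h with a nonnegative kernel whose
  Fourier transform lives on [-T, T] is at most eta(1/X, T). Rescale to u = T t and let Z collect
  the global data; the majorant E(u), which is of the size of the claimed remainder at u = TX and
  grows like Z |u - TX| / (TX) away from it, varies slowly on the scale of the kernel. Centring
  the kernel to the right or to the left of a point y, the slow decrease of F turns a bound
  |w h| <= V E into |w h| <= (c + V/2) E, hence sup |w h| / E <= 2c. For bounded TX, adding a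
  linear function makes F nonnegative and one application of the kernel is enough.

  Dividing by Gamma(om + 1), weighting by w and the inequality v^om e^{-v} <= e Gamma(om + 1)
  make all bounds on P uniform in the exponents.
*)

theory Submission
  imports Defs
begin

section \<open>A band-limited kernel\<close>

text \<open>The slow decrease improves only as one moves out: on the right half
  \<open>u \<ge> \<Lambda> / 2\<close>, with \<open>\<Lambda> = T X\<close>, the modulus is at most
  its value at argument sqrt x, while further left only the global bound \<open>Z\<close> is at
  hand. This forces the linear growth of the majorant: on the left half it is at least Z/2, so crude
  bounds suffice there, and at \<open>\<Lambda>\<close> itself the growth term costs no more than
  \<open>Z / \<Lambda>\<close>. The same split serves the weight, which behaves like
  \<open>t / \<Lambda>\<close> near 0: its relative increase per unit length is of order 1/t, and
  becomes O(\<open>1 / \<Lambda>\<close>) on the right half only.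

  The self-improvement is a count of multiples of V. The tail of the kernel beyond radius 160 costs
  1/4, the variation of the weight over a window costs 1/8 once \<open>\<Lambda> \<ge> 5120\<close>,
  and 3/8 < 1/2. The argument needs sup |w h| / E to be finite beforehand. Convergence of the Mellin
  transform, together with the lower bound from slow decrease, gives F(t) = O(exp(sigma t)) for
  every sigma > 0, hence finiteness; the size of this bound never enters the final constant.\<close>

definition fourier :: "(real \<Rightarrow> complex) \<Rightarrow> real \<Rightarrow> complex" where
  "fourier H \<tau> = (LINT t|lborel. cis (- (\<tau> * t)) * H t)"

text \<open>The transform of the indicator of [-1/4, 1/4] without a normalising factor; the value
  1/2 at 0 is the length of the band.\<close>

definition phi :: "real \<Rightarrow> real" where
  "phi u = (if u = 0 then 1/2 else 2 * sin (u/4) / u)"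

lemma measurable_cis_compose [measurable (raw)]:
  "f \<in> borel_measurable M \<Longrightarrow> (\<lambda>x. cis (f x)) \<in> borel_measurable M"
  by (rule borel_measurable_continuous_on[of cis]) (auto intro!: continuous_intros)

lemma integrable_cis_mult:
  assumes "integrable lborel H"
  shows "integrable lborel (\<lambda>t. cis (a * t) * H t)"
proof (rule Bochner_Integration.integrable_bound[OF assms])
  have [measurable]: "H \<in> borel_measurable lborel" using assms by simp
  show "(\<lambda>t. cis (a * t) * H t) \<in> borel_measurable lborel" by measurable
qed (simp add: norm_mult)

lemma measurable_phi [measurable]: "phi \<in> borel_measurable borel"
  unfolding phi_def by measurable

lemma integrable_indicator_Icc [simp]: "integrable lborel (indicator {a..b::real} :: real \<Rightarrow> real)"
  by (rule integrable_real_indicator) (auto simp: emeasure_lborel_Icc_eq)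

lemma phi_integral:
  "(LINT \<tau>|lborel. indicator {-1/4..1/4} \<tau> *\<^sub>R cis (\<tau> * u)) = of_real (phi u)"
proof (cases "u = 0")
  case True
  have "(LINT \<tau>|lborel. indicator {-1/4..1/4::real} \<tau> *\<^sub>R (1::complex)) = 1/2"
    by (subst integral_scaleR_left) (auto simp: scaleR_conv_of_real)
  then show ?thesis using True by (simp add: phi_def)
next
  case False
  have "(LINT \<tau>|lborel. indicator {-1/4..1/4} \<tau> *\<^sub>R cis (\<tau> * u))
      = - \<i> / of_real u * cis (1/4 * u) - (- \<i> / of_real u * cis (-1/4 * u))"
  proof (rule integral_FTC_Icc)
    show "((\<lambda>x. - \<i> / of_real u * cis (x * u)) has_vector_derivative cis (x * u)) (at x within {-1/4..1/4})"
      if "-1/4 \<le> x" "x \<le> 1/4" for x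
      unfolding has_vector_derivative_def
      by (rule derivative_eq_intros refl | simp add: False algebra_simps scaleR_conv_of_real)+
    show "continuous_on {-1/4..1/4} (\<lambda>x. cis (x * u))"
      by (auto intro!: continuous_intros)
  qed simp
  also have "\<dots> = of_real (phi u)"
    using False by (simp add: phi_def cis.ctr field_simps) (simp add: complex_eq_iff)
  finally show ?thesis .
qed

lemma abs_phi_le: "\<bar>phi u\<bar> \<le> 1/2"
proof (cases "u = 0")
  case False
  have "\<bar>sin (u/4)\<bar> \<le> \<bar>u/4\<bar>" by (rule abs_sin_x_le_abs_x)
  then show ?thesis using False by (simp add: phi_def field_simps abs_mult)
qed (simp add: phi_def)

lemma abs_phi_le_inverse: "u \<noteq> 0 \<Longrightarrow> \<bar>phi u\<bar> \<le> 2 / \<bar>u\<bar>"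
  by (simp add: phi_def abs_mult divide_right_mono)

lemma phi_ge:
  assumes "\<bar>u\<bar> \<le> 1" shows "phi u \<ge> 1/4"
proof (cases "u = 0")
  case False
  have *: "sin v \<ge> v / 2" if v: "0 < v" "v \<le> 1/4" for v :: real
  proof -
    obtain z where z: "0 < z" "z < v" "sin v - sin 0 = (v - 0) * cos z"
      using MVT2[of 0 v sin cos] v DERIV_sin by blast
    have "cos z \<ge> cos (pi/3)"
      using z v pi_gt3 by (intro cos_monotone_0_pi_le) auto
    then have "v * cos z \<ge> v * (1/2)" using v by (intro mult_left_mono) (auto simp: cos_60)
    then show ?thesis using z by simp
  qed
  show ?thesis
  proof (cases "u > 0")
    case True
    then show ?thesis using *[of "u/4"] assms by (simp add: phi_def field_simps)
  next
    case neg: False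
    then show ?thesis using *[of "-u/4"] assms False by (simp add: phi_def field_simps)
  qed
qed (simp add: phi_def)

lemma cis_cis_mult: "cis a * (cis b * z) = cis (a + b) * z"
  by (metis cis_mult mult.assoc)

lemma fourier_cis: "fourier (\<lambda>t. cis (- (\<tau> * t)) * H t) \<sigma> = fourier H (\<sigma> + \<tau>)"
  unfolding fourier_def by (simp add: cis_cis_mult distrib_right add.commute)

lemma measurable_fourier [measurable]:
  assumes [measurable]: "H \<in> borel_measurable lborel"
  shows "fourier H \<in> borel_measurable borel"
  unfolding fourier_def by (rule sigma_finite_measure.borel_measurable_lebesgue_integral) (unfold_locales, measurable)

lemma norm_fourier_le:
  assumes "integrable lborel H"
  shows "norm (fourier H \<tau>) \<le> (LINT t|lborel. norm (H t))"
  unfolding fourier_def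
  by (rule order_trans[OF integral_norm_bound]) (simp add: norm_mult)

lemma integrable_bounded_Icc:
  fixes f :: "real \<Rightarrow> 'a::{banach,second_countable_topology}"
  assumes "f \<in> borel_measurable borel" "\<And>x. a \<le> x \<Longrightarrow> x \<le> b \<Longrightarrow> norm (f x) \<le> B"
  shows "integrable lborel (\<lambda>x. indicator {a..b} x *\<^sub>R f x)"
proof (rule Bochner_Integration.integrable_bound[of lborel "\<lambda>x. indicator {a..b} x * B"])
  show "(\<lambda>x. indicator {a..b} x *\<^sub>R f x) \<in> borel_measurable lborel" using assms(1) by measurable
  show "AE x in lborel. norm (indicator {a..b} x *\<^sub>R f x) \<le> norm (indicator {a..b} x * B)"
    using assms(2) by (auto simp: indicator_def intro!: always_eventually) (meson abs_ge_self order_trans)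
qed auto

text \<open>Fubini, after \<open>phi\<close> is written as an integral over its band. The band is
  bounded, so integrability of \<open>H\<close> alone dominates the double integral.\<close>

lemma integral_phi_eq_fourier:
  assumes H: "integrable lborel H"
  shows "(LINT t|lborel. H t * of_real (phi (y - t)))
       = (LINT \<tau>|lborel. indicator {-1/4..1/4} \<tau> *\<^sub>R (cis (\<tau> * y) * fourier H \<tau>))"
proof -
  have [measurable]: "H \<in> borel_measurable lborel" using H by simp
  let ?f = "\<lambda>t \<tau>. indicator {-1/4..1/4::real} \<tau> *\<^sub>R (cis (\<tau> * (y - t)) * H t)"
  have int: "integrable (lborel \<Otimes>\<^sub>M lborel) (case_prod ?f)"
  proof (rule lborel_pair.Fubini_integrable)
    show "case_prod ?f \<in> borel_measurable (lborel \<Otimes>\<^sub>M lborel)" by measurable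
    show "integrable lborel (\<lambda>t. LINT \<tau>|lborel. norm (case_prod ?f (t, \<tau>)))"
      using H by (simp add: norm_mult)
    show "AE t in lborel. integrable lborel (\<lambda>\<tau>. case_prod ?f (t, \<tau>))"
      unfolding prod.case
      by (intro always_eventually allI integrable_bounded_Icc[where B = "norm (H _)"]) (auto simp: norm_mult)
  qed
  have "(LINT t|lborel. H t * of_real (phi (y - t))) = (LINT t|lborel. LINT \<tau>|lborel. ?f t \<tau>)"
    unfolding phi_integral[symmetric] by (simp add: mult.commute[of "H _"] flip: integral_mult_left_zero)
  also have "\<dots> = (LINT \<tau>|lborel. LINT t|lborel. ?f t \<tau>)"
    using lborel_pair.Fubini_integral[OF int] by simp
  also have "\<dots> = (LINT \<tau>|lborel. indicator {-1/4..1/4} \<tau> *\<^sub>R (cis (\<tau> * y) * fourier H \<tau>))"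
    by (simp add: fourier_def cis_cis_mult right_diff_distrib flip: integral_mult_right_zero)
  finally show ?thesis .
qed

lemma integrable_mult_phi:
  fixes H :: "real \<Rightarrow> complex"
  assumes "integrable lborel H"
  shows "integrable lborel (\<lambda>t. H t * of_real (phi (y - t)))"
proof (rule Bochner_Integration.integrable_bound)
  have [measurable]: "H \<in> borel_measurable lborel" using assms by simp
  show "integrable lborel (\<lambda>t. norm (H t))" using assms by simp
  show "(\<lambda>t. H t * of_real (phi (y - t))) \<in> borel_measurable lborel" by measurable
  show "AE t in lborel. norm (H t * of_real (phi (y - t))) \<le> norm (norm (H t))"
    by (auto simp: norm_mult intro!: always_eventually mult_left_le order_trans[OF abs_phi_le])
qed

text \<open>Multiplication by \<open>phi\<close> averages the transform over a window of length 1/2.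
  Modulating \<open>H\<close> by the frequency \<open>\<tau>\<close> reduces this to
  \<open>integral_phi_eq_fourier\<close>.\<close>

lemma norm_fourier_mult_phi_le:
  assumes H: "integrable lborel H"
  shows "norm (fourier (\<lambda>t. H t * of_real (phi (y - t))) \<tau>)
       \<le> (LINT \<sigma>|lborel. indicator {\<tau>-1/4..\<tau>+1/4} \<sigma> *\<^sub>R norm (fourier H \<sigma>))"
proof -
  let ?H = "\<lambda>t. cis (- (\<tau> * t)) * H t"
  have H': "integrable lborel ?H" using integrable_cis_mult[OF H, of "-\<tau>"] by simp
  have "fourier (\<lambda>t. H t * of_real (phi (y - t))) \<tau> = (LINT t|lborel. ?H t * of_real (phi (y - t)))"
    unfolding fourier_def by (simp add: mult.assoc)
  also have "\<dots> = (LINT \<sigma>|lborel. indicator {-1/4..1/4} \<sigma> *\<^sub>R (cis (\<sigma> * y) * fourier H (\<sigma> + \<tau>)))"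
    by (subst integral_phi_eq_fourier[OF H']) (simp add: fourier_cis)
  also have "norm \<dots> \<le> (LINT \<sigma>|lborel. indicator {-1/4..1/4} \<sigma> *\<^sub>R norm (fourier H (\<sigma> + \<tau>)))"
    by (rule order_trans[OF integral_norm_bound]) (simp add: norm_mult)
  also have "\<dots> = (LINT \<sigma>|lborel. indicator {\<tau>-1/4..\<tau>+1/4} \<sigma> *\<^sub>R norm (fourier H \<sigma>))"
    by (subst lborel_integral_real_affine[of 1 _ \<tau>])
       (auto intro!: Bochner_Integration.integral_cong simp: indicator_def algebra_simps)
  finally show ?thesis .
qed

text \<open>The window has length 1/2, so the average is even at most B/2; stating it with the same
  \<open>B\<close> lets the estimate be iterated, at the price of 1/4 in frequency each
  time.\<close>

lemma norm_fourier_mult_phi_le_sup: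
  assumes H: "integrable lborel H" and B: "\<And>\<tau>. \<bar>\<tau>\<bar> \<le> r \<Longrightarrow> norm (fourier H \<tau>) \<le> B"
    and \<tau>: "\<bar>\<tau>\<bar> \<le> r - 1/4"
  shows "norm (fourier (\<lambda>t. H t * of_real (phi (y - t))) \<tau>) \<le> B"
proof -
  have [measurable]: "H \<in> borel_measurable lborel" using H by simp
  have "B \<ge> 0" using B[of \<tau>] \<tau> norm_ge_zero[of "fourier H \<tau>"] by linarith
  have "(LINT \<sigma>|lborel. indicator {\<tau>-1/4..\<tau>+1/4} \<sigma> *\<^sub>R norm (fourier H \<sigma>))
      \<le> (LINT \<sigma>|lborel. indicator {\<tau>-1/4..\<tau>+1/4} \<sigma> *\<^sub>R B)"
  proof (rule integral_mono)
    show "integrable lborel (\<lambda>\<sigma>. indicator {\<tau>-1/4..\<tau>+1/4} \<sigma> *\<^sub>R norm (fourier H \<sigma>))"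
      by (rule integrable_bounded_Icc[where B = B]) (use \<tau> in \<open>auto intro!: B\<close>)
    show "integrable lborel (\<lambda>\<sigma>. indicator {\<tau>-1/4..\<tau>+1/4} \<sigma> *\<^sub>R B)" by simp
    show "indicator {\<tau>-1/4..\<tau>+1/4} \<sigma> *\<^sub>R norm (fourier H \<sigma>) \<le> indicator {\<tau>-1/4..\<tau>+1/4} \<sigma> *\<^sub>R B" for \<sigma>
      using \<tau> by (auto simp: indicator_def intro!: B)
  qed
  also have "\<dots> = B / 2" by simp
  also have "\<dots> \<le> B" using \<open>B \<ge> 0\<close> by simp
  finally show ?thesis using norm_fourier_mult_phi_le[OF H, of y \<tau>] by linarith
qed

text \<open>
  Each factor \<^term>\<open>phi\<close> widens the frequency band by \<open>1/4\<close>; four factors give a nonnegative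
  kernel with decay \<open>u\<^sup>-\<^sup>4\<close>, so that it can be integrated against the linear growth of the majorant.
\<close>

definition jackson :: "real \<Rightarrow> real" where "jackson u = phi u ^ 4"

text \<open>The left side is the transform at frequency 0 after four multiplications by
  \<open>phi\<close>. The first one turns the L1 bound on [-1, 1] into a sup bound for frequencies
  up to 3/4; the other three keep this sup bound on the ranges 1/2, 1/4 and 0. The transform of
  \<open>jackson\<close> itself is never computed.\<close>

lemma norm_integral_jackson_le:
  assumes H: "integrable lborel H"
  shows "norm (LINT t|lborel. H t * of_real (jackson (y - t)))
       \<le> (LINT \<tau>|lborel. indicator {-1..1} \<tau> *\<^sub>R norm (fourier H \<tau>))" (is "_ \<le> ?I")
proof -
  have [measurable]: "H \<in> borel_measurable lborel" using H by simp
  define M where "M = (\<lambda>(H::real\<Rightarrow>complex) t. H t * of_real (phi (y - t)))"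
  have int: "integrable lborel (M H)" if "integrable lborel H" for H
    using integrable_mult_phi[OF that] unfolding M_def .
  have 1: "norm (fourier (M H) \<tau>) \<le> ?I" if \<tau>: "\<bar>\<tau>\<bar> \<le> 3/4" for \<tau>
  proof -
    have "norm (fourier (M H) \<tau>) \<le> (LINT \<sigma>|lborel. indicator {\<tau>-1/4..\<tau>+1/4} \<sigma> *\<^sub>R norm (fourier H \<sigma>))"
      unfolding M_def by (rule norm_fourier_mult_phi_le[OF H])
    also have "\<dots> \<le> ?I"
    proof (rule integral_mono)
      show "integrable lborel (\<lambda>\<sigma>. indicator {\<tau>-1/4..\<tau>+1/4} \<sigma> *\<^sub>R norm (fourier H \<sigma>))"
        by (rule integrable_bounded_Icc) (auto intro!: norm_fourier_le H)
      show "integrable lborel (\<lambda>\<sigma>. indicator {-1..1} \<sigma> *\<^sub>R norm (fourier H \<sigma>))"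
        by (rule integrable_bounded_Icc) (auto intro!: norm_fourier_le H)
    qed (use \<tau> in \<open>auto simp: indicator_def\<close>)
    finally show ?thesis .
  qed
  have 2: "norm (fourier (M (M H)) \<tau>) \<le> ?I" if "\<bar>\<tau>\<bar> \<le> 1/2" for \<tau>
    using norm_fourier_mult_phi_le_sup[OF int[OF H] 1, of "3/4" \<tau> y] that unfolding M_def by fastforce
  have 3: "norm (fourier (M (M (M H))) \<tau>) \<le> ?I" if "\<bar>\<tau>\<bar> \<le> 1/4" for \<tau>
    using norm_fourier_mult_phi_le_sup[OF int[OF int[OF H]] 2, of "1/2" \<tau> y] that unfolding M_def by simp
  have "norm (fourier (M (M (M (M H)))) 0) \<le> ?I"
    using norm_fourier_mult_phi_le_sup[OF int[OF int[OF int[OF H]]] 3, of "1/4" 0 y] unfolding M_def by simp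
  then show ?thesis
    by (simp add: fourier_def M_def jackson_def power4_eq_xxxx mult_ac)
qed

lemma jackson_nonneg: "jackson u \<ge> 0"
  by (simp add: jackson_def)

lemma measurable_jackson [measurable]: "jackson \<in> borel_measurable borel"
  unfolding jackson_def by measurable

lemma jackson_le: "jackson u \<le> 1/16"
proof -
  have "\<bar>phi u\<bar> ^ 4 \<le> (1/2) ^ 4" by (rule power_mono[OF abs_phi_le]) simp
  then show ?thesis by (simp add: jackson_def power_divide)
qed

lemma jackson_le_inverse: "u \<noteq> 0 \<Longrightarrow> jackson u \<le> 16 / \<bar>u\<bar> ^ 4"
  using power_mono[OF abs_phi_le_inverse, of u 4] by (simp add: jackson_def power_divide)

lemma jackson_ge: "\<bar>u\<bar> \<le> 1 \<Longrightarrow> jackson u \<ge> 1/256"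
  using power_mono[OF phi_ge, of u 4] by (simp add: jackson_def power_divide)

lemma integrable_mult_jackson:
  fixes H :: "real \<Rightarrow> real"
  assumes "integrable lborel H"
  shows "integrable lborel (\<lambda>t. H t * jackson (y - t))"
proof (rule Bochner_Integration.integrable_bound[OF assms])
  have [measurable]: "H \<in> borel_measurable lborel" using assms by simp
  show "(\<lambda>t. H t * jackson (y - t)) \<in> borel_measurable lborel" by measurable
  have "\<bar>jackson u\<bar> \<le> 1" for u using jackson_le[of u] jackson_nonneg[of u] by linarith
  then show "AE t in lborel. norm (H t * jackson (y - t)) \<le> norm (H t)"
    by (auto simp: abs_mult intro!: always_eventually mult_left_le)
qed

text \<open>
  For \<open>\<bar>u\<bar> > 160\<close> this dominates \<open>(1 + 2 \<bar>u\<bar>) jackson u\<close>. The radius \<open>160\<close> makes its integral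
  less than a quarter of the lower bound \<open>1/128\<close> for the integral of the kernel over \<open>[-1, 1]\<close>.
\<close>

definition cubic_tail :: "real \<Rightarrow> real" where
  "cubic_tail u = indicator {160..} \<bar>u\<bar> * (48 / \<bar>u\<bar> ^ 3)"

lemma has_bochner_integral_cubic_tail: "has_bochner_integral lborel cubic_tail (3/1600)"
proof -
  let ?f = "\<lambda>u::real. 48 / \<bar>u\<bar> ^ 3 * indicator {160..} u"
  have "(\<integral>\<^sup>+u. ennreal (48 / \<bar>u\<bar> ^ 3) * indicator {160..} u \<partial>lborel) = ennreal (0 - (- 24 / 160 ^ 2))"
  proof (rule nn_integral_FTC_atLeast)
    show "((\<lambda>u::real. - 24 / u ^ 2) has_real_derivative 48 / \<bar>u\<bar> ^ 3) (at u)" if "160 \<le> u" for u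
      using that by (auto intro!: derivative_eq_intros simp: field_simps power2_eq_square power3_eq_cube)
    have "((\<lambda>u::real. -24 * inverse u ^ 2) \<longlongrightarrow> -24 * 0 ^ 2) at_top"
      by (intro tendsto_intros tendsto_inverse_0_at_top filterlim_ident)
    then show "((\<lambda>u::real. - 24 / u ^ 2) \<longlongrightarrow> 0) at_top" by (simp add: field_simps)
  qed auto
  then have "(\<integral>\<^sup>+u. ennreal (?f u) \<partial>lborel) = ennreal (3/3200)"
    by (subst nn_integral_cong[of _ _ "\<lambda>u. ennreal (48 / \<bar>u\<bar> ^ 3) * indicator {160..} u"])
       (auto simp: indicator_def)
  then have pos: "has_bochner_integral lborel ?f (3/3200)"
    by (intro has_bochner_integral_nn_integral) (auto intro!: always_eventually)
  have neg: "has_bochner_integral lborel (\<lambda>u. ?f (0 + (-1) * u)) (3/3200)"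
    using lborel_has_bochner_integral_real_affine_iff[of "-1" ?f "3/3200" 0] pos by simp
  have "has_bochner_integral lborel (\<lambda>u. ?f u + ?f (0 + (-1) * u)) (3/3200 + 3/3200)"
    by (rule has_bochner_integral_add[OF pos neg])
  moreover have "(\<lambda>u. ?f u + ?f (0 + (-1) * u)) = cubic_tail"
    by (auto simp: cubic_tail_def fun_eq_iff indicator_def abs_if)
  ultimately show ?thesis by simp
qed

text \<open>The kernel has mass at least 2 * 1/256 = 1/128 on [-1, 1]. For distances between 1 and
  160 the integrand is nonnegative, and beyond 160 the loss is at most \<open>W\<close> times the
  integral 3/1600 of \<open>cubic_tail\<close>. Hence d/128 - 3W/1600 <= \<open>\<eta>\<close>, and
  128 * 3/1600 = 0.24 < 1/4.\<close>

lemma jackson_window: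
  fixes H :: "real \<Rightarrow> real"
  assumes H: "integrable lborel H" and le: "(LINT t|lborel. H t * jackson (z - t)) \<le> \<eta>"
    and inner: "\<And>t. \<bar>t - z\<bar> \<le> 160 \<Longrightarrow> H t \<ge> d" and "d \<ge> 0" "W \<ge> 0"
    and outer: "\<And>t. \<bar>t - z\<bar> > 160 \<Longrightarrow> H t \<ge> - W * (1 + 2 * \<bar>t - z\<bar>)"
  shows "d \<le> 128 * \<eta> + W / 4"
proof -
  let ?g = "\<lambda>t. d / 256 * indicator {z-1..z+1} t - W * cubic_tail (z + (-1) * t)"
  have tail: "has_bochner_integral lborel (\<lambda>t. cubic_tail (z + (-1) * t)) (3/1600)"
    using lborel_has_bochner_integral_real_affine_iff[of "-1" cubic_tail "3/1600" z]
      has_bochner_integral_cubic_tail by simp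
  have it: "integrable lborel (\<lambda>t. cubic_tail (z + (-1) * t))" using tail by (simp add: has_bochner_integral_iff)
  have "(LINT t|lborel. ?g t) = d / 128 - W * (3/1600)"
    using tail it by (simp add: has_bochner_integral_iff)
  moreover have "(LINT t|lborel. ?g t) \<le> (LINT t|lborel. H t * jackson (z - t))"
  proof (rule integral_mono)
    show "integrable lborel ?g" using it by (intro Bochner_Integration.integrable_diff integrable_mult_right) auto
    show "integrable lborel (\<lambda>t. H t * jackson (z - t))" by (rule integrable_mult_jackson[OF H])
    show "?g t \<le> H t * jackson (z - t)" for t
    proof (cases "\<bar>t - z\<bar> > 160")
      case True
      define u where "u = \<bar>t - z\<bar>"
      have u: "u > 160" using True by (simp add: u_def)
      have j: "jackson (z - t) \<le> 16 / u ^ 4"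
        using jackson_le_inverse[of "z - t"] True by (simp add: u_def abs_minus_commute)
      have "W * (1 + 2 * u) * jackson (z - t) \<le> W * (1 + 2 * u) * (16 / u ^ 4)"
        using \<open>W \<ge> 0\<close> u by (intro mult_left_mono j) auto
      also have "\<dots> \<le> W * (3 * u) * (16 / u ^ 4)"
        using \<open>W \<ge> 0\<close> u by (intro mult_right_mono mult_left_mono) auto
      also have "\<dots> = W * (48 / u ^ 3)" using u by (simp add: field_simps power4_eq_xxxx power3_eq_cube)
      finally have "- W * (1 + 2 * u) * jackson (z - t) \<ge> - (W * (48 / u ^ 3))" by simp
      moreover have "H t * jackson (z - t) \<ge> - W * (1 + 2 * u) * jackson (z - t)"
        using outer[OF True] by (intro mult_right_mono) (auto simp: jackson_nonneg u_def)
      moreover have "?g t = - (W * (48 / u ^ 3))"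
        using True by (auto simp: cubic_tail_def u_def indicator_def abs_minus_commute)
      ultimately show ?thesis by linarith
    next
      case False
      have t0: "W * cubic_tail (z + (-1) * t) \<ge> 0"
        using \<open>W \<ge> 0\<close> by (simp add: cubic_tail_def)
      have "d / 256 * indicator {z-1..z+1} t \<le> d * jackson (z - t)"
      proof (cases "t \<in> {z-1..z+1}")
        case True
        then have "1 / 256 \<le> jackson (z - t)" by (intro jackson_ge) auto
        then show ?thesis using mult_left_mono[of "1/256" "jackson (z - t)" d] True \<open>d \<ge> 0\<close> by simp
      qed (use \<open>d \<ge> 0\<close> jackson_nonneg in auto)
      also have "\<dots> \<le> H t * jackson (z - t)"
        using False inner by (intro mult_right_mono jackson_nonneg) auto
      finally show ?thesis using t0 by linarith
    qed
  qed
  ultimately show ?thesis using le by (simp add: field_simps) (use \<open>W \<ge> 0\<close> in linarith)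
qed

section \<open>The one-sided Tauberian argument\<close>

definition wt :: "real \<Rightarrow> real \<Rightarrow> real" where
  "wt \<Lambda> t = exp (- t / \<Lambda>) - exp (- 2 * t / \<Lambda>)"

lemma wt_factor: "wt \<Lambda> t = exp (- t / \<Lambda>) * (1 - exp (- t / \<Lambda>))"
  by (simp add: wt_def right_diff_distrib mult_exp_exp)

lemma wt_nonneg: "\<Lambda> > 0 \<Longrightarrow> t \<ge> 0 \<Longrightarrow> wt \<Lambda> t \<ge> 0"
  by (simp add: wt_factor)

lemma wt_le: "wt \<Lambda> t \<le> 1/4"
proof -
  have "0 \<le> (exp (- t / \<Lambda>) - 1/2)\<^sup>2" by simp
  then show ?thesis by (simp add: wt_factor power2_eq_square algebra_simps)
qed

lemma wt_le_exp: "wt \<Lambda> t \<le> exp (- t / \<Lambda>)"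
  by (simp add: wt_def)

lemma mult_wt_le:
  assumes "\<Lambda> > 0" "t \<ge> 0" shows "t * wt \<Lambda> t \<le> \<Lambda>"
proof -
  have "t / \<Lambda> \<le> exp (t / \<Lambda>)" using exp_ge_add_one_self[of "t/\<Lambda>"] by linarith
  then have "t / \<Lambda> * exp (- t / \<Lambda>) \<le> exp (t / \<Lambda>) * exp (- t / \<Lambda>)" by (intro mult_right_mono) auto
  then have "t * exp (- t / \<Lambda>) \<le> \<Lambda>" using assms by (simp add: mult_exp_exp field_simps)
  moreover have "t * wt \<Lambda> t \<le> t * exp (- t / \<Lambda>)" using assms by (intro mult_left_mono wt_le_exp)
  ultimately show ?thesis by linarith
qed

text \<open>In the factored form only the first factor decreases, by exactly this exponential; the
  second one increases.\<close>

lemma wt_shift_ge_exp: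
  assumes "\<Lambda> > 0" "0 \<le> t" "t \<le> t'"
  shows "wt \<Lambda> t' \<ge> exp (- (t' - t) / \<Lambda>) * wt \<Lambda> t"
proof -
  have "exp (- t' / \<Lambda>) \<le> exp (- t / \<Lambda>)" using assms by (simp add: divide_right_mono)
  then have "exp (- t' / \<Lambda>) * (1 - exp (- t' / \<Lambda>)) \<ge> exp (- t' / \<Lambda>) * (1 - exp (- t / \<Lambda>))"
    by (intro mult_left_mono) auto
  moreover have "exp (- (t' - t) / \<Lambda>) * exp (- t / \<Lambda>) = exp (- t' / \<Lambda>)"
    by (simp add: mult_exp_exp diff_divide_distrib)
  ultimately show ?thesis by (simp add: wt_factor mult.assoc[symmetric])
qed

lemma one_minus_le_exp_divide: "1 - (t' - t) / \<Lambda> \<le> exp (- (t' - t) / \<Lambda>)" for \<Lambda> :: real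
proof -
  have "1 + - ((t' - t) / \<Lambda>) \<le> exp (- ((t' - t) / \<Lambda>))" by (rule exp_ge_add_one_self)
  then show ?thesis by (metis add_uminus_conv_diff minus_divide_left)
qed

lemma wt_shift_ge:
  assumes "\<Lambda> > 0" "0 \<le> t" "t \<le> t'"
  shows "wt \<Lambda> t' \<ge> wt \<Lambda> t - (t' - t) / \<Lambda> * wt \<Lambda> t"
proof -
  have "(1 - (t' - t) / \<Lambda>) * wt \<Lambda> t \<le> exp (- (t' - t) / \<Lambda>) * wt \<Lambda> t"
    using wt_nonneg[of \<Lambda> t] assms by (intro mult_right_mono one_minus_le_exp_divide) auto
  then show ?thesis using wt_shift_ge_exp[OF assms] by (simp add: left_diff_distrib)
qed

text \<open>The right side equals \<open>t' * wt \<Lambda> t\<close>: the quotient of the weight by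
  its argument does not increase. Cross-multiplication keeps \<open>t = 0\<close> admissible. This
  is the right measure of growth near 0, where the weight is comparable to
  \<open>t / \<Lambda>\<close>.\<close>

lemma wt_shift_le:
  assumes "\<Lambda> > 0" "0 \<le> t" "t \<le> t'"
  shows "t * wt \<Lambda> t' \<le> t * wt \<Lambda> t + (t' - t) * wt \<Lambda> t"
proof -
  define q where "q = exp (- t / \<Lambda>)"
  define r where "r = exp (- (t' - t) / \<Lambda>)"
  have q: "0 < q" "q \<le> 1" using assms by (auto simp: q_def)
  have r: "0 < r" "r \<le> 1" using assms by (auto simp: r_def divide_nonpos_pos)
  have w: "wt \<Lambda> t = q * (1 - q)" "wt \<Lambda> t' = r * q * (1 - r * q)"
    by (simp_all add: wt_factor q_def r_def mult_exp_exp diff_divide_distrib)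
  \<comment> \<open>Three losses follow: \<open>q * r \<le> 1\<close> in the last factor,
    \<open>1 - r \<le> (t' - t) / \<Lambda>\<close>, and finally
    \<open>(1 + t / \<Lambda>) * q \<le> 1\<close>, which turns the remaining \<open>q\<close> into
    \<open>1 - q\<close>.\<close>
  have "wt \<Lambda> t' - wt \<Lambda> t = q * ((1 - r) * (q * (1 + r) - 1))" by (simp add: w algebra_simps)
  also have "\<dots> \<le> q * ((1 - r) * q)"
    using q r mult_le_one[of q r] by (intro mult_left_mono) (auto simp: algebra_simps)
  finally have "t * (wt \<Lambda> t' - wt \<Lambda> t) \<le> t * (q * ((1 - r) * q))" using assms by (intro mult_left_mono) auto
  also have "\<dots> \<le> t * (q * ((t' - t) / \<Lambda> * q))"
  proof (intro mult_left_mono mult_right_mono)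
    show "1 - r \<le> (t' - t) / \<Lambda>" using one_minus_le_exp_divide[of t' t \<Lambda>] unfolding r_def by linarith
  qed (use assms q in auto)
  also have "\<dots> = q * (t' - t) * (t / \<Lambda> * q)" by (simp add: field_simps)
  also have "\<dots> \<le> q * (t' - t) * (1 - q)"
  proof (rule mult_left_mono)
    have "(1 + t / \<Lambda>) * q \<le> exp (t / \<Lambda>) * q" using q exp_ge_add_one_self by (intro mult_right_mono) auto
    then show "t / \<Lambda> * q \<le> 1 - q" by (simp add: q_def mult_exp_exp algebra_simps)
  qed (use q assms in auto)
  finally show ?thesis by (simp add: w algebra_simps)
qed

text \<open>The setting after rescaling: \<open>\<Lambda>\<close> is T log x, \<open>F\<close> is
  A(x)/x in the scaled logarithmic variable, \<open>p\<close> the weighted main term and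
  \<open>D\<close> the bound for a drop over one unit. The Lipschitz bound for \<open>p\<close>
  starts at \<open>\<Lambda> / 4\<close> because powers with small exponents are singular, or have
  singular derivatives, at 0. Boundedness of \<open>H\<close> is purely qualitative.\<close>

locale tauberian =
  fixes \<Lambda> \<eta> q S Q :: real and F p D H :: "real \<Rightarrow> real"
  assumes \<Lambda>: "\<Lambda> \<ge> 17"
    and H_def: "H = (\<lambda>t. if t < 0 then 0 else wt \<Lambda> t * F t - p t)"
    and integrable_H: "integrable lborel H"
    and bounded_H: "\<exists>B. \<forall>t. \<bar>H t\<bar> \<le> B"
    and smoothed: "\<And>y. \<bar>LINT t|lborel. H t * jackson (y - t)\<bar> \<le> \<eta>"
    and drop: "\<And>t t'. 0 \<le> t \<Longrightarrow> t \<le> t' \<Longrightarrow> F t' - F t \<ge> - (1 + t' - t) * D t"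
    and D_antimono: "\<And>t t'. 0 \<le> t \<Longrightarrow> t \<le> t' \<Longrightarrow> D t' \<le> D t"
    and D_nonneg: "\<And>t. 0 \<le> t \<Longrightarrow> 0 \<le> D t"
    and F_0: "\<bar>F 0\<bar> \<le> S"
    and p_bound: "\<And>t. 0 \<le> t \<Longrightarrow> \<bar>p t\<bar> \<le> Q" and Q_pos: "Q > 0"
    and p_lipschitz: "\<And>t t'. \<Lambda> / 4 \<le> t \<Longrightarrow> \<Lambda> / 4 \<le> t' \<Longrightarrow> \<bar>p t - p t'\<bar> \<le> q * \<bar>t - t'\<bar>" and q_nonneg: "q \<ge> 0"
begin

definition Z where "Z = D 0 + S + Q"
text \<open>Half of \<open>\<Lambda>\<close> corresponds, before rescaling, to the argument sqrt x
  of the remainder. The 1 in the numerator keeps \<open>E\<close> at least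
  \<open>Z / \<Lambda>\<close>, hence positive.\<close>

definition E where "E t = D (\<Lambda> / 2) + \<eta> + q + Z * ((1 + \<bar>t - \<Lambda>\<bar>) / \<Lambda>)"

section \<open>Comparisons with the majorant\<close>

lemma \<eta>_nonneg: "\<eta> \<ge> 0" using smoothed[of 0] by linarith

lemma S_nonneg: "S \<ge> 0" using F_0 by linarith

lemma Z_pos: "Z > 0" and D_le_Z: "D 0 \<le> Z" and S_le_Z: "S \<le> Z" and Q_le_Z: "Q \<le> Z"
  using D_nonneg[of 0] S_nonneg Q_pos by (auto simp: Z_def)

lemma E_ge: "D (\<Lambda> / 2) \<le> E t" "\<eta> \<le> E t" "q \<le> E t" "Z / \<Lambda> \<le> E t" "Z * ((1 + \<bar>t - \<Lambda>\<bar>) / \<Lambda>) \<le> E t" "0 < E t"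
proof -
  have 1: "D (\<Lambda> / 2) \<ge> 0" using \<Lambda> by (intro D_nonneg) auto
  have 2: "Z / \<Lambda> \<le> Z * ((1 + \<bar>t - \<Lambda>\<bar>) / \<Lambda>)" using Z_pos \<Lambda> by (simp add: field_simps)
  have 3: "0 < Z / \<Lambda>" using Z_pos \<Lambda> by simp
  show "D (\<Lambda> / 2) \<le> E t" "\<eta> \<le> E t" "q \<le> E t" "Z / \<Lambda> \<le> E t" "Z * ((1 + \<bar>t - \<Lambda>\<bar>) / \<Lambda>) \<le> E t" "0 < E t"
    using 1 2 3 \<eta>_nonneg q_nonneg unfolding E_def by linarith+
qed

text \<open>From 1 + a + b <= (1 + a)(1 + b). Linear growth is what a kernel with decay of fourth
  order can absorb.\<close>

lemma E_shift: "E t \<le> E y * (1 + \<bar>t - y\<bar>)"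
proof -
  have "(1 + \<bar>t - \<Lambda>\<bar>) \<le> (1 + \<bar>y - \<Lambda>\<bar>) + \<bar>t - y\<bar>" by linarith
  also have "\<dots> \<le> (1 + \<bar>y - \<Lambda>\<bar>) * (1 + \<bar>t - y\<bar>)" by (simp add: algebra_simps)
  finally have "Z * ((1 + \<bar>t - \<Lambda>\<bar>) / \<Lambda>) \<le> Z * ((1 + \<bar>y - \<Lambda>\<bar>) * (1 + \<bar>t - y\<bar>) / \<Lambda>)"
    using Z_pos \<Lambda> by (intro mult_left_mono divide_right_mono) auto
  moreover have "D (\<Lambda>/2) + \<eta> + q \<le> (D (\<Lambda>/2) + \<eta> + q) * (1 + \<bar>t - y\<bar>)"
    using D_nonneg[of "\<Lambda>/2"] \<Lambda> \<eta>_nonneg q_nonneg by (simp add: distrib_left)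
  ultimately show ?thesis unfolding E_def by (simp add: algebra_simps)
qed

text \<open>At distance at least \<open>\<Lambda> / 2\<close> from \<open>\<Lambda>\<close> the
  growth term alone reaches Z/2; every crude bound for small arguments is paid for here.\<close>

lemma Z_le_E: assumes "y \<le> \<Lambda> / 2" shows "Z \<le> 2 * E y"
proof -
  have "1 / 2 \<le> (1 + \<bar>y - \<Lambda>\<bar>) / \<Lambda>" using assms \<Lambda> by (simp add: field_simps)
  then have "Z * (1/2) \<le> Z * ((1 + \<bar>y - \<Lambda>\<bar>) / \<Lambda>)" using Z_pos by (intro mult_left_mono) auto
  then show ?thesis using E_ge(5)[of y] by linarith
qed

lemma D_le_E: assumes "y \<ge> 0" shows "D y \<le> 2 * E y"
proof (cases "y \<le> \<Lambda> / 2")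
  case True
  then show ?thesis using Z_le_E[OF True] D_le_Z D_antimono[of 0 y] assms by linarith
next
  case False
  then have "D y \<le> D (\<Lambda> / 2)" using \<Lambda> by (intro D_antimono) auto
  then show ?thesis using E_ge(1,6)[of y] by linarith
qed

lemma Q_div_le_E: assumes "0 \<le> x" shows "x / \<Lambda> * Q \<le> x * E y"
proof -
  have "Q / \<Lambda> \<le> Z / \<Lambda>" using Q_le_Z \<Lambda> by (simp add: divide_right_mono)
  then have "Q / \<Lambda> \<le> E y" using E_ge(4)[of y] by linarith
  then show ?thesis using mult_left_mono[of "Q/\<Lambda>" "E y" x] assms by simp
qed

text \<open>Left of \<open>\<Lambda> / 2\<close> the trivial bound 2Q is already of the size of
  \<open>E\<close>. If \<open>y\<close> is on the right half and \<open>t\<close> before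
  \<open>\<Lambda> / 4\<close>, their distance is at least \<open>\<Lambda> / 4\<close>, so 2Q is
  charged to the distance, which gives the factor 2 * 4 = 8. Otherwise both points lie in the
  Lipschitz range.\<close>

lemma p_shift:
  assumes "0 \<le> t" "0 \<le> y" shows "\<bar>p t - p y\<bar> \<le> 8 * E y * (1 + \<bar>t - y\<bar>)"
proof -
  have pq: "\<bar>p t - p y\<bar> \<le> 2 * Q" using p_bound[of t] p_bound[of y] assms by linarith
  have pos: "0 \<le> E y * \<bar>t - y\<bar>" "0 < E y" using E_ge(6)[of y] by auto
  consider "y < \<Lambda>/2" | "y \<ge> \<Lambda>/2" "t < \<Lambda>/4" | "y \<ge> \<Lambda>/2" "t \<ge> \<Lambda>/4" by linarith
  then show ?thesis
  proof cases
    case 1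
    then have "2 * Q \<le> 4 * E y" using Z_le_E[of y] Q_le_Z by linarith
    then show ?thesis using pq pos unfolding distrib_left by linarith
  next
    case 2
    then have "1 \<le> 4 * \<bar>t - y\<bar> / \<Lambda>" using \<Lambda> by (simp add: field_simps)
    then have "Q * 1 \<le> Q * (4 * \<bar>t - y\<bar> / \<Lambda>)" using Q_pos by (intro mult_left_mono) auto
    also have "\<dots> = (4 * \<bar>t - y\<bar>) / \<Lambda> * Q" by simp
    also have "\<dots> \<le> (4 * \<bar>t - y\<bar>) * E y" by (rule Q_div_le_E) auto
    finally show ?thesis using pq pos by (simp add: algebra_simps)
  next
    case 3
    then have "\<bar>p t - p y\<bar> \<le> q * \<bar>t - y\<bar>" using \<Lambda> by (intro p_lipschitz) auto
    also have "\<dots> \<le> E y * \<bar>t - y\<bar>" by (intro mult_right_mono E_ge) auto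
    finally show ?thesis using pos by (simp add: distrib_left)
  qed
qed

lemma integrable_neg_H: "integrable lborel (\<lambda>t. - H t)"
  using integrable_H by simp

text \<open>\<open>V\<close> is a provisional bound, improved by the lemmas of this context. The
  threshold is 8 * 640, where 640 is twice the length 320 of a kernel window.\<close>

context
  fixes V assumes V_nonneg: "V \<ge> 0" and V: "\<And>t. \<bar>H t\<bar> \<le> V * E t" and big: "\<Lambda> \<ge> 5120"
begin

lemma wF_le: assumes "y \<ge> 0" shows "wt \<Lambda> y * \<bar>F y\<bar> \<le> V * E y + Q"
proof -
  have "wt \<Lambda> y * \<bar>F y\<bar> = \<bar>wt \<Lambda> y * F y\<bar>" using wt_nonneg[of \<Lambda> y] \<Lambda> assms by (simp add: abs_mult)
  also have "\<dots> = \<bar>H y + p y\<bar>" using assms by (simp add: H_def)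
  finally show ?thesis using V[of y] p_bound[OF assms] by linarith
qed

text \<open>The cost of letting the weight vary. Shifts up to 640 are allowed because the relative
  change of the weight on the right half is up to \<open>2 * \<delta> / \<Lambda>\<close> with
  \<open>\<delta> \<le> 320\<close>. The part with \<open>V\<close> shrinks to 1/8; the part with
  \<open>Q\<close> is covered by the summand \<open>Z / \<Lambda>\<close> of
  \<open>E\<close>.\<close>

lemma wF_shift_le:
  assumes "y \<ge> 0" "0 \<le> \<delta>" "\<delta> \<le> 640" shows "\<delta> / \<Lambda> * (wt \<Lambda> y * \<bar>F y\<bar>) \<le> V * E y / 8 + 640 * E y"
proof -
  have pos: "0 \<le> V * E y" using V_nonneg E_ge(6)[of y] by simp
  have "\<delta> / \<Lambda> * (wt \<Lambda> y * \<bar>F y\<bar>) \<le> \<delta> / \<Lambda> * (V * E y + Q)"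
    using assms \<Lambda> by (intro mult_left_mono wF_le) auto
  also have "\<dots> = \<delta> / \<Lambda> * (V * E y) + \<delta> / \<Lambda> * Q" by (simp add: distrib_left)
  also have "\<delta> / \<Lambda> * (V * E y) \<le> 1/8 * (V * E y)"
    using pos assms big by (intro mult_right_mono) (auto simp: field_simps)
  also have "\<delta> / \<Lambda> * Q \<le> \<delta> * E y" by (rule Q_div_le_E) (use assms in auto)
  also have "\<delta> * E y \<le> 640 * E y" using assms E_ge(6)[of y] by (intro mult_right_mono) auto
  finally show ?thesis by simp
qed

text \<open>The factor 2 comes from |t - y| <= |t - z| + 160 <= 2 |t - z|; it moves the growth of
  \<open>E\<close> from \<open>y\<close> to the centre \<open>z\<close> of the window.\<close>

lemma outer_bound:
  assumes "\<bar>z - y\<bar> \<le> 160" "\<bar>t - z\<bar> > 160"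
  shows "\<bar>H t\<bar> \<le> V * E y * (1 + 2 * \<bar>t - z\<bar>)"
proof -
  have "\<bar>H t\<bar> \<le> V * (E y * (1 + \<bar>t - y\<bar>))" using V[of t] mult_left_mono[OF E_shift V_nonneg] by (rule order_trans)
  also have "\<dots> \<le> V * (E y * (1 + 2 * \<bar>t - z\<bar>))"
  proof (intro mult_left_mono)
    show "1 + \<bar>t - y\<bar> \<le> 1 + 2 * \<bar>t - z\<bar>"
      using assms abs_triangle_ineq[of "t - z" "z - y"] by simp
  qed (use V_nonneg E_ge(6)[of y] in auto)
  finally show ?thesis by simp
qed

text \<open>With centre \<open>y + 160\<close> the inner window is [y, y + 320], to the right of
  \<open>y\<close>. There \<open>F\<close> cannot have dropped much, so a large \<open>H y\<close>
  would make the whole window large.\<close>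

lemma upper_step:
  assumes y: "y \<ge> 0" shows "H y \<le> (60000 + V / 2) * E y"
proof -
  have E: "E y > 0" by (rule E_ge)
  have VE: "V * E y \<ge> 0" using E V_nonneg by simp
  have Hy: "H y = wt \<Lambda> y * F y - p y" using y by (simp add: H_def)
  show ?thesis
  \<comment> \<open>A negative \<open>F y\<close> is harmed by an increasing weight, and the
    relative increase is under control only for \<open>y \<ge> \<Lambda> / 2\<close>. In the
    excluded case the sign of \<open>F y\<close> already bounds \<open>H y\<close> by
    \<open>Q\<close>.\<close>
  proof (cases "F y < 0 \<and> y < \<Lambda> / 2")
    case True
    then have "wt \<Lambda> y * F y \<le> 0" using wt_nonneg[of \<Lambda> y] y \<Lambda> by (simp add: mult_nonneg_nonpos)
    then have "H y \<le> Q" using p_bound[OF y] Hy by linarith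
    also have "Q \<le> 2 * E y" using Z_le_E[of y] Q_le_Z True by linarith
    finally show ?thesis using E VE by (simp add: distrib_right)
  next
    case False
    \<comment> \<open>3400 covers 161 for the drop (a quarter of 321 * 2), 2568 = 8 * 321 for
      \<open>p\<close> and 640 for the weight; V/8 is the other part of the weight's cost.\<close>
    define d where "d = H y - 3400 * E y - V * E y / 8"
    have inner: "H t \<ge> d" if t: "\<bar>t - (y + 160)\<bar> \<le> 160" for t
    proof -
      define \<delta> where "\<delta> = t - y"
      have \<delta>: "0 \<le> \<delta>" "\<delta> \<le> 320" "t = y + \<delta>" using t by (auto simp: \<delta>_def)
      have w: "0 \<le> wt \<Lambda> t" "wt \<Lambda> t \<le> 1/4" using wt_nonneg[of \<Lambda> t] wt_le[of \<Lambda> t] y \<delta> \<Lambda> by auto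
      have dD: "0 \<le> (1 + \<delta>) * D y" using D_nonneg[OF y] \<delta> by auto
      have "- ((1 + \<delta>) * D y) \<le> F t - F y" using drop[of y t] y \<delta> by (simp add: algebra_simps)
      then have "wt \<Lambda> t * (F t - F y) \<ge> wt \<Lambda> t * (- ((1 + \<delta>) * D y))" using w by (intro mult_left_mono) auto
      moreover have "wt \<Lambda> t * ((1 + \<delta>) * D y) \<le> 1/4 * ((1 + \<delta>) * D y)" using w dD by (intro mult_right_mono)
      moreover have "(1 + \<delta>) * D y \<le> 321 * (2 * E y)"
        using \<delta> D_le_E[OF y] D_nonneg[OF y] by (intro mult_mono) auto
      ultimately have 1: "wt \<Lambda> t * (F t - F y) \<ge> - 161 * E y" using E by linarith
      have "8 * E y * (1 + \<bar>t - y\<bar>) \<le> 8 * E y * 321" using E \<delta> by (intro mult_left_mono) auto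
      then have 2: "\<bar>p t - p y\<bar> \<le> 2568 * E y" using p_shift[of t y] y \<delta> by linarith
      have 3: "(wt \<Lambda> t - wt \<Lambda> y) * F y \<ge> - (V * E y / 8 + 640 * E y)"
      proof (cases "F y \<ge> 0")
        case True
        have "wt \<Lambda> t - wt \<Lambda> y \<ge> - (\<delta> / \<Lambda> * wt \<Lambda> y)" using wt_shift_ge[of \<Lambda> y t] y \<delta> \<Lambda> by simp
        then have "(wt \<Lambda> t - wt \<Lambda> y) * F y \<ge> - (\<delta> / \<Lambda> * wt \<Lambda> y) * F y" using True by (intro mult_right_mono)
        moreover have "\<delta> / \<Lambda> * (wt \<Lambda> y * \<bar>F y\<bar>) \<le> V * E y / 8 + 640 * E y" using \<delta> y by (intro wF_shift_le) auto
        ultimately show ?thesis using True by simp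
      next
        case neg: False
        then have y2: "y \<ge> \<Lambda> / 2" using False by auto
        then have "y > 0" using \<Lambda> by linarith
        have "y * (wt \<Lambda> t - wt \<Lambda> y) \<le> \<delta> * wt \<Lambda> y" using wt_shift_le[of \<Lambda> y t] y \<delta> \<Lambda> by (simp add: algebra_simps)
        then have "wt \<Lambda> t - wt \<Lambda> y \<le> \<delta> * wt \<Lambda> y / y" using \<open>y > 0\<close> by (simp add: field_simps)
        also have "\<dots> \<le> \<delta> * wt \<Lambda> y / (\<Lambda> / 2)"
          using \<delta> y2 \<Lambda> wt_nonneg[of \<Lambda> y] y by (intro divide_left_mono) auto
        also have "\<dots> = 2 * \<delta> / \<Lambda> * wt \<Lambda> y" by simp
        finally have "(wt \<Lambda> t - wt \<Lambda> y) * F y \<ge> (2 * \<delta> / \<Lambda> * wt \<Lambda> y) * F y" using neg by (intro mult_right_mono_neg) auto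
        moreover have "2 * \<delta> / \<Lambda> * (wt \<Lambda> y * \<bar>F y\<bar>) \<le> V * E y / 8 + 640 * E y" using \<delta> y by (intro wF_shift_le) auto
        ultimately show ?thesis using neg by simp
      qed
      have "H t = H y + wt \<Lambda> t * (F t - F y) + (wt \<Lambda> t - wt \<Lambda> y) * F y - (p t - p y)"
        using y \<delta> by (simp add: H_def algebra_simps)
      then show ?thesis using 1 2 3 E unfolding d_def by linarith
    qed
    show ?thesis
    proof (cases "d \<ge> 0")
      case True
      \<comment> \<open>Together with the V/8 inside \<open>d\<close> this totals 3V/8, below the
        V/2 of the claim.\<close>
      have "d \<le> 128 * \<eta> + (V * E y) / 4"
      proof (rule jackson_window[OF integrable_H _ inner True VE])
        show "(LINT t|lborel. H t * jackson (y + 160 - t)) \<le> \<eta>" using smoothed[of "y + 160"] by linarith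
        show "- (V * E y) * (1 + 2 * \<bar>t - (y + 160)\<bar>) \<le> H t" if "160 < \<bar>t - (y + 160)\<bar>" for t
          using outer_bound[OF _ that, of y] by (simp add: abs_le_iff)
      qed auto
      then show ?thesis using E_ge(2)[of y] E VE unfolding d_def distrib_right by linarith
    next
      case False
      then show ?thesis using E VE unfolding d_def distrib_right by linarith
    qed
  qed
qed

text \<open>The mirror image: the window [y - 320, y] lies to the left, where \<open>F\<close>
  cannot be much larger than at \<open>y\<close>. The modulus is now taken at the earlier point, so
  \<open>E_shift\<close> adds a factor 321 to the cost of the drop.\<close>

lemma lower_step:
  assumes y: "y \<ge> 0" shows "- H y \<le> (60000 + V / 2) * E y"
proof -
  have E: "E y > 0" by (rule E_ge)
  have VE: "V * E y \<ge> 0" using E V_nonneg by simp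
  have Hy: "H y = wt \<Lambda> y * F y - p y" using y by (simp add: H_def)
  show ?thesis
  \<comment> \<open>2560 is half the threshold for \<open>\<Lambda>\<close>, so smaller
    \<open>y\<close> are on the left half and the crude bound by \<open>Z\<close> applies. For
    larger \<open>y\<close> the window stays in the half-line of nonnegative arguments and 320/y is
    at most 1/8.\<close>
  proof (cases "y < 2560")
    case True
    have w: "0 \<le> wt \<Lambda> y" "wt \<Lambda> y \<le> 1" using wt_nonneg[of \<Lambda> y] wt_le[of \<Lambda> y] y \<Lambda> by auto
    have ZE: "Z \<le> 2 * E y" using Z_le_E[of y] True big by linarith
    have "(1 + y) * D 0 \<le> 2561 * Z" using True y D_nonneg[of 0] D_le_Z by (intro mult_mono) auto
    then have "F y \<ge> - (2562 * Z)" using drop[of 0 y] y F_0 S_le_Z by (simp add: algebra_simps abs_le_iff)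
    then have "wt \<Lambda> y * F y \<ge> wt \<Lambda> y * (- (2562 * Z))" using w by (intro mult_left_mono)
    moreover have "wt \<Lambda> y * (2562 * Z) \<le> 1 * (2562 * Z)" using w Z_pos by (intro mult_right_mono) auto
    ultimately have "- H y \<le> 2563 * Z" using Hy p_bound[OF y] Q_le_Z by linarith
    then show ?thesis using ZE E VE unfolding distrib_right by linarith
  next
    case False
    \<comment> \<open>56000 covers 51521 for the drop (a quarter of 321 * 642), 2568 for
      \<open>p\<close> and 640 for the weight.\<close>
    define d where "d = - H y - 56000 * E y - V * E y / 8"
    have inner: "- H t \<ge> d" if t: "\<bar>t - (y - 160)\<bar> \<le> 160" for t
    proof -
      define \<delta> where "\<delta> = y - t"
      have \<delta>: "0 \<le> \<delta>" "\<delta> \<le> 320" "y = t + \<delta>" "0 \<le> t" using t False by (auto simp: \<delta>_def)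
      have w: "0 \<le> wt \<Lambda> t" "wt \<Lambda> t \<le> 1/4" using wt_nonneg[of \<Lambda> t] wt_le[of \<Lambda> t] \<delta> \<Lambda> by auto
      have wy: "0 \<le> wt \<Lambda> y" using wt_nonneg[of \<Lambda> y] y \<Lambda> by auto
      have Dt: "D t \<le> 642 * E y"
      proof -
        have "E y * (1 + \<bar>t - y\<bar>) \<le> E y * 321" using E \<delta> by (intro mult_left_mono) auto
        then show ?thesis using D_le_E[OF \<delta>(4)] E_shift[of t y] by linarith
      qed
      have dD: "0 \<le> (1 + \<delta>) * D t" using D_nonneg[OF \<delta>(4)] \<delta> by auto
      have "F t - F y \<le> (1 + \<delta>) * D t" using drop[of t y] \<delta> by (auto simp: algebra_simps)
      then have "wt \<Lambda> t * (F t - F y) \<le> wt \<Lambda> t * ((1 + \<delta>) * D t)" using w by (intro mult_left_mono) auto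
      moreover have "wt \<Lambda> t * ((1 + \<delta>) * D t) \<le> 1/4 * ((1 + \<delta>) * D t)" using w dD by (intro mult_right_mono)
      moreover have "(1 + \<delta>) * D t \<le> 321 * (642 * E y)"
        using \<delta> Dt D_nonneg[OF \<delta>(4)] by (intro mult_mono) auto
      ultimately have 1: "wt \<Lambda> t * (F t - F y) \<le> 51521 * E y" using E by linarith
      have "8 * E y * (1 + \<bar>t - y\<bar>) \<le> 8 * E y * 321" using E \<delta> by (intro mult_left_mono) auto
      then have 2: "\<bar>p t - p y\<bar> \<le> 2568 * E y" using p_shift[of t y] y \<delta> by linarith
      have up: "wt \<Lambda> t - wt \<Lambda> y \<le> 2 * \<delta> / \<Lambda> * wt \<Lambda> y"
      proof -
        have ge: "wt \<Lambda> y \<ge> wt \<Lambda> t - \<delta> / \<Lambda> * wt \<Lambda> t" using wt_shift_ge[of \<Lambda> t y] \<delta> \<Lambda> by simp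
        have "\<delta> / \<Lambda> \<le> 1/2" using \<delta> big by (simp add: field_simps)
        then have "\<delta> / \<Lambda> * wt \<Lambda> t \<le> 1/2 * wt \<Lambda> t" using w by (intro mult_right_mono)
        then have "wt \<Lambda> t \<le> 2 * wt \<Lambda> y" using ge by linarith
        then have "\<delta> / \<Lambda> * wt \<Lambda> t \<le> \<delta> / \<Lambda> * (2 * wt \<Lambda> y)" using \<delta> \<Lambda> by (intro mult_left_mono) auto
        then show ?thesis using ge by (simp add: mult_ac)
      qed
      have lo: "wt \<Lambda> t - wt \<Lambda> y \<ge> - (\<delta> / y * wt \<Lambda> y)"
      proof (cases "t = 0")
        case True
        then show ?thesis using w \<delta> False by simp
      next
        case nz: False
        then have tp: "t > 0" using \<delta> by auto
        have "t * wt \<Lambda> y \<le> y * wt \<Lambda> t" using wt_shift_le[of \<Lambda> t y] \<delta> \<Lambda> by (simp add: algebra_simps)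
        then have "t / y * wt \<Lambda> y \<le> wt \<Lambda> t" using False by (simp add: field_simps)
        moreover have "t / y = 1 - \<delta> / y" using False \<delta> by (simp add: field_simps)
        ultimately show ?thesis by (simp add: left_diff_distrib)
      qed
      have 3: "(wt \<Lambda> t - wt \<Lambda> y) * F y \<le> V * E y / 8 + 640 * E y"
      \<comment> \<open>On the right half both directions of change are at most
        \<open>2 * \<delta> / \<Lambda>\<close>. On the left half the change
        \<open>\<delta> / y\<close> is only known to be at most 1/8, but there
        \<open>Q \<le> 2 * E y\<close>, so this is enough.\<close>
      proof (cases "y \<ge> \<Lambda> / 2")
        case True
        have "\<delta> / y \<le> \<delta> / (\<Lambda> / 2)" using True \<delta> \<Lambda> y False by (intro divide_left_mono) auto
        then have "\<delta> / y \<le> 2 * \<delta> / \<Lambda>" by (simp add: mult.commute)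
        then have "\<delta> / y * wt \<Lambda> y \<le> 2 * \<delta> / \<Lambda> * wt \<Lambda> y" using wy by (intro mult_right_mono) auto
        then have "\<bar>wt \<Lambda> t - wt \<Lambda> y\<bar> \<le> 2 * \<delta> / \<Lambda> * wt \<Lambda> y" using up lo by linarith
        then have "\<bar>wt \<Lambda> t - wt \<Lambda> y\<bar> * \<bar>F y\<bar> \<le> 2 * \<delta> / \<Lambda> * wt \<Lambda> y * \<bar>F y\<bar>" by (intro mult_right_mono) auto
        moreover have "2 * \<delta> / \<Lambda> * (wt \<Lambda> y * \<bar>F y\<bar>) \<le> V * E y / 8 + 640 * E y" using \<delta> y by (intro wF_shift_le) auto
        ultimately show ?thesis using abs_ge_self[of "(wt \<Lambda> t - wt \<Lambda> y) * F y"] by (simp add: abs_mult)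
      next
        case small: False
        have "2 * \<delta> / \<Lambda> \<le> \<delta> / y"
        proof -
          have "\<delta> / (\<Lambda> / 2) \<le> \<delta> / y" using small \<delta> \<Lambda> y False by (intro divide_left_mono) auto
          then show ?thesis by (simp add: mult.commute)
        qed
        then have "2 * \<delta> / \<Lambda> * wt \<Lambda> y \<le> \<delta> / y * wt \<Lambda> y" using wy by (intro mult_right_mono) auto
        then have a: "\<bar>wt \<Lambda> t - wt \<Lambda> y\<bar> \<le> \<delta> / y * wt \<Lambda> y" using up lo by linarith
        have "\<delta> / y * wt \<Lambda> y \<le> 1/8 * wt \<Lambda> y" using wy \<delta> False by (intro mult_right_mono) (auto simp: field_simps)
        with a have "\<bar>wt \<Lambda> t - wt \<Lambda> y\<bar> \<le> 1/8 * wt \<Lambda> y" by (rule order_trans)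
        then have "\<bar>wt \<Lambda> t - wt \<Lambda> y\<bar> * \<bar>F y\<bar> \<le> 1/8 * wt \<Lambda> y * \<bar>F y\<bar>" by (intro mult_right_mono) auto
        moreover have "wt \<Lambda> y * \<bar>F y\<bar> \<le> V * E y + Q" by (rule wF_le[OF y])
        moreover have "Q \<le> 2 * E y" using Z_le_E[of y] Q_le_Z small by linarith
        ultimately show ?thesis using E abs_ge_self[of "(wt \<Lambda> t - wt \<Lambda> y) * F y"] unfolding abs_mult by linarith
      qed
      have "H t = H y + wt \<Lambda> t * (F t - F y) + (wt \<Lambda> t - wt \<Lambda> y) * F y - (p t - p y)"
        using y \<delta> by (simp add: H_def algebra_simps)
      then show ?thesis using 1 2 3 E unfolding d_def by linarith
    qed
    show ?thesis
    proof (cases "d \<ge> 0")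
      case True
      have "d \<le> 128 * \<eta> + (V * E y) / 4"
      proof (rule jackson_window[OF integrable_neg_H _ inner True VE])
        show "(LINT t|lborel. - H t * jackson (y - 160 - t)) \<le> \<eta>" using smoothed[of "y - 160"] by (simp add: abs_le_iff)
        show "- (V * E y) * (1 + 2 * \<bar>t - (y - 160)\<bar>) \<le> - H t" if "160 < \<bar>t - (y - 160)\<bar>" for t
          using outer_bound[OF _ that, of y] by (simp add: abs_le_iff)
      qed auto
      then show ?thesis using E_ge(2)[of y] E VE unfolding d_def distrib_right by linarith
    next
      case False
      then show ?thesis using E VE unfolding d_def distrib_right by linarith
    qed
  qed
qed

lemma abs_step: "\<bar>H y\<bar> \<le> (60000 + V / 2) * E y"
proof (cases "y < 0")
  case True
  then show ?thesis using E_ge(6)[of y] V_nonneg by (simp add: H_def)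
next
  case False
  then show ?thesis using upper_step[of y] lower_step[of y] by (auto simp: abs_le_iff)
qed

end

text \<open>The least admissible \<open>V\<close> is finite, since \<open>H\<close> is bounded and
  \<open>E\<close> is at least \<open>Z / \<Lambda>\<close>. Feeding it into \<open>abs_step\<close>
  gives V <= 60000 + V/2.\<close>

lemma large_case:
  assumes "\<Lambda> \<ge> 5120" shows "\<bar>H y\<bar> \<le> 120000 * E y"
proof -
  obtain B where B: "\<And>t. \<bar>H t\<bar> \<le> B" using bounded_H by blast
  have quot: "\<bar>H t\<bar> / E t \<le> B / (Z / \<Lambda>)" for t
    using B[of t] E_ge(4,6)[of t] Z_pos \<Lambda> by (intro frac_le) auto
  define V where "V = (SUP t. \<bar>H t\<bar> / E t)"
  have bdd: "bdd_above (range (\<lambda>t. \<bar>H t\<bar> / E t))" using quot by (intro bdd_aboveI2)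
  have V: "\<bar>H t\<bar> / E t \<le> V" for t unfolding V_def by (intro cSUP_upper bdd) auto
  have "V \<ge> 0" using V[of 0] E_ge(6)[of 0] by (smt (verit) divide_nonneg_pos)
  have V': "\<bar>H t\<bar> \<le> V * E t" for t using V[of t] E_ge(6)[of t] by (simp add: field_simps)
  have "\<bar>H t\<bar> / E t \<le> 60000 + V / 2" for t
    using abs_step[OF \<open>V \<ge> 0\<close> V' assms, of t] E_ge(6)[of t] by (simp add: field_simps)
  then have "V \<le> 60000 + V / 2" unfolding V_def by (intro cSUP_least) auto
  then have "V \<le> 120000" by linarith
  then have "V * E y \<le> 120000 * E y" using E_ge(6)[of y] by (intro mult_right_mono) auto
  then show ?thesis using V'[of y] by linarith
qed

text \<open>For bounded \<open>\<Lambda>\<close> an error of order \<open>Z\<close> is admissible.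
  The linear drop of \<open>F\<close> is compensated by
  \<open>t * wt \<Lambda> t \<le> \<Lambda>\<close>, so \<open>H\<close> is bounded below
  everywhere; a single window to the right of \<open>\<Lambda>\<close> then bounds
  \<open>F \<Lambda>\<close> from above.\<close>

lemma small_case:
  assumes "\<Lambda> \<le> 5120" shows "\<bar>H \<Lambda>\<bar> \<le> exp 20 * 10000 * (\<eta> + Z)"
proof -
  \<comment> \<open>5120 from the bound on \<open>\<Lambda>\<close>, and one \<open>Z\<close> each
    for \<open>S\<close>, \<open>D 0\<close> and \<open>Q\<close>.\<close>
  have H_lower: "H t \<ge> - (5123 * Z)" for t
  proof (cases "t < 0")
    case True
    then show ?thesis using Z_pos by (simp add: H_def)
  next
    case False
    then have t: "t \<ge> 0" by simp
    have w: "0 \<le> wt \<Lambda> t" "wt \<Lambda> t \<le> 1" using wt_nonneg[of \<Lambda> t] wt_le[of \<Lambda> t] t \<Lambda> by auto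
    have "F t \<ge> - S - (1 + t) * D 0" using drop[of 0 t] t F_0 by (auto simp: algebra_simps)
    then have "wt \<Lambda> t * F t \<ge> wt \<Lambda> t * (- S - (1 + t) * D 0)" using w by (intro mult_left_mono)
    then have 1: "- (wt \<Lambda> t * (S + D 0)) - t * wt \<Lambda> t * D 0 \<le> wt \<Lambda> t * F t"
      by (simp add: algebra_simps)
    have 2: "wt \<Lambda> t * (S + D 0) \<le> 1 * (S + D 0)" using w S_nonneg D_nonneg[of 0] by (intro mult_right_mono) auto
    have 3: "t * wt \<Lambda> t * D 0 \<le> \<Lambda> * D 0" using mult_wt_le[of \<Lambda> t] \<Lambda> t D_nonneg[of 0] by (intro mult_right_mono) auto
    have 4: "\<Lambda> * D 0 \<le> 5120 * Z" using assms \<Lambda> D_le_Z D_nonneg[of 0] by (intro mult_mono) auto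
    \<comment> \<open>The variables stand for the products in facts 1 to 4, which turns their
      combination into linear arithmetic.\<close>
    have "- c - e \<le> f" if "- a - b \<le> f" "a \<le> 1 * c" "b \<le> d" "d \<le> e" for a b c d e f :: real
      using that by linarith
    from this[OF 1 2 3 4] have "wt \<Lambda> t * F t \<ge> - (S + D 0) - 5120 * Z" .
    then show ?thesis using p_bound[OF t] t S_le_Z D_le_Z Q_le_Z by (simp add: H_def)
  qed
  define w0 where "w0 = wt \<Lambda> \<Lambda>"
  have w0: "0 \<le> w0" "w0 \<le> 1/4" using wt_nonneg[of \<Lambda> \<Lambda>] wt_le[of \<Lambda> \<Lambda>] \<Lambda> by (auto simp: w0_def)
  \<comment> \<open>A lower bound for \<open>F\<close> on the whole window: its length 320 costs 1 +
    320 times the modulus.\<close>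
  define x where "x = F \<Lambda> - 321 * D 0"
  have "exp (-20) * (w0 * x) \<le> 128 * \<eta> + 1282 * Z"
  proof (cases "exp (-20) * (w0 * x) - Q \<ge> 0")
    case True
    then have "0 < exp (-20) * (w0 * x)" using Q_pos by linarith
    then have "w0 * x > 0" by (rule zero_less_mult_pos) simp
    then have "x > 0" using w0 by (simp add: zero_less_mult_iff)
    have "exp (-20) * (w0 * x) - Q \<le> 128 * \<eta> + (5123 * Z) / 4"
    proof (rule jackson_window[OF integrable_H, of "\<Lambda> + 160"])
      show "(LINT t|lborel. H t * jackson (\<Lambda> + 160 - t)) \<le> \<eta>" using smoothed[of "\<Lambda> + 160"] by linarith
      show "exp (-20) * (w0 * x) - Q \<le> H t" if t: "\<bar>t - (\<Lambda> + 160)\<bar> \<le> 160" for t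
      proof -
        have t': "\<Lambda> \<le> t" "t \<le> \<Lambda> + 320" using t by auto
        have w: "0 \<le> wt \<Lambda> t" using wt_nonneg[of \<Lambda> t] t' \<Lambda> by auto
        have "F t \<ge> x"
        proof -
          have "(1 + t - \<Lambda>) * D \<Lambda> \<le> 321 * D 0" using t' \<Lambda> D_antimono[of 0 \<Lambda>] D_nonneg[of \<Lambda>] by (intro mult_mono) auto
          then show ?thesis using drop[of \<Lambda> t] t' \<Lambda> unfolding x_def by (simp add: algebra_simps)
        qed
        then have 1: "wt \<Lambda> t * F t \<ge> wt \<Lambda> t * x" using w by (intro mult_left_mono)
        \<comment> \<open>Here \<open>\<Lambda> \<ge> 17\<close> enters: 320/17 < 20.\<close>
        have e: "exp (-20) \<le> exp (- (t - \<Lambda>) / \<Lambda>)" using t' \<Lambda> by (simp add: field_simps)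
        have 2: "wt \<Lambda> t * x \<ge> exp (-20) * (w0 * x)"
        proof -
          have "exp (-20) * w0 \<le> exp (- (t - \<Lambda>) / \<Lambda>) * w0" using e w0 by (intro mult_right_mono)
          also have "\<dots> \<le> wt \<Lambda> t" unfolding w0_def using t' \<Lambda> by (intro wt_shift_ge_exp) auto
          finally show ?thesis using \<open>x > 0\<close> mult_right_mono[of "exp (-20) * w0" "wt \<Lambda> t" x] by (simp add: mult.assoc)
        qed
        have "H t = wt \<Lambda> t * F t - p t" using t' \<Lambda> by (simp add: H_def)
        then show ?thesis using 1 2 p_bound[of t] t' \<Lambda> by auto
      qed
      show "- (5123 * Z) * (1 + 2 * \<bar>t - (\<Lambda> + 160)\<bar>) \<le> H t" for t
      proof -
        have "5123 * Z * 1 \<le> 5123 * Z * (1 + 2 * \<bar>t - (\<Lambda> + 160)\<bar>)" using Z_pos by (intro mult_left_mono) auto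
        then show ?thesis using H_lower[of t] by simp
      qed
    qed (use True Z_pos in auto)
    then show ?thesis using Q_le_Z Z_pos by linarith
  next
    case False
    then show ?thesis using Q_le_Z \<eta>_nonneg Z_pos by linarith
  qed
  then have "exp 20 * (exp (-20) * (w0 * x)) \<le> exp 20 * (128 * \<eta> + 1282 * Z)" by (intro mult_left_mono) auto
  also have "exp 20 * (exp (-20) * (w0 * x)) = w0 * x" by (simp add: mult.assoc[symmetric] mult_exp_exp)
  finally have "w0 * F \<Lambda> \<le> exp 20 * (128 * \<eta> + 1282 * Z) + w0 * (321 * D 0)" by (simp add: x_def algebra_simps)
  also have "w0 * (321 * D 0) \<le> 1 * (321 * Z)" using w0 D_le_Z D_nonneg[of 0] by (intro mult_mono) auto
  finally have up: "H \<Lambda> \<le> exp 20 * (128 * \<eta> + 1282 * Z) + 322 * Z"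
    using p_bound[of \<Lambda>] Q_le_Z \<Lambda> by (simp add: H_def w0_def)
  have "1 * Z \<le> exp 20 * Z" using Z_pos by (intro mult_right_mono) auto
  moreover have "0 \<le> exp 20 * \<eta>" using \<eta>_nonneg by simp
  moreover have "exp 20 * 10000 * (\<eta> + Z) = 10000 * (exp 20 * \<eta>) + 10000 * (exp 20 * Z)"
    "exp 20 * (128 * \<eta> + 1282 * Z) = 128 * (exp 20 * \<eta>) + 1282 * (exp 20 * Z)"
    by (simp_all add: algebra_simps)
  ultimately show ?thesis using up H_lower[of \<Lambda>] Z_pos unfolding abs_le_iff by linarith
qed

text \<open>In the bounded case \<open>Z\<close> is at most 5120 \<open>Z / \<Lambda>\<close>, hence
  at most 5120 \<open>E \<Lambda>\<close>; rounding up, 10^4 * 10^4 gives the common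
  constant.\<close>

theorem H_bound: "\<bar>H \<Lambda>\<bar> \<le> exp 20 * 10 ^ 8 * E \<Lambda>"
proof (cases "\<Lambda> \<ge> 5120")
  case True
  have "120000 * E \<Lambda> \<le> exp 20 * 10 ^ 8 * E \<Lambda>"
    using E_ge(6)[of \<Lambda>] exp_ge_add_one_self[of 20] by (intro mult_right_mono) auto
  then show ?thesis using large_case[OF True, of \<Lambda>] by linarith
next
  case False
  have "Z \<le> 5120 * (Z / \<Lambda>)" using False \<Lambda> Z_pos by (simp add: field_simps)
  then have "\<eta> + Z \<le> 10000 * E \<Lambda>" using E_ge(2,4,6)[of \<Lambda>] by linarith
  then have "exp 20 * 10000 * (\<eta> + Z) \<le> exp 20 * 10000 * (10000 * E \<Lambda>)" by (intro mult_left_mono) auto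
  moreover have "exp 20 * 10000 * (10000 * E \<Lambda>) = exp 20 * 10 ^ 8 * E \<Lambda>" by simp
  ultimately show ?thesis using small_case False by linarith
qed

end

section \<open>Laplace transforms of powers\<close>

lemma has_bochner_integral_Gamma:
  fixes w r :: real
  assumes "w > -1" "r > 0"
  shows "has_bochner_integral lborel (\<lambda>t. indicator {0..} t * (t powr w * exp (- (r * t)))) (Gamma (w + 1) / r powr (w + 1))"
proof -
  let ?f = "\<lambda>t. indicator {0..} t * (t powr w * exp (- t)) :: real"
  have "(\<integral>\<^sup>+t. ennreal (?f t) \<partial>lborel) = ennreal (Gamma (w + 1))"
    using Gamma_conv_nn_integral_real[of "w + 1"] assms by (simp add: exp_minus divide_inverse mult.assoc)
  moreover have "Gamma (w + 1) > 0" using assms by (intro Gamma_real_pos) auto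
  ultimately have "has_bochner_integral lborel ?f (Gamma (w + 1))"
    by (intro has_bochner_integral_nn_integral) auto
  then have "has_bochner_integral lborel (\<lambda>t. ?f (0 + r * t)) (Gamma (w + 1) /\<^sub>R \<bar>r\<bar>)"
    using lborel_has_bochner_integral_real_affine_iff[of r ?f "Gamma (w+1)" 0] assms by simp
  from has_bochner_integral_mult_right[OF this, of "inverse (r powr w)"]
  have "has_bochner_integral lborel (\<lambda>t. inverse (r powr w) * ?f (0 + r * t)) (Gamma (w + 1) / r powr (w + 1))"
    using assms by (simp add: powr_add field_simps)
  moreover have "(\<lambda>t. inverse (r powr w) * ?f (0 + r * t)) = (\<lambda>t. indicator {0..} t * (t powr w * exp (- (r * t))))"
    using assms by (auto simp: indicator_def powr_mult zero_le_mult_iff fun_eq_iff)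
  ultimately show ?thesis by (simp only:)
qed

lemma has_bochner_integral_laplace_powr:
  fixes w :: real and a :: complex
  assumes w: "w > -1" and a: "Re a > 0"
  shows "has_bochner_integral lborel (\<lambda>t. indicator {0..} t *\<^sub>R (of_real (t powr w) * exp (- (a * of_real t))))
           (of_real (Gamma (w + 1)) / a powr of_real (w + 1))"
proof -
  \<comment> \<open>A real \<open>r\<close> with \<open>\<bar>r - a\<bar> < r\<close> exists for every \<open>a\<close> in the right half-plane; expanding
     \<open>e\<^sup>(\<^sup>r\<^sup>-\<^sup>a\<^sup>)\<^sup>t\<close> and integrating termwise gives the binomial series of \<open>(1 - (r - a) / r) powr (- w - 1)\<close>.\<close>
  define r where "r = (norm a)\<^sup>2 / Re a"
  have "a \<noteq> 0" using a by auto
  then have r: "r > 0" using a by (simp add: r_def)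
  have "(norm (of_real r - a))\<^sup>2 = (r - Re a)\<^sup>2 + (Im a)\<^sup>2" by (simp add: cmod_power2)
  also have "\<dots> = r\<^sup>2 - 2 * (r * Re a) + (norm a)\<^sup>2" by (simp add: cmod_power2) (simp add: power2_eq_square algebra_simps)
  also have "r * Re a = (norm a)\<^sup>2" using a by (simp add: r_def)
  finally have "(norm (of_real r - a))\<^sup>2 < r\<^sup>2" using \<open>a \<noteq> 0\<close> by simp
  then have lt: "norm (of_real r - a) < r" using r power_less_imp_less_base by (metis less_imp_le)
  define d where "d = of_real r - a"
  define f where "f = (\<lambda>k t. indicator {0..} t *\<^sub>R (of_real (t powr w * exp (- (r * t))) * ((d * of_real t) ^ k /\<^sub>R fact k)) :: complex)"
  define G where "G = (\<lambda>k. Gamma (w + 1) / r powr (w + 1) * (pochhammer (w + 1) k / fact k / r ^ k))"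
  have npos: "w + 1 \<notin> \<int>\<^sub>\<le>\<^sub>0" using w by (auto elim!: nonpos_Ints_cases)
  have Gamma_plus1_pos: "Gamma (w + 1) > 0" using w by (intro Gamma_real_pos) auto
  have real_int: "has_bochner_integral lborel (\<lambda>t. indicator {0..} t * (t powr (w + real k) * exp (- (r * t))))
      (Gamma (w + 1) / r powr (w + 1) * (pochhammer (w + 1) k / r ^ k))" for k
  proof -
    have "Gamma (w + real k + 1) = pochhammer (w + 1) k * Gamma (w + 1)"
      using pochhammer_Gamma[OF npos, of k] Gamma_plus1_pos by (simp add: add_ac)
    then show ?thesis
      using has_bochner_integral_Gamma[of "w + real k" r] w r by (simp add: powr_add powr_realpow field_simps)
  qed
  have pk: "indicator {0..} t * (t powr (w + real k) * exp (- (r * t))) = indicator {0..} t * (t powr w * exp (- (r * t)) * t ^ k)" for t k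
  proof (cases "t > 0")
    case True
    then show ?thesis by (simp add: powr_add powr_realpow)
  qed (auto simp: indicator_def)
  have f_eq: "f k t = of_real (indicator {0..} t * (t powr (w + real k) * exp (- (r * t)))) * (d ^ k / fact k)" for k t
    unfolding pk by (simp add: f_def power_mult_distrib scaleR_conv_of_real field_simps indicator_def)
  have f_int: "has_bochner_integral lborel (f k) (of_real (G k) * d ^ k)" for k
  proof -
    have "f k = (\<lambda>t. of_real (indicator {0..} t * (t powr (w + real k) * exp (- (r * t)))) * (d ^ k / fact k))"
      by (rule ext) (rule f_eq)
    moreover have "of_real (Gamma (w + 1) / r powr (w + 1) * (pochhammer (w + 1) k / r ^ k)) * (d ^ k / fact k) = of_real (G k) * d ^ k"
      by (simp add: G_def)
    ultimately show ?thesis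
      using has_bochner_integral_mult_left[OF has_bochner_integral_of_real[OF real_int[of k]], of "d ^ k / fact k"]
      by (simp only:)
  qed
  have norm_f: "norm (f k t) = indicator {0..} t * (t powr (w + real k) * exp (- (r * t))) * (norm d ^ k / fact k)" for k t
    by (simp add: f_eq norm_mult norm_divide norm_power abs_mult)
  have norm_f_int: "(LINT t|lborel. norm (f k t)) = G k * norm d ^ k" for k
    using has_bochner_integral_mult_left[OF real_int[of k], of "norm d ^ k / fact k"]
    unfolding norm_f by (simp add: has_bochner_integral_iff G_def)
  have sums_G: "(\<lambda>k. of_real (G k) * z ^ k) sums (of_real (Gamma (w + 1) / r powr (w + 1)) * (1 - z / of_real r) powr (- of_real (w + 1)))"
    if "norm z < r" for z :: complex
  proof -
    have "norm (- (z / of_real r)) < 1" using that r by (simp add: norm_divide)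
    from gen_binomial_complex[OF this, of "- of_real (w + 1)"]
    have "(\<lambda>k. (- of_real (w + 1) gchoose k) * (- (z / of_real r)) ^ k) sums (1 - z / of_real r) powr (- of_real (w + 1))" by simp
    moreover have "(- of_real (w + 1) gchoose k) * (- (z / of_real r)) ^ k = of_real (pochhammer (w + 1) k / fact k / r ^ k) * z ^ k" for k
    proof -
      have "(- (z / of_real r)) ^ k = (-1) ^ k * (z / of_real r) ^ k" by (metis mult_minus1 power_mult_distrib)
      moreover have "((- of_real (w + 1) :: complex) gchoose k) = (-1) ^ k * of_real (pochhammer (w + 1) k / fact k)"
        by (simp add: gbinomial_pochhammer pochhammer_of_real del: of_real_add)
      moreover have "(-1) ^ k * (-1) ^ k = (1::complex)" by (simp flip: power_mult_distrib)
      ultimately show ?thesis by (simp add: power_divide)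
    qed
    ultimately have "(\<lambda>k. of_real (pochhammer (w + 1) k / fact k / r ^ k) * z ^ k) sums (1 - z / of_real r) powr (- of_real (w + 1))" by simp
    from sums_mult[OF this, of "of_real (Gamma (w + 1) / r powr (w + 1))"] show ?thesis
      by (simp add: G_def mult.assoc)
  qed
  \<comment> \<open>The integrals of the norms form the same series at the point |d|, which is still
    inside the disc of radius \<open>r\<close>.\<close>
  have summ: "summable (\<lambda>k. G k * norm d ^ k)"
  proof -
    have "summable (\<lambda>k. of_real (G k) * of_real (norm d) ^ k :: complex)"
      using sums_G[of "of_real (norm d)"] lt by (intro sums_summable) (auto simp: d_def)
    then have "summable (\<lambda>k. of_real (G k * norm d ^ k) :: complex)" by simp
    then show ?thesis by (simp only: summable_of_real_iff)
  qed
  have point: "(\<lambda>k. f k t) sums (indicator {0..} t *\<^sub>R (of_real (t powr w) * exp (- (a * of_real t))))" for t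
  proof -
    have "(\<lambda>k. indicator {0..} t *\<^sub>R (of_real (t powr w * exp (- (r * t))) * ((d * of_real t) ^ k /\<^sub>R fact k)))
      sums (indicator {0..} t *\<^sub>R (of_real (t powr w * exp (- (r * t))) * exp (d * of_real t)))"
      by (intro sums_scaleR_right sums_mult exp_converges)
    moreover have "of_real (t powr w * exp (- (r * t))) * exp (d * of_real t) = of_real (t powr w) * exp (- (a * of_real t))"
      by (simp add: d_def exp_of_real[symmetric] mult_exp_exp mult.assoc algebra_simps)
    ultimately show ?thesis by (simp only: f_def)
  qed
  have sn: "summable (\<lambda>k. norm (f k t))" for t
  proof -
    have "summable (\<lambda>k. indicator {0..} t * (t powr w * exp (- (r * t))) * norm ((d * of_real t) ^ k /\<^sub>R fact k))"
      by (intro summable_mult summable_norm_exp)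
    moreover have "norm (f k t) = indicator {0..} t * (t powr w * exp (- (r * t))) * norm ((d * of_real t) ^ k /\<^sub>R fact k)" for k
      unfolding f_def norm_scaleR norm_mult norm_of_real by (simp add: abs_mult)
    ultimately show ?thesis by (simp only:)
  qed
  have fi: "\<And>k. integrable lborel (f k)" using f_int by (simp add: has_bochner_integral_iff)
  have sum_nf: "summable (\<lambda>k. LINT t|lborel. norm (f k t))" using summ unfolding norm_f_int .
  have suminf: "(\<Sum>k. f k t) = indicator {0..} t *\<^sub>R (of_real (t powr w) * exp (- (a * of_real t)))" for t
    using point by (simp add: sums_iff)
  have I: "integrable lborel (\<lambda>t. \<Sum>k. f k t)"
    by (rule integrable_suminf[OF fi always_eventually sum_nf]) (use sn in auto)
  have S: "(\<lambda>k. LINT t|lborel. f k t) sums (LINT t|lborel. (\<Sum>k. f k t))"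
    by (rule sums_integral[OF fi always_eventually sum_nf]) (use sn in auto)
  have "(\<lambda>k. LINT t|lborel. f k t) = (\<lambda>k. of_real (G k) * d ^ k)"
    using f_int by (auto simp: has_bochner_integral_iff)
  with S have "(LINT t|lborel. (\<Sum>k. f k t)) = of_real (Gamma (w + 1) / r powr (w + 1)) * (1 - d / of_real r) powr (- of_real (w + 1))"
    using sums_G[of d] lt by (metis d_def sums_unique2)
  also have "1 - d / of_real r = a / of_real r" using r by (simp add: d_def field_simps)
  also have "of_real (Gamma (w + 1) / r powr (w + 1)) * (a / of_real r) powr (- of_real (w + 1)) = of_real (Gamma (w + 1)) / a powr of_real (w + 1)"
  proof -
    have nz: "a / of_real r \<noteq> 0" using \<open>a \<noteq> 0\<close> r by simp
    \<comment> \<open>Principal logarithms add here because \<open>r\<close> is a positive real, so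
      the branch of the power is respected.\<close>
    have "Ln a = Ln (of_real r * (a / of_real r))" using r by simp
    also have "\<dots> = of_real (ln r) + Ln (a / of_real r)" using Ln_times_of_real[OF r nz] r by (simp add: Ln_of_real)
    finally have Ln: "Ln a = of_real (ln r) + Ln (a / of_real r)" .
    have "a powr of_real (w + 1) = of_real (r powr (w + 1)) * (a / of_real r) powr of_real (w + 1)"
      using nz \<open>a \<noteq> 0\<close> r by (simp add: powr_def Ln distrib_left exp_add exp_of_real[symmetric])
    then show ?thesis unfolding powr_minus using r by (simp add: divide_inverse del: of_real_add)
  qed
  finally show ?thesis using I by (simp add: has_bochner_integral_iff suminf)
qed

section \<open>From the Mellin-Stieltjes transform to a Laplace transform\<close>

text \<open>\<open>W\<close> is the total variation on [1, x]: appending [x, y] to a division of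
  [1, x] raises its sum by |A y - A x|. It makes \<open>A\<close> a difference of two monotone
  functions and later controls the error of Riemann sums.\<close>

lemma locally_bounded_variation_majorant:
  assumes "locally_bounded_variation A"
  obtains W where "\<And>x y. 1 \<le> x \<Longrightarrow> x \<le> y \<Longrightarrow> \<bar>A y - A x\<bar> \<le> W y - W x"
proof -
  define var where "var = (\<lambda>D. \<Sum>K\<in>D. \<bar>A (Sup K) - A (Inf K)\<bar>)"
  define W where "W = (\<lambda>x. Sup (var ` {D. D division_of {1..x}}))"
  have bdd: "bdd_above (var ` {D. D division_of {1..x}})" for x
  proof -
    obtain M where "\<And>D. D division_of {1..x} \<Longrightarrow> var D \<le> M"
      using assms unfolding locally_bounded_variation_def var_def by metis
    then show ?thesis by (intro bdd_aboveI2[where M = M]) auto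
  qed
  have ne: "{D. D division_of {1..x}} \<noteq> {}" if "1 \<le> x" for x :: real
    using division_of_self[of 1 x] that by auto
  show ?thesis
  proof (rule that[of W])
    fix x y :: real assume xy: "1 \<le> x" "x \<le> y"
    show "\<bar>A y - A x\<bar> \<le> W y - W x"
    proof (cases "x = y")
      case False
      then have "x < y" using xy by simp
      have "W x \<le> W y - \<bar>A y - A x\<bar>"
      proof (subst (1) W_def, rule cSUP_least[OF ne[OF xy(1)]], clarify)
        fix D assume D: "D division_of {1..x}"
        have new: "{x..y} \<notin> D"
        proof
          assume "{x..y} \<in> D"
          then have "{x..y} \<subseteq> {1..x}" using D by (meson division_ofD(2))
          then show False using \<open>x < y\<close> by auto
        qed
        have "{{x..y}} division_of {x..y}" using division_of_self[of x y] xy by auto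
        then have "D \<union> {{x..y}} division_of {1..x} \<union> {x..y}"
          by (intro division_disjoint_union D) auto
        moreover have "{1..x} \<union> {x..y} = {1..y}" using xy by auto
        ultimately have "var (D \<union> {{x..y}}) \<le> W y"
          unfolding W_def by (intro cSUP_upper bdd) auto
        moreover have "var (D \<union> {{x..y}}) = \<bar>A y - A x\<bar> + var D"
          using new D xy by (simp add: var_def division_of_finite)
        ultimately show "var D \<le> W y - \<bar>A y - A x\<bar>" by simp
      qed
      then show ?thesis by simp
    qed simp
  qed
qed

lemma fine_left_tagged: "u < v \<Longrightarrow> v - u < d \<Longrightarrow> (\<lambda>x. ball x d) fine {(u, {u..v::real})}"
  by (auto simp: fine_def dist_real_def)

text \<open>The existence of the Stieltjes integral is given, so one convenient family of sums
  identifies its value. Strict increase keeps the intervals distinct, so that the sum over a set of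
  tagged intervals loses no term.\<close>

lemma left_tagged_partition:
  fixes x :: "nat \<Rightarrow> real" and f :: "real \<Rightarrow> complex"
  assumes "\<And>i. i < Suc n \<Longrightarrow> x i < x (Suc i)" "\<And>i. i < Suc n \<Longrightarrow> x (Suc i) - x i < d"
  shows "\<exists>p. p tagged_division_of {x 0..x (Suc n)} \<and> (\<lambda>x. ball x d) fine p \<and>
    (\<Sum>(t, K)\<in>p. of_real (A (Sup K) - A (Inf K)) * f t) = (\<Sum>i<Suc n. of_real (A (x (Suc i)) - A (x i)) * f (x i))"
  using assms
proof (induction n)
  case 0
  then have lt: "x 0 < x (Suc 0)" "x (Suc 0) - x 0 < d" by auto
  have "{(x 0, {x 0..x (Suc 0)})} tagged_division_of {x 0..x (Suc 0)}"
    using lt by (intro tagged_division_of_self_real) auto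
  then show ?case
    using lt fine_left_tagged[OF lt] by (intro exI[of _ "{(x 0, {x 0..x (Suc 0)})}"]) simp
next
  case (Suc n)
  then obtain p where p: "p tagged_division_of {x 0..x (Suc n)}" "(\<lambda>x. ball x d) fine p"
    "(\<Sum>(t, K)\<in>p. of_real (A (Sup K) - A (Inf K)) * f t) = (\<Sum>i<Suc n. of_real (A (x (Suc i)) - A (x i)) * f (x i))"
    by (meson less_SucI)
  let ?u = "x (Suc n)" and ?v = "x (Suc (Suc n))"
  have lt: "?u < ?v" "?v - ?u < d" using Suc.prems by auto
  have le: "x 0 \<le> ?u"
  proof -
    have "k \<le> Suc n \<Longrightarrow> x 0 \<le> x k" for k
    proof (induction k)
      case (Suc k)
      then show ?case using Suc.prems \<open>\<And>i. i < Suc (Suc n) \<Longrightarrow> x i < x (Suc i)\<close>[of k] by force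
    qed simp
    then show ?thesis by simp
  qed
  have new: "(?u, {?u..?v}) \<notin> p"
  proof
    assume "(?u, {?u..?v}) \<in> p"
    then have "{?u..?v} \<subseteq> {x 0..?u}" using p(1) by (meson tagged_division_ofD(3))
    then show False using lt by auto
  qed
  have self: "{(?u, {?u..?v})} tagged_division_of {?u..?v}"
    using lt by (intro tagged_division_of_self_real) auto
  have "p \<union> {(?u, {?u..?v})} tagged_division_of {x 0..?u} \<union> {?u..?v}"
    by (intro tagged_division_Un p(1) self) auto
  moreover have "{x 0..?u} \<union> {?u..?v} = {x 0..?v}" using le lt by auto
  moreover have "(\<lambda>x. ball x d) fine (p \<union> {(?u, {?u..?v})})"
    using p(2) fine_left_tagged[OF lt] by (rule fine_Un)
  moreover have "(\<Sum>(t, K)\<in>p \<union> {(?u, {?u..?v})}. of_real (A (Sup K) - A (Inf K)) * f t)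
      = of_real (A ?v - A ?u) * f ?u + (\<Sum>(t, K)\<in>p. of_real (A (Sup K) - A (Inf K)) * f t)"
    using new lt tagged_division_of_finite[OF p(1)] by simp
  ultimately show ?case using p(3) by (intro exI[of _ "p \<union> {(?u, {?u..?v})}"]) simp
qed

text \<open>B = W - (W - B) on the nonnegative half-line, and both \<open>W\<close> and
  \<open>W - B\<close> are monotone there.\<close>

lemma measurable_of_majorant:
  fixes B W :: "real \<Rightarrow> real"
  assumes W: "\<And>t t'. 0 \<le> t \<Longrightarrow> t \<le> t' \<Longrightarrow> \<bar>B t' - B t\<bar> \<le> W t' - W t"
    and zero: "\<And>t. t < 0 \<Longrightarrow> B t = 0"
  shows "B \<in> borel_measurable borel"
proof -
  have 1: "W \<in> borel_measurable (restrict_space borel {0..})"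
    using W by (intro borel_measurable_mono_on_fnc mono_onI) (force simp: abs_le_iff)
  have 2: "(\<lambda>t. W t - B t) \<in> borel_measurable (restrict_space borel {0..})"
    using W by (intro borel_measurable_mono_on_fnc mono_onI) (force simp: abs_le_iff)
  have "(\<lambda>t. W t - (W t - B t)) \<in> borel_measurable (restrict_space borel {0..})"
    by (rule borel_measurable_diff[OF 1 2])
  then have "(\<lambda>t. indicator {0..} t *\<^sub>R B t) \<in> borel_measurable borel"
    by (subst (asm) borel_measurable_restrict_space_iff) auto
  moreover have "(\<lambda>t. indicator {0..} t *\<^sub>R B t) = B"
  proof
    show "indicator {0..} t *\<^sub>R B t = B t" for t using zero[of t] by (cases "t < 0") auto
  qed
  ultimately show ?thesis by simp
qed

text \<open>Summation by parts in the variable t = log x. The separately added jump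
  \<open>A 1\<close> cancels the boundary term at t = 0.\<close>

lemma stieltjes_exp_by_parts:
  fixes z :: complex
  assumes W: "\<And>x y. 1 \<le> x \<Longrightarrow> x \<le> y \<Longrightarrow> \<bar>A y - A x\<bar> \<le> W y - W x"
    and zero: "\<And>x. x < 1 \<Longrightarrow> A x = 0"
    and I: "has_stieltjes_integral (\<lambda>x. of_real x powr (- z)) A 1 (exp U) I" and U: "U > 0"
  shows "of_real (A 1) + I = of_real (A (exp U)) * exp (- (z * of_real U))
      + z * integral {0..U} (\<lambda>t. of_real (A (exp t)) * exp (- (z * of_real t)))"
proof -
  define B where "B = (\<lambda>t. A (exp t))"
  define V where "V = (\<lambda>t. W (exp t))"
  define g where "g = (\<lambda>t. exp (- (z * of_real t)))"
  have V: "\<bar>B t' - B t\<bar> \<le> V t' - V t" if "0 \<le> t" "t \<le> t'" for t t'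
    unfolding B_def V_def using that by (intro W) auto
  have [measurable]: "B \<in> borel_measurable borel"
    by (rule measurable_of_majorant[of B V]) (use V zero in \<open>auto simp: B_def\<close>)
  define M where "M = exp (norm z * U)"
  have g_bound: "norm (g t) \<le> M" if "0 \<le> t" "t \<le> U" for t
  proof -
    have "norm (g t) \<le> exp (norm (z * of_real t))" unfolding g_def using norm_exp[of "- (z * of_real t)"] by simp
    also have "\<dots> \<le> M" using that by (auto simp: M_def norm_mult intro!: mult_left_mono)
    finally show ?thesis .
  qed
  have M: "M > 0" by (simp add: M_def)
  have B_bound: "\<bar>B t\<bar> \<le> \<bar>B 0\<bar> + (V U - V 0)" if "0 \<le> t" "t \<le> U" for t
    using V[of 0 t] V[of t U] that by linarith
  have int: "(\<lambda>t. of_real (B t) * (z * g t)) integrable_on {a..b}" if "0 \<le> a" "b \<le> U" for a b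
  proof -
    have "set_integrable lborel {a..b} (\<lambda>t. of_real (B t) * (z * g t))"
      unfolding set_integrable_def
    proof (rule integrable_bounded_Icc)
      show "(\<lambda>t. of_real (B t) * (z * g t)) \<in> borel_measurable borel" unfolding g_def by measurable
      show "norm (of_real (B t) * (z * g t)) \<le> (\<bar>B 0\<bar> + (V U - V 0)) * (norm z * M)" if "a \<le> t" "t \<le> b" for t
        using that \<open>0 \<le> a\<close> \<open>b \<le> U\<close> B_bound[of t] g_bound[of t]
        by (auto simp: norm_mult intro!: mult_mono mult_left_mono)
    qed
    then show ?thesis by (rule set_borel_integral_eq_integral)
  qed
  have FTC: "((\<lambda>t. z * g t) has_integral (g a - g b)) {a..b}" if "a \<le> b" for a b
  proof -
    have "((\<lambda>t. z * g t) has_integral ((- g b) - (- g a))) {a..b}"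
    proof (rule fundamental_theorem_of_calculus[OF that])
      fix t assume "t \<in> {a..b}"
      have "((\<lambda>w. - exp (- (z * w))) has_field_derivative (z * g t)) (at (of_real t))"
        unfolding g_def by (auto intro!: derivative_eq_intros)
      then have "((\<lambda>t. - exp (- (z * of_real t))) has_vector_derivative (z * g t)) (at t within {a..b})"
        by (intro has_vector_derivative_real_field)
      then show "((\<lambda>t. - g t) has_vector_derivative (z * g t)) (at t within {a..b})" by (simp add: g_def)
    qed
    then show ?thesis by simp
  qed
  let ?J = "\<lambda>u. integral {0..u} (\<lambda>t. of_real (B t) * (z * g t))"
  have key: "norm (I - (of_real (B U) * g U - of_real (B 0) + ?J U)) \<le> e + (V U - V 0) * (norm z * M) * e" if e: "e > 0" for e
  proof -
    have "\<exists>d>0. \<forall>p. p tagged_division_of {1..exp U} \<and> (\<lambda>x. ball x d) fine p \<longrightarrow>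
        norm ((\<Sum>(x, K)\<in>p. of_real (A (Sup K) - A (Inf K)) * of_real x powr (- z)) - I) < e"
      by (rule I[unfolded has_stieltjes_integral_def, THEN spec, THEN mp, OF e])
    then obtain d where d: "d > 0" and dI: "\<forall>p. p tagged_division_of {1..exp U} \<and> (\<lambda>x. ball x d) fine p \<longrightarrow>
        norm ((\<Sum>(x, K)\<in>p. of_real (A (Sup K) - A (Inf K)) * of_real x powr (- z)) - I) < e"
      by (elim exE conjE)
    have "uniformly_continuous_on {0..U} (exp :: real \<Rightarrow> real)"
      by (intro compact_uniformly_continuous) (auto intro!: continuous_intros)
    then obtain h where h: "h > 0" "\<And>s t. s \<in> {0..U} \<Longrightarrow> t \<in> {0..U} \<Longrightarrow> dist t s < h \<Longrightarrow> dist (exp t) (exp s) < d"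
      unfolding uniformly_continuous_on_def using d by metis
    obtain n :: nat where n: "U / min h e < real n" using reals_Archimedean2 by blast
    have pos: "min h e > 0" using h(1) e by simp
    then have "U / min h e > 0" using U by (intro divide_pos_pos) auto
    then have n0: "n > 0" using n by (metis gr0I of_nat_0 order_less_asym)
    \<comment> \<open>Equal steps in t, not in x: \<open>\<delta> < h\<close> makes the image points
      \<open>d\<close>-fine by uniform continuity of exp, and \<open>\<delta> < e\<close> makes the
      error of the parts formula proportional to \<open>e\<close>.\<close>
    define \<delta> where "\<delta> = U / real n"
    have "\<delta> < min h e" 
      using pos n n0 unfolding \<delta>_def by (metis mult.commute of_nat_0_less_iff pos_divide_less_eq)
    then have \<delta>: "0 < \<delta>" "\<delta> < h" "\<delta> < e" using n0 U by (auto simp: \<delta>_def)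
    define t where "t = (\<lambda>i. \<delta> * real i)"
    have t: "0 \<le> t i" "t (Suc i) = t i + \<delta>" for i using \<delta> by (auto simp: t_def algebra_simps)
    have tn: "t n = U" "t 0 = 0" using n0 by (auto simp: t_def \<delta>_def)
    have tU: "t i \<le> U" if "i \<le> n" for i
    proof -
      have "t i \<le> t n" unfolding t_def using that \<delta> by (intro mult_left_mono) auto
      then show ?thesis using tn by simp
    qed
    have mesh: "exp (t i) < exp (t (Suc i))" "exp (t (Suc i)) - exp (t i) < d" if "i < n" for i
    proof -
      show "exp (t i) < exp (t (Suc i))" using t \<delta> by simp
      have "dist (exp (t (Suc i))) (exp (t i)) < d"
        using t[of i] tU[of i] tU[of "Suc i"] that \<delta> t[of "Suc i"] by (intro h(2)) (auto simp: dist_real_def)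
      then show "exp (t (Suc i)) - exp (t i) < d" by (simp add: dist_real_def)
    qed
    obtain k where k: "n = Suc k" using n0 gr0_implies_Suc by blast
    obtain p where p: "p tagged_division_of {exp (t 0)..exp (t (Suc k))}" "(\<lambda>x. ball x d) fine p"
      "(\<Sum>(x, K)\<in>p. of_real (A (Sup K) - A (Inf K)) * of_real x powr (- z))
        = (\<Sum>i<Suc k. of_real (A (exp (t (Suc i))) - A (exp (t i))) * of_real (exp (t i)) powr (- z))"
      using left_tagged_partition[of k "\<lambda>i. exp (t i)" d A "\<lambda>x. of_real x powr (- z)"] mesh unfolding k by blast
    have pw: "of_real (exp s) powr (- z) = g s" for s :: real
      by (simp add: powr_def g_def exp_of_real[symmetric] Ln_exp mult.commute) 
    have 1: "norm ((\<Sum>i<n. of_real (B (t (Suc i)) - B (t i)) * g (t i)) - I) < e"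
      using dI[THEN spec, of p] p tn unfolding k pw B_def by simp
    \<comment> \<open>Abel summation; each difference of \<open>g\<close> is then the integral of
      \<open>z * g\<close> over one step.\<close>
    have 2: "(\<Sum>i<j. of_real (B (t (Suc i)) - B (t i)) * g (t i))
        = of_real (B (t j)) * g (t j) - of_real (B (t 0)) * g (t 0) + (\<Sum>i<j. of_real (B (t (Suc i))) * (g (t i) - g (t (Suc i))))" for j
      by (induction j) (auto simp: algebra_simps)
    \<comment> \<open>On one step \<open>B\<close> differs from its right end value by at most the
      increment of \<open>V\<close>. The errors telescope to the total variation times the
      mesh.\<close>
    have 3: "norm ((\<Sum>i<j. of_real (B (t (Suc i))) * (g (t i) - g (t (Suc i)))) - ?J (t j)) \<le> (V (t j) - V 0) * (norm z * M) * \<delta>"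
      if "j \<le> n" for j using that
    proof (induction j)
      case 0
      then show ?case using tn by simp
    next
      case (Suc j)
      let ?a = "t j" and ?b = "t (Suc j)"
      have ab: "0 \<le> ?a" "?a \<le> ?b" "?b \<le> U" using t[of j] \<delta> tU[OF Suc.prems] by auto
      have J: "?J ?b = ?J ?a + integral {?a..?b} (\<lambda>s. of_real (B s) * (z * g s))"
        using ab by (intro Henstock_Kurzweil_Integration.integral_combine[symmetric] int) auto
      have hi: "((\<lambda>s. of_real (B ?b) * (z * g s) - of_real (B s) * (z * g s)) has_integral
          (of_real (B ?b) * (g ?a - g ?b) - integral {?a..?b} (\<lambda>s. of_real (B s) * (z * g s)))) {?a..?b}"
        using ab by (intro has_integral_diff has_integral_mult_right FTC integrable_integral int) auto
      have "norm (of_real (B ?b) * (g ?a - g ?b) - integral {?a..?b} (\<lambda>s. of_real (B s) * (z * g s)))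
          \<le> (V ?b - V ?a) * (norm z * M) * measure lborel {?a..?b}"
      proof (rule has_integral_bound_real[OF _ finite.emptyI hi])
        show "0 \<le> (V ?b - V ?a) * (norm z * M)" using V[of ?a ?b] ab M by auto
        fix s assume s: "s \<in> {?a..?b} - {}"
        have "norm (of_real (B ?b) * (z * g s) - of_real (B s) * (z * g s)) = \<bar>B ?b - B s\<bar> * (norm z * norm (g s))"
          by (simp add: left_diff_distrib[symmetric] norm_mult flip: of_real_diff)
        also have "\<dots> \<le> (V ?b - V ?a) * (norm z * M)"
          using s ab V[of s ?b] V[of ?a s] g_bound[of s] by (intro mult_mono mult_left_mono) auto
        finally show "norm (of_real (B ?b) * (z * g s) - of_real (B s) * (z * g s)) \<le> (V ?b - V ?a) * (norm z * M)" .
      qed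
      also have "measure lborel {?a..?b} = \<delta>" using ab t by simp
      finally have st: "norm (of_real (B ?b) * (g ?a - g ?b) - integral {?a..?b} (\<lambda>s. of_real (B s) * (z * g s)))
          \<le> (V ?b - V ?a) * (norm z * M) * \<delta>" .
      have "(\<Sum>i<Suc j. of_real (B (t (Suc i))) * (g (t i) - g (t (Suc i)))) - ?J ?b
         = ((\<Sum>i<j. of_real (B (t (Suc i))) * (g (t i) - g (t (Suc i)))) - ?J ?a)
          + (of_real (B ?b) * (g ?a - g ?b) - integral {?a..?b} (\<lambda>s. of_real (B s) * (z * g s)))"
        unfolding J by simp
      also have "norm \<dots> \<le> (V ?a - V 0) * (norm z * M) * \<delta> + (V ?b - V ?a) * (norm z * M) * \<delta>"
        using Suc by (intro norm_triangle_mono st) auto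
      also have "\<dots> = (V ?b - V 0) * (norm z * M) * \<delta>" by (simp add: algebra_simps)
      finally show ?case .
    qed
    have "I - (of_real (B U) * g U - of_real (B 0) + ?J U)
       = - ((\<Sum>i<n. of_real (B (t (Suc i)) - B (t i)) * g (t i)) - I)
         + ((\<Sum>i<n. of_real (B (t (Suc i))) * (g (t i) - g (t (Suc i)))) - ?J U)"
      unfolding 2 tn by (simp add: g_def)
    also have "norm \<dots> \<le> e + (V U - V 0) * (norm z * M) * \<delta>"
      using 1 3[of n] tn by (intro norm_triangle_mono) (auto simp: norm_minus_commute)
    also have "\<dots> \<le> e + (V U - V 0) * (norm z * M) * e"
      using \<delta> V[of 0 U] U M by (intro add_left_mono mult_left_mono) auto
    finally show ?thesis .
  qed
  have "norm (I - (of_real (B U) * g U - of_real (B 0) + ?J U)) \<le> 0"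
  proof (rule field_le_epsilon)
    fix e :: real assume e: "e > 0"
    define C where "C = 1 + (V U - V 0) * (norm z * M)"
    have C: "C \<ge> 1" using V[of 0 U] U M by (simp add: C_def)
    have "e / C + (V U - V 0) * (norm z * M) * (e / C) = C * (e / C)" unfolding C_def by (simp only: distrib_right mult_1)
    also have "\<dots> = e" using C by simp
    finally show "norm (I - (of_real (B U) * g U - of_real (B 0) + ?J U)) \<le> 0 + e"
      using key[of "e / C"] e C by simp
  qed
  then have "I = of_real (B U) * g U - of_real (B 0) + ?J U" by simp
  moreover have "?J U = z * integral {0..U} (\<lambda>t. of_real (B t) * g t)"
    by (subst integral_mult_right[symmetric]) (simp add: mult_ac)
  ultimately show ?thesis by (simp add: B_def g_def)
qed


lemma has_mellin_exp_by_parts: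
  fixes s :: complex
  assumes A: "locally_bounded_variation A" and zero: "\<And>x. x < 1 \<Longrightarrow> A x = 0"
    and L: "has_mellin A (s + 1) L"
  shows "((\<lambda>U. of_real (A (exp U) * exp (- U)) * exp (- (s * of_real U))
      + (s + 1) * integral {0..U} (\<lambda>t. of_real (A (exp t) * exp (- t)) * exp (- (s * of_real t)))) \<longlongrightarrow> L) at_top"
proof -
  obtain W where W: "\<And>x y. 1 \<le> x \<Longrightarrow> x \<le> y \<Longrightarrow> \<bar>A y - A x\<bar> \<le> W y - W x"
    using locally_bounded_variation_majorant[OF A] by blast
  obtain I where I: "\<And>X. X \<ge> 1 \<Longrightarrow> has_stieltjes_integral (\<lambda>x. of_real x powr (- (s + 1))) A 1 X (I X)"
    and lim: "((\<lambda>X. of_real (A 1) + I X) \<longlongrightarrow> L) at_top"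
    using L unfolding has_mellin_def by blast
  have "((\<lambda>U. of_real (A 1) + I (exp U)) \<longlongrightarrow> L) at_top"
    using filterlim_compose[OF lim exp_at_top] .
  moreover have "\<forall>\<^sub>F U in at_top. of_real (A 1) + I (exp U) = of_real (A (exp U) * exp (- U)) * exp (- (s * of_real U))
      + (s + 1) * integral {0..U} (\<lambda>t. of_real (A (exp t) * exp (- t)) * exp (- (s * of_real t)))"
    using eventually_gt_at_top[of 0]
  proof eventually_elim
    case (elim U)
    have e: "of_real (A (exp t)) * exp (- ((s + 1) * of_real t)) = of_real (A (exp t) * exp (- t)) * exp (- (s * of_real t))" for t
    proof -
      have "exp (- ((s + 1) * of_real t)) = exp (- of_real t) * exp (- (s * of_real t))"
        by (simp add: mult_exp_exp algebra_simps)
      then show ?thesis by (simp add: exp_of_real[symmetric])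
    qed
    have "of_real (A 1) + I (exp U) = of_real (A (exp U)) * exp (- ((s + 1) * of_real U))
      + (s + 1) * integral {0..U} (\<lambda>t. of_real (A (exp t)) * exp (- ((s + 1) * of_real t)))"
      by (rule stieltjes_exp_by_parts[OF W zero I elim]) (use elim in auto)
    then show ?case unfolding e .
  qed
  ultimately show ?thesis by (rule Lim_transform_eventually)
qed

lemma integrable_exp_atLeast:
  assumes "a > 0" shows "integrable lborel (\<lambda>t. indicator {0..} t * exp (- (a * t)) :: real)"
proof (rule Bochner_Integration.integrable_bound)
  show "integrable lborel (\<lambda>t. indicator {0..} t * (t powr 0 * exp (- (a * t))))"
    using has_bochner_integral_Gamma[of 0 a] assms by (simp add: has_bochner_integral_iff)
  \<comment> \<open>The exception at 0 is real: \<open>0 powr 0 = 0\<close>, so the dominating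
    function vanishes there.\<close>
  show "AE t in lborel. norm (indicator {0..} t * exp (- (a * t))) \<le> norm (indicator {0..} t * (t powr 0 * exp (- (a * t))))"
    using AE_lborel_singleton[of "0::real"] by eventually_elim auto
qed auto

text \<open>
  The lower bound keeps both terms of the integrated-by-parts transform bounded below, so that
  its convergence bounds the boundary term.
\<close>

lemma exp_growth_of_mellin:
  assumes A: "locally_bounded_variation A" and zero: "\<And>x. x < 1 \<Longrightarrow> A x = 0"
    and L: "has_mellin A (of_real (1 + \<sigma>)) L" and \<sigma>: "\<sigma> > 0"
    and lower: "\<And>t. t \<ge> 0 \<Longrightarrow> A (exp t) * exp (- t) \<ge> - a * (1 + t)" and a: "a \<ge> 0"
  shows "\<exists>M\<ge>0. \<forall>t\<ge>0. \<bar>A (exp t) * exp (- t)\<bar> \<le> M * exp (\<sigma> * t)"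
proof -
  define F where "F = (\<lambda>t. A (exp t) * exp (- t))"
  obtain W where W: "\<And>x y. 1 \<le> x \<Longrightarrow> x \<le> y \<Longrightarrow> \<bar>A y - A x\<bar> \<le> W y - W x"
    using locally_bounded_variation_majorant[OF A] by blast
  have lim: "((\<lambda>U. of_real (F U) * exp (- (of_real \<sigma> * of_real U))
      + (of_real \<sigma> + 1) * integral {0..U} (\<lambda>t. of_real (F t) * exp (- (of_real \<sigma> * of_real t)))) \<longlongrightarrow> L) at_top"
    using has_mellin_exp_by_parts[OF A zero, of "of_real \<sigma>" L] L unfolding F_def by (simp add: add.commute)
  have small: "a * (1 + t) \<le> a * (1 + 1 / r) * exp (r * t)" if "t \<ge> 0" "r > 0" for t r
  proof -
    have "0 \<le> r * t" using that by simp
    then have e: "r * t \<le> exp (r * t)" "1 \<le> exp (r * t)" using exp_ge_add_one_self[of "r * t"] by linarith+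
    have "1 + t = 1 + (1 / r) * (r * t)" using that by simp
    also have "\<dots> \<le> exp (r * t) + (1 / r) * exp (r * t)" using e that by (intro add_mono mult_left_mono) auto
    also have "\<dots> = (1 + 1 / r) * exp (r * t)" by (simp add: distrib_right)
    finally show ?thesis using mult_left_mono[OF _ a] by (simp add: mult.assoc)
  qed
  define V where "V = (\<lambda>t. W (exp t))"
  have V: "\<bar>A (exp t') - A (exp t)\<bar> \<le> V t' - V t" if "0 \<le> t" "t \<le> t'" for t t'
    unfolding V_def using that by (intro W) auto
  have [measurable]: "(\<lambda>t. A (exp t)) \<in> borel_measurable borel"
    by (rule measurable_of_majorant[of _ V]) (use V zero in auto)
  have F_bound: "\<bar>F t\<bar> \<le> \<bar>A 1\<bar> + (V U - V 0)" if "0 \<le> t" "t \<le> U" for t U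
  proof -
    have "\<bar>F t\<bar> = \<bar>A (exp t)\<bar> * exp (- t)" by (simp add: F_def abs_mult)
    also have "\<dots> \<le> \<bar>A (exp t)\<bar> * 1" using that by (intro mult_left_mono) auto
    also have "\<dots> \<le> \<bar>A 1\<bar> + (V U - V 0)" using V[of 0 t] V[of t U] that by simp
    finally show ?thesis .
  qed
  define f where "f = (\<lambda>t. F t * exp (- (\<sigma> * t)))"
  have f_int: "f integrable_on {0..U}" for U
  proof -
    have "set_integrable lborel {0..U} f"
      unfolding set_integrable_def
    proof (rule integrable_bounded_Icc)
      show "f \<in> borel_measurable borel" unfolding f_def F_def by measurable
      show "norm (f t) \<le> (\<bar>A 1\<bar> + (V U - V 0)) * 1" if "0 \<le> t" "t \<le> U" for t
        using F_bound[OF that] that \<sigma> unfolding f_def norm_mult by (intro mult_mono) auto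
    qed
    then show ?thesis by (rule set_borel_integral_eq_integral)
  qed
  have Re: "Re (of_real (F U) * exp (- (of_real \<sigma> * of_real U))
      + (of_real \<sigma> + 1) * integral {0..U} (\<lambda>t. of_real (F t) * exp (- (of_real \<sigma> * of_real t))))
     = f U + (\<sigma> + 1) * integral {0..U} f" for U
  proof -
    have e: "of_real (F t) * exp (- (of_real \<sigma> * of_real t)) = complex_of_real (f t)" for t
      by (simp add: f_def exp_of_real[symmetric])
    have "integral {0..U} (\<lambda>t. complex_of_real (f t)) = of_real (integral {0..U} f)"
      using integral_linear[OF f_int bounded_linear_of_real] by (simp add: o_def)
    then show ?thesis unfolding e by simp
  qed
  have "((\<lambda>U. f U + (\<sigma> + 1) * integral {0..U} f) \<longlongrightarrow> Re L) at_top"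
    using tendsto_Re[OF lim] unfolding Re .
  then have "\<forall>\<^sub>F U in at_top. f U + (\<sigma> + 1) * integral {0..U} f < Re L + 1"
    by (rule order_tendstoD) simp
  then obtain U0 where U0: "\<And>U. U \<ge> U0 \<Longrightarrow> f U + (\<sigma> + 1) * integral {0..U} f < Re L + 1"
    unfolding eventually_at_top_linorder by blast
  define c where "c = a * (1 + 1 / (\<sigma> / 2))"
  have c: "c \<ge> 0" using a \<sigma> by (simp add: c_def)
  \<comment> \<open>Half of the decay pays for the linear factor; the other half keeps the bound
    integrable.\<close>
  have f_lower: "f t \<ge> - c * exp (- (\<sigma> / 2 * t))" if "t \<ge> 0" for t
  proof -
    have "F t \<ge> - (a * (1 + t))" using lower[OF that] by (simp add: F_def)
    then have "F t \<ge> - (c * exp (\<sigma> / 2 * t))" using small[OF that, of "\<sigma> / 2"] \<sigma> unfolding c_def by linarith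
    then have "f t \<ge> - (c * exp (\<sigma> / 2 * t)) * exp (- (\<sigma> * t))" unfolding f_def by (intro mult_right_mono) auto
    then show ?thesis by (simp add: mult.assoc mult_exp_exp algebra_simps)
  qed
  have J_lower: "integral {0..U} f \<ge> - (c * (2 / \<sigma>))" if "U \<ge> 0" for U
  proof -
    have "((\<lambda>t. - c * exp (- (\<sigma> / 2 * t))) has_integral
        (c * (2 / \<sigma>) * exp (- (\<sigma> / 2 * U)) - c * (2 / \<sigma>) * exp (- (\<sigma> / 2 * 0)))) {0..U}"
      by (rule fundamental_theorem_of_calculus[OF that])
         (use \<sigma> in \<open>auto intro!: derivative_eq_intros simp: has_real_derivative_iff_has_vector_derivative[symmetric]\<close>)
    then have "c * (2 / \<sigma>) * exp (- (\<sigma> / 2 * U)) - c * (2 / \<sigma>) * exp (- (\<sigma> / 2 * 0)) \<le> integral {0..U} f"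
      by (rule has_integral_le[OF _ integrable_integral[OF f_int]]) (use f_lower in auto)
    moreover have "0 \<le> c * (2 / \<sigma>) * exp (- (\<sigma> / 2 * U))" using c \<sigma> by simp
    ultimately show ?thesis by simp
  qed
  define U1 where "U1 = max U0 0"
  \<comment> \<open>Up to \<open>U1\<close> the variation of \<open>A\<close> bounds
    \<open>F\<close>. Beyond it the converging expression is below \<open>Re L + 1\<close>, and the
    lower bound of its integral part turns this into an upper bound for \<open>f\<close>.\<close>
  define M where "M = \<bar>A 1\<bar> + \<bar>V (U1) - V 0\<bar> + c + \<bar>Re L + 1\<bar> + (\<sigma> + 1) * (c * (2 / \<sigma>))"
  have M0: "(\<sigma> + 1) * (c * (2 / \<sigma>)) \<ge> 0" using c \<sigma> by simp
  have M_nonneg: "M \<ge> 0" using c M0 unfolding M_def by linarith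
  have "\<bar>F t\<bar> \<le> M * exp (\<sigma> * t)" if t: "t \<ge> 0" for t
  proof (cases "t \<le> U1")
    case True
    then have "\<bar>F t\<bar> \<le> M" using F_bound[OF t True] c M0 unfolding M_def by linarith
    moreover have "M * 1 \<le> M * exp (\<sigma> * t)" using M_nonneg t \<sigma> by (intro mult_left_mono) auto
    ultimately show ?thesis by simp
  next
    case False
    have "f t \<ge> - (c * 1)"
    proof -
      have "c * exp (- (\<sigma> / 2 * t)) \<le> c * 1" using c t \<sigma> by (intro mult_left_mono) auto
      then show ?thesis using f_lower[OF t] by linarith
    qed
    moreover have "f t \<le> Re L + 1 + (\<sigma> + 1) * (c * (2 / \<sigma>))"
    proof -
      have "(\<sigma> + 1) * integral {0..t} f \<ge> (\<sigma> + 1) * (- (c * (2 / \<sigma>)))"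
        using J_lower[OF t] \<sigma> by (intro mult_left_mono) auto
      moreover have "U0 \<le> t" using False unfolding U1_def by simp
      ultimately show ?thesis using U0[of t] unfolding mult_minus_right by linarith
    qed
    ultimately have "\<bar>f t\<bar> \<le> M" using c M0 unfolding M_def by linarith
    then have "\<bar>f t\<bar> * exp (\<sigma> * t) \<le> M * exp (\<sigma> * t)" by (intro mult_right_mono) auto
    moreover have "\<bar>f t\<bar> * exp (\<sigma> * t) = \<bar>F t\<bar>" by (simp add: f_def abs_mult mult.assoc mult_exp_exp)
    ultimately show ?thesis by simp
  qed
  then show ?thesis using M_nonneg unfolding F_def by blast
qed

lemma set_integrable_laplace:
  fixes F :: "real \<Rightarrow> real" and s :: complex
  assumes [measurable]: "F \<in> borel_measurable borel"
    and growth: "\<And>\<sigma>. \<sigma> > 0 \<Longrightarrow> \<exists>M\<ge>0. \<forall>t\<ge>0. \<bar>F t\<bar> \<le> M * exp (\<sigma> * t)" and s: "Re s > 0"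
  shows "set_integrable lborel {0..} (\<lambda>t. of_real (F t) * exp (- (s * of_real t)))"
proof -
  obtain M where M: "M \<ge> 0" "\<And>t. t \<ge> 0 \<Longrightarrow> \<bar>F t\<bar> \<le> M * exp (Re s / 2 * t)" using growth[of "Re s / 2"] s by auto
  show ?thesis unfolding set_integrable_def
  proof (rule Bochner_Integration.integrable_bound)
    show "integrable lborel (\<lambda>t. M * (indicator {0..} t * exp (- (Re s / 2 * t))))"
      using s by (intro integrable_mult_right integrable_exp_atLeast) auto
    show "(\<lambda>t. indicator {0..} t *\<^sub>R (of_real (F t) * exp (- (s * of_real t)))) \<in> borel_measurable lborel" by measurable
    have "norm (of_real (F t) * exp (- (s * of_real t))) \<le> M * exp (- (Re s / 2 * t))" if "t \<ge> 0" for t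
    proof -
      have "norm (of_real (F t) * exp (- (s * of_real t))) = \<bar>F t\<bar> * exp (- (Re s * t))" by (simp add: norm_mult)
      also have "\<dots> \<le> M * exp (Re s / 2 * t) * exp (- (Re s * t))" using M(2)[OF that] by (intro mult_right_mono) auto
      also have "\<dots> = M * exp (- (Re s / 2 * t))" by (simp add: mult.assoc mult_exp_exp algebra_simps)
      finally show ?thesis .
    qed
    then show "AE t in lborel. norm (indicator {0..} t *\<^sub>R (of_real (F t) * exp (- (s * of_real t))))
        \<le> norm (M * (indicator {0..} t * exp (- (Re s / 2 * t))))"
      using M(1) by (intro always_eventually allI) (auto simp: indicator_def abs_mult)
  qed
qed

text \<open>\<open>mellin\<close> is a definite description, so uniqueness has to be shown: any
  value of the transform is the limit of the parts formula, whose boundary term vanishes by the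
  growth bound at rate Re s / 2.\<close>

lemma mellin_eq_laplace:
  fixes s :: complex
  assumes A: "locally_bounded_variation A" and zero: "\<And>x. x < 1 \<Longrightarrow> A x = 0"
    and L: "\<exists>L. has_mellin A (s + 1) L" and s: "Re s > 0"
    and [measurable]: "(\<lambda>t. A (exp t) * exp (- t)) \<in> borel_measurable borel"
    and growth: "\<And>\<sigma>. \<sigma> > 0 \<Longrightarrow> \<exists>M\<ge>0. \<forall>t\<ge>0. \<bar>A (exp t) * exp (- t)\<bar> \<le> M * exp (\<sigma> * t)"
  shows "mellin A (s + 1) = (s + 1) * (LINT t:{0..}|lborel. of_real (A (exp t) * exp (- t)) * exp (- (s * of_real t)))"
proof -
  define F where "F = (\<lambda>t. A (exp t) * exp (- t))"
  have int: "set_integrable lborel {0..} (\<lambda>t. of_real (F t) * exp (- (s * of_real t)))"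
    unfolding F_def by (rule set_integrable_laplace) (use growth s in auto)
  have unique: "L = (s + 1) * (LINT t:{0..}|lborel. of_real (F t) * exp (- (s * of_real t)))"
    if L: "has_mellin A (s + 1) L" for L
  proof -
    have lim: "((\<lambda>U. of_real (F U) * exp (- (s * of_real U))
      + (s + 1) * integral {0..U} (\<lambda>t. of_real (F t) * exp (- (s * of_real t)))) \<longlongrightarrow> L) at_top"
      unfolding F_def by (rule has_mellin_exp_by_parts[OF A zero L])
    obtain M where M: "M \<ge> 0" "\<And>t. t \<ge> 0 \<Longrightarrow> \<bar>F t\<bar> \<le> M * exp (Re s / 2 * t)"
      using growth[of "Re s / 2"] s unfolding F_def by auto
    have "((\<lambda>U. of_real (F U) * exp (- (s * of_real U))) \<longlongrightarrow> 0) at_top"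
    proof (rule Lim_null_comparison)
      show "\<forall>\<^sub>F U in at_top. norm (of_real (F U) * exp (- (s * of_real U))) \<le> M * exp (- (Re s / 2 * U))"
        using eventually_ge_at_top[of 0]
      proof eventually_elim
        case (elim t)
        have "norm (of_real (F t) * exp (- (s * of_real t))) = \<bar>F t\<bar> * exp (- (Re s * t))" by (simp add: norm_mult)
        also have "\<dots> \<le> M * exp (Re s / 2 * t) * exp (- (Re s * t))" using M(2)[OF elim] by (intro mult_right_mono) auto
        also have "\<dots> = M * exp (- (Re s / 2 * t))" by (simp add: mult.assoc mult_exp_exp algebra_simps)
        finally show ?case .
      qed
      have "filterlim (\<lambda>U. Re s / 2 * U) at_top at_top"
        using s by (intro filterlim_tendsto_pos_mult_at_top[OF tendsto_const _ filterlim_ident]) auto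
      then have "((\<lambda>U. exp (- (Re s / 2 * U))) \<longlongrightarrow> 0) at_top"
        by (intro filterlim_compose[OF exp_at_bot] filterlim_compose[OF filterlim_uminus_at_bot_at_top])
      then show "((\<lambda>U. M * exp (- (Re s / 2 * U))) \<longlongrightarrow> 0) at_top"
        by (rule tendsto_mult_right_zero)
    qed
    moreover have "((\<lambda>U. integral {0..U} (\<lambda>t. of_real (F t) * exp (- (s * of_real t))))
      \<longlongrightarrow> (LINT t:{0..}|lborel. of_real (F t) * exp (- (s * of_real t)))) at_top"
    proof (rule Lim_transform_eventually)
      show "((\<lambda>U. LINT t:{0..U}|lborel. of_real (F t) * exp (- (s * of_real t)))
        \<longlongrightarrow> (LINT t:{0..}|lborel. of_real (F t) * exp (- (s * of_real t)))) at_top"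
        by (rule tendsto_set_lebesgue_integral_at_top[OF _ int]) auto
      show "\<forall>\<^sub>F U in at_top. (LINT t:{0..U}|lborel. of_real (F t) * exp (- (s * of_real t)))
         = integral {0..U} (\<lambda>t. of_real (F t) * exp (- (s * of_real t)))"
        by (intro always_eventually allI set_borel_integral_eq_integral(2) set_integrable_subset[OF int]) auto
    qed
    ultimately have "((\<lambda>U. of_real (F U) * exp (- (s * of_real U))
      + (s + 1) * integral {0..U} (\<lambda>t. of_real (F t) * exp (- (s * of_real t))))
      \<longlongrightarrow> 0 + (s + 1) * (LINT t:{0..}|lborel. of_real (F t) * exp (- (s * of_real t)))) at_top"
      by (intro tendsto_intros)
    from tendsto_unique[OF _ lim this] show ?thesis by simp
  qed
  have "mellin A (s + 1) = (s + 1) * (LINT t:{0..}|lborel. of_real (F t) * exp (- (s * of_real t)))"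
    unfolding mellin_def using L unique by (intro the_equality) (metis, metis)
  then show ?thesis by (simp add: F_def)
qed

section \<open>Uniform bounds for the weighted main term\<close>

lemma Gamma_ge_window:
  fixes w v c :: real
  assumes w: "w > -1" and v: "v \<ge> 0" and c: "\<And>t. v \<le> t \<Longrightarrow> t \<le> v + 1 \<Longrightarrow> c \<le> t powr w * exp (- t)"
  shows "c \<le> Gamma (w + 1)"
proof -
  have B: "has_bochner_integral lborel (\<lambda>t. indicator {0..} t * (t powr w * exp (- t))) (Gamma (w + 1))"
    using has_bochner_integral_Gamma[OF w, of 1] by simp
  have "(LINT t|lborel. indicator {v..v+1} t * c) \<le> (LINT t|lborel. indicator {0..} t * (t powr w * exp (- t)))"
  proof (rule integral_mono)
    show "integrable lborel (\<lambda>t. indicator {0..} t * (t powr w * exp (- t)))" using B by (simp add: has_bochner_integral_iff)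
    show "indicator {v..v+1} t * c \<le> indicator {0..} t * (t powr w * exp (- t))" for t
      using c[of t] v by (auto simp: indicator_def)
  qed (intro integrable_mult_left integrable_indicator_Icc)
  then show ?thesis using B by (simp add: has_bochner_integral_iff)
qed

text \<open>The Gamma integrand over [v, v + 1] is at least v^w exp(-v-1), since the power
  increases. The constant does not depend on the exponent.\<close>

lemma powr_mult_exp_le_Gamma:
  fixes w v :: real
  assumes "w \<ge> 0" "v \<ge> 0" shows "v powr w * exp (- v) \<le> exp 1 * Gamma (w + 1)"
proof -
  have "v powr w * exp (- (v + 1)) \<le> Gamma (w + 1)"
  proof (rule Gamma_ge_window)
    show "v powr w * exp (- (v + 1)) \<le> t powr w * exp (- t)" if "v \<le> t" "t \<le> v + 1" for t
      using assms that by (intro mult_mono powr_mono2) auto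
  qed (use assms in auto)
  then have "exp 1 * (v powr w * exp (- (v + 1))) \<le> exp 1 * Gamma (w + 1)" by (intro mult_left_mono) auto
  moreover have "exp 1 * (v powr w * exp (- (v + 1))) = v powr w * exp (- v)" 
  proof -
    have "exp 1 * exp (- (v + 1)) = exp (- v)" by (simp add: mult_exp_exp)
    then show ?thesis by (metis mult.left_commute)
  qed
  ultimately show ?thesis by linarith
qed

text \<open>On [1, 2] the power is at least 1/t >= 1/2 for every exponent above -1.\<close>

lemma Gamma_ge_const:
  fixes w :: real
  assumes "-1 < w" "w \<le> 0" shows "1 \<le> 2 * exp 2 * Gamma (w + 1)"
proof -
  have "exp (-2) / 2 \<le> Gamma (w + 1)"
  proof (rule Gamma_ge_window[of w 1])
    show "exp (-2) / 2 \<le> t powr w * exp (- t)" if "1 \<le> t" "t \<le> 1 + 1" for t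
    proof -
      have "t powr w \<ge> t powr (-1)" using assms that by (intro powr_mono) auto
      moreover have "t powr (-1) \<ge> 1/2" using that by (simp add: powr_minus_divide field_simps)
      ultimately have "1/2 \<le> t powr w" by linarith
      then have "1/2 * exp (-2) \<le> t powr w * exp (- t)" using that by (intro mult_mono) auto
      then show ?thesis by simp
    qed
  qed (use assms in auto)
  then have "2 * exp 2 * (exp (-2) / 2) \<le> 2 * exp 2 * Gamma (w + 1)" by (intro mult_left_mono) auto
  then show ?thesis using mult_exp_exp[of 2 "-2::real"] by simp
qed

context
  fixes X w :: real
  assumes X: "X \<ge> 1" and w: "w > -1"
begin

lemma Gamma_plus1_pos: "Gamma (w + 1) > 0" using w by (intro Gamma_real_pos) auto

lemma exp_powr_Gamma_le:
  assumes "w \<ge> 0" "t \<ge> 0"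
  shows "exp (- t / X) * (t powr w / Gamma (w + 1)) \<le> exp 1 * X powr w"
proof -
  have "t powr w = X powr w * (t / X) powr w" using assms X by (simp add: powr_divide)
  moreover have "(t / X) powr w * exp (- (t / X)) \<le> exp 1 * Gamma (w + 1)"
    using assms X by (intro powr_mult_exp_le_Gamma) auto
  then have "X powr w * ((t / X) powr w * exp (- (t / X))) \<le> X powr w * (exp 1 * Gamma (w + 1))"
    by (intro mult_left_mono) auto
  ultimately show ?thesis using Gamma_plus1_pos by (simp add: field_simps)
qed

lemma exp_1_le: "exp 1 \<le> 2 * exp (2::real)"
proof -
  have "exp 1 \<le> exp (2::real)" by simp
  then show ?thesis using exp_gt_zero[of "2::real"] by linarith
qed

text \<open>For a negative exponent the singularity at 0 is cancelled by the linear vanishing of the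
  weight: t * t^w = t^(w+1) <= 1 for t < 1.\<close>

lemma wt_powr_bound:
  assumes "t \<ge> 0" shows "\<bar>wt X t * (t powr w / Gamma (w + 1))\<bar> \<le> 2 * exp 2 * X powr max w 0"
proof -
  have w0: "wt X t \<ge> 0" using wt_nonneg[of X t] X assms by simp
  have nn: "t powr w / Gamma (w + 1) \<ge> 0" using Gamma_plus1_pos by simp
  have "wt X t * (t powr w / Gamma (w + 1)) \<le> 2 * exp 2 * X powr max w 0"
  proof (cases "w \<ge> 0")
    case True
    have "wt X t * (t powr w / Gamma (w + 1)) \<le> exp (- t / X) * (t powr w / Gamma (w + 1))"
      using wt_le_exp nn by (intro mult_right_mono)
    also have "\<dots> \<le> exp 1 * X powr w" by (rule exp_powr_Gamma_le[OF True assms])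
    also have "\<dots> \<le> 2 * exp 2 * X powr w" using exp_1_le by (intro mult_right_mono) auto
    finally show ?thesis using True by simp
  next
    case False
    have "wt X t * t powr w \<le> 1"
    proof (cases "t \<ge> 1")
      case True
      have "t powr w \<le> 1" using True False using powr_mono[of w 0 t] by simp
      then have "wt X t * t powr w \<le> 1 * 1" using w0 wt_le[of X t] by (intro mult_mono) auto
      then show ?thesis by simp
    next
      case small: False
      have "wt X t \<le> 1 * (1 - exp (- t / X))" unfolding wt_factor using assms X by (intro mult_right_mono) auto
      also have "\<dots> \<le> t / X" using exp_ge_add_one_self[of "- t / X"] by simp
      also have "\<dots> \<le> t" using X assms mult_right_mono[of 1 X t] by (simp add: field_simps)
      finally have "wt X t * t powr w \<le> t * t powr w" by (intro mult_right_mono) auto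
      also have "\<dots> = t powr (w + 1)" using assms by (cases "t = 0") (auto simp: powr_add)
      also have "\<dots> \<le> 1" using small assms w by (intro powr_le1) auto
      finally show ?thesis .
    qed
    then have "wt X t * t powr w / Gamma (w + 1) \<le> 1 / Gamma (w + 1)" using Gamma_plus1_pos by (intro divide_right_mono) auto
    also have "\<dots> \<le> 2 * exp 2" using Gamma_ge_const[of w] w False Gamma_plus1_pos by (simp add: field_simps)
    finally show ?thesis using False X by simp
  qed
  then show ?thesis unfolding abs_of_nonneg[OF mult_nonneg_nonneg[OF w0 nn]] .
qed

lemma exp_powr_bound:
  assumes "t \<ge> 1/4" shows "exp (- t / X) * (t powr w / Gamma (w + 1)) \<le> 8 * exp 2 * X powr max w 0"
proof (cases "w \<ge> 0")
  case True
  have "exp (- t / X) * (t powr w / Gamma (w + 1)) \<le> exp 1 * X powr w"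
    by (rule exp_powr_Gamma_le) (use True assms in auto)
  also have "\<dots> \<le> 8 * exp 2 * X powr w" using exp_1_le exp_gt_zero[of "2::real"] by (intro mult_right_mono) (linarith, simp)
  finally show ?thesis using True by simp
next
  case False
  have "t powr w \<le> (1/4) powr w" using assms False by (intro powr_mono2') auto
  also have "(1/4::real) powr w \<le> (1/4) powr (-1)" using w by (intro powr_mono') auto
  finally have "t powr w \<le> 4" by (simp add: powr_minus_divide)
  then have "exp (- t / X) * t powr w \<le> 1 * 4" using assms X by (intro mult_mono) auto
  then have "exp (- t / X) * (t powr w / Gamma (w + 1)) \<le> 4 * (1 / Gamma (w + 1))"
    using Gamma_plus1_pos by (simp add: divide_right_mono)
  also have "\<dots> \<le> 4 * (2 * exp 2)" using Gamma_ge_const[of w] w False Gamma_plus1_pos by (intro mult_left_mono) (auto simp: field_simps)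
  finally show ?thesis using False X by simp
qed

text \<open>Bound on the derivative, uniform in the exponent. For w >= 1 the factor w is absorbed by
  Gamma(w+1) = w Gamma(w). For w < 1 it is at most 1 in absolute value, and 1/t <= 4 because t >=
  X/4 >= 1/4; this gives 8 + 4 * 8 = 40.\<close>

lemma wt_powr_lipschitz:
  assumes "t \<ge> X / 4" "t' \<ge> X / 4"
  shows "\<bar>wt X t * (t powr w / Gamma (w + 1)) - wt X t' * (t' powr w / Gamma (w + 1))\<bar> \<le> 40 * exp 2 * X powr max w 0 * \<bar>t - t'\<bar>"
proof -
  define d where "d = (\<lambda>t. (- exp (- t / X) / X + 2 * exp (- 2 * t / X) / X) * (t powr w / Gamma (w + 1))
      + wt X t * (w * t powr (w - 1) / Gamma (w + 1)))"
  have der: "((\<lambda>t. wt X t * (t powr w / Gamma (w + 1))) has_field_derivative d t) (at t within {X/4..})" if "t \<in> {X/4..}" for t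
  proof -
    have "t > 0" using that X by auto
    then show ?thesis unfolding wt_def d_def using X Gamma_plus1_pos
      by (auto intro!: derivative_eq_intros simp: field_simps)
  qed
  have bound: "norm (d t) \<le> 40 * exp 2 * X powr max w 0" if "t \<in> {X/4..}" for t
  proof -
    have t: "t \<ge> 1/4" using that X by auto
    define q where "q = exp (- t / X)"
    have q: "0 < q" "q \<le> 1" using t X by (auto simp: q_def)
    have q2: "exp (- 2 * t / X) = q * q" by (simp add: q_def mult_exp_exp)
    have "\<bar>- q / X + 2 * (q * q) / X\<bar> = q * \<bar>2 * q - 1\<bar> / X"
    proof -
      have "- q / X + 2 * (q * q) / X = q * (2 * q - 1) / X" by (simp add: algebra_simps add_divide_distrib diff_divide_distrib)
      then show ?thesis using q X by (simp add: abs_mult)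
    qed
    also have "\<dots> \<le> q * 1 / 1" using q X by (intro frac_le mult_left_mono) auto
    finally have d1: "\<bar>- q / X + 2 * (q * q) / X\<bar> \<le> q" by simp
    have nn: "t powr w / Gamma (w + 1) \<ge> 0" using Gamma_plus1_pos by simp
    have b: "q * (t powr w / Gamma (w + 1)) \<le> 8 * exp 2 * X powr max w 0"
      unfolding q_def by (rule exp_powr_bound[OF t])
    have T1: "\<bar>(- q / X + 2 * (q * q) / X) * (t powr w / Gamma (w + 1))\<bar> \<le> 8 * exp 2 * X powr max w 0"
      unfolding abs_mult using mult_right_mono[OF d1 nn] b nn by linarith
    have wq: "\<bar>wt X t\<bar> \<le> q" using wt_nonneg[of X t] wt_le_exp[of X t] X t by (simp add: q_def)
    have T2: "\<bar>wt X t * (w * t powr (w - 1) / Gamma (w + 1))\<bar> \<le> 32 * exp 2 * X powr max w 0"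
    proof (cases "w < 1")
      case True
      have "t powr (w - 1) = t powr w / t" using t by (simp add: powr_diff)
      also have "\<dots> \<le> t powr w / (1/4)" using t by (intro divide_left_mono) auto
      finally have "\<bar>w\<bar> * t powr (w - 1) \<le> 1 * (4 * t powr w)" using w True by (intro mult_mono) auto
      then have "\<bar>w * t powr (w - 1) / Gamma (w + 1)\<bar> \<le> 4 * (t powr w / Gamma (w + 1))"
        using Gamma_plus1_pos by (simp add: abs_mult divide_right_mono)
      then have "\<bar>wt X t\<bar> * \<bar>w * t powr (w - 1) / Gamma (w + 1)\<bar> \<le> q * (4 * (t powr w / Gamma (w + 1)))"
        using wq q by (intro mult_mono) auto
      also have "q * (4 * (t powr w / Gamma (w + 1))) = 4 * (q * (t powr w / Gamma (w + 1)))" by simp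
      also have "\<dots> \<le> 4 * (8 * exp 2 * X powr max w 0)" using b by (rule mult_left_mono) simp
      also have "\<dots> = 32 * exp 2 * X powr max w 0" by simp
      finally show ?thesis unfolding abs_mult[of "wt X t"] .
    next
      case False
      have G: "Gamma (w + 1) = w * Gamma w" using False by (intro Gamma_plus1) (auto elim!: nonpos_Ints_cases)
      have "Gamma w > 0" using False by (intro Gamma_real_pos) auto
      have "w * t powr (w - 1) / Gamma (w + 1) = t powr (w - 1) / Gamma w" using False G by simp
      moreover have "q * (t powr (w - 1) / Gamma w) \<le> exp 1 * X powr (w - 1)"
      proof -
        have "t powr (w - 1) = X powr (w - 1) * (t / X) powr (w - 1)" using t X by (simp add: powr_divide)
        moreover have "(t / X) powr (w - 1) * exp (- (t / X)) \<le> exp 1 * Gamma (w - 1 + 1)"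
          using t X False by (intro powr_mult_exp_le_Gamma) auto
        then have "X powr (w - 1) * ((t / X) powr (w - 1) * exp (- (t / X))) \<le> X powr (w - 1) * (exp 1 * Gamma w)"
          by (intro mult_left_mono) auto
        ultimately show ?thesis using \<open>Gamma w > 0\<close> by (simp add: field_simps q_def)
      qed
      moreover have "exp 1 * X powr (w - 1) \<le> 32 * exp 2 * X powr w"
        using X exp_1_le exp_gt_zero[of "2::real"] by (intro mult_mono powr_mono) (linarith | simp)+
      moreover have "\<bar>wt X t\<bar> * (t powr (w - 1) / Gamma w) \<le> q * (t powr (w - 1) / Gamma w)"
        using wq \<open>Gamma w > 0\<close> by (intro mult_right_mono) auto
      ultimately show ?thesis using False \<open>Gamma w > 0\<close> by (simp add: abs_mult)
    qed
    have "8 * exp 2 * X powr max w 0 + 32 * exp 2 * X powr max w 0 = 40 * exp 2 * X powr max w 0" by simp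
    then show ?thesis
      using order_trans[OF abs_triangle_ineq add_mono[OF T1 T2]] unfolding d_def q2 q_def[symmetric] real_norm_def by (simp only:)
  qed
  have "norm (wt X t * (t powr w / Gamma (w + 1)) - wt X t' * (t' powr w / Gamma (w + 1))) \<le> 40 * exp 2 * X powr max w 0 * norm (t - t')"
    by (rule field_differentiable_bound[of "{X/4..}", OF _ der bound]) (use assms in auto)
  then show ?thesis by simp
qed

text \<open>One constant serves both bounds: the size needs 4, the Lipschitz estimate 80 from the
  weighted power and 8 from the oscillation with frequency \<open>b\<close>.\<close>

lemma wt_term_bounds:
  fixes c :: complex and b :: real
  defines "r \<equiv> \<lambda>t. 2 * Re (c * exp (- \<i> * of_real (b * t)))"
  shows "t \<ge> 0 \<Longrightarrow> \<bar>wt X t * (t powr w / Gamma (w + 1) * r t)\<bar> \<le> 160 * exp 2 * (norm c * (1 + \<bar>b\<bar>)) * X powr max w 0"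
    and "t \<ge> X / 4 \<Longrightarrow> t' \<ge> X / 4 \<Longrightarrow>
      \<bar>wt X t * (t powr w / Gamma (w + 1) * r t) - wt X t' * (t' powr w / Gamma (w + 1) * r t')\<bar>
        \<le> 160 * exp 2 * (norm c * (1 + \<bar>b\<bar>)) * X powr max w 0 * \<bar>t - t'\<bar>"
proof -
  define u where "u = (\<lambda>t. wt X t * (t powr w / Gamma (w + 1)))"
  define Y where "Y = exp 2 * X powr max w 0"
  have Y: "Y \<ge> 0" by (simp add: Y_def)
  have r: "\<bar>r t\<bar> \<le> 2 * norm c" for t
  proof -
    have "norm (exp (- \<i> * of_real (b * t))) = 1" by simp
    then have "norm (c * exp (- \<i> * of_real (b * t))) = norm c" unfolding norm_mult by simp
    then show ?thesis using abs_Re_le_cmod[of "c * exp (- \<i> * of_real (b * t))"] by (simp add: r_def)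
  qed
  have r_eq: "r t = 2 * (Re c * cos (b * t) + Im c * sin (b * t))" for t
    by (simp add: r_def Re_exp Im_exp)
  have r_lip: "\<bar>r t - r t'\<bar> \<le> 4 * norm c * \<bar>b\<bar> * \<bar>t - t'\<bar>" for t t'
  proof -
    have "norm (r t - r t') \<le> 4 * norm c * \<bar>b\<bar> * norm (t - t')"
    proof (rule field_differentiable_bound[of UNIV])
      fix s :: real
      show "(r has_field_derivative 2 * (Re c * (- sin (b * s) * b) + Im c * (cos (b * s) * b))) (at s within UNIV)"
        unfolding r_eq[abs_def] by (auto intro!: derivative_eq_intros)
      have two: "\<bar>2 * (x + y)\<bar> \<le> 4 * k" if "\<bar>x\<bar> \<le> k" "\<bar>y\<bar> \<le> k" for x y k :: real
        using that abs_triangle_ineq[of x y] by (simp add: abs_mult)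
      have "\<bar>Re c * (- sin (b * s) * b)\<bar> \<le> norm c * (1 * \<bar>b\<bar>)"
        unfolding abs_mult by (intro mult_mono abs_Re_le_cmod) (auto simp: abs_mult)
      moreover have "\<bar>Im c * (cos (b * s) * b)\<bar> \<le> norm c * (1 * \<bar>b\<bar>)"
        unfolding abs_mult by (intro mult_mono abs_Im_le_cmod) (auto simp: abs_mult)
      ultimately show "norm (2 * (Re c * (- sin (b * s) * b) + Im c * (cos (b * s) * b))) \<le> 4 * norm c * \<bar>b\<bar>"
        unfolding real_norm_def using two[of _ "norm c * (1 * \<bar>b\<bar>)"] by (simp add: mult.assoc)
    qed auto
    then show ?thesis by simp
  qed
  have eq: "wt X t * (t powr w / Gamma (w + 1) * r t) = u t * r t" for t by (simp add: u_def)
  have u: "\<bar>u t\<bar> \<le> 2 * Y" if "t \<ge> 0" for t using wt_powr_bound[OF that] by (simp add: u_def Y_def)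
  have cY: "0 \<le> norm c * Y" "0 \<le> norm c * \<bar>b\<bar> * Y" using Y by auto
  have rhs: "160 * exp 2 * (norm c * (1 + \<bar>b\<bar>)) * X powr max w 0 = 160 * (norm c * Y) + 160 * (norm c * \<bar>b\<bar> * Y)"
    by (simp add: Y_def algebra_simps)
  show "\<bar>wt X t * (t powr w / Gamma (w + 1) * r t)\<bar> \<le> 160 * exp 2 * (norm c * (1 + \<bar>b\<bar>)) * X powr max w 0" if "t \<ge> 0"
  proof -
    have "\<bar>u t * r t\<bar> \<le> 2 * Y * (2 * norm c)" unfolding abs_mult using u[OF that] r[of t] Y by (intro mult_mono) auto
    then show ?thesis unfolding eq rhs using cY by (simp add: mult.commute)
  qed
  show "\<bar>wt X t * (t powr w / Gamma (w + 1) * r t) - wt X t' * (t' powr w / Gamma (w + 1) * r t')\<bar>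
        \<le> 160 * exp 2 * (norm c * (1 + \<bar>b\<bar>)) * X powr max w 0 * \<bar>t - t'\<bar>" if "t \<ge> X / 4" "t' \<ge> X / 4"
  proof -
    have "u t * r t - u t' * r t' = (u t - u t') * r t + u t' * (r t - r t')" by (simp add: algebra_simps)
    also have "\<bar>\<dots>\<bar> \<le> \<bar>u t - u t'\<bar> * \<bar>r t\<bar> + \<bar>u t'\<bar> * \<bar>r t - r t'\<bar>"
      by (rule order_trans[OF abs_triangle_ineq]) (simp add: abs_mult)
    also have "\<bar>u t - u t'\<bar> * \<bar>r t\<bar> \<le> (40 * Y * \<bar>t - t'\<bar>) * (2 * norm c)"
      using wt_powr_lipschitz[OF that] r[of t] Y by (intro mult_mono) (auto simp: u_def Y_def)
    also have "\<bar>u t'\<bar> * \<bar>r t - r t'\<bar> \<le> (2 * Y) * (4 * norm c * \<bar>b\<bar> * \<bar>t - t'\<bar>)"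
      using u[of t'] r_lip[of t t'] Y that X by (intro mult_mono) auto
    finally have "\<bar>u t * r t - u t' * r t'\<bar> \<le> (80 * (norm c * Y) + 8 * (norm c * \<bar>b\<bar> * Y)) * \<bar>t - t'\<bar>"
      by (simp add: algebra_simps)
    also have "\<dots> \<le> (160 * (norm c * Y) + 160 * (norm c * \<bar>b\<bar> * Y)) * \<bar>t - t'\<bar>"
      using cY by (intro mult_right_mono) linarith+
    finally show ?thesis unfolding eq rhs .
  qed
qed

end

section \<open>Moduli of decrease\<close>

text \<open>Chaining along x, lam x, lam^2 x and so on; since \<open>D\<close> does not increase,
  each link costs at most \<open>D x\<close>.\<close>

lemma iterate_drop:
  fixes f D :: "real \<Rightarrow> real"
  assumes step: "\<And>x y. a \<le> x \<Longrightarrow> x \<le> y \<Longrightarrow> y \<le> lam * x \<Longrightarrow> f y - f x \<ge> - D x"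
    and D: "\<And>x y. a \<le> x \<Longrightarrow> x \<le> y \<Longrightarrow> D y \<le> D x" "\<And>x. a \<le> x \<Longrightarrow> D x \<ge> 0"
    and "a > 0" "lam > 1"
  shows "a \<le> x \<Longrightarrow> x \<le> y \<Longrightarrow> y \<le> lam ^ k * x \<Longrightarrow> f y - f x \<ge> - real k * D x"
proof (induction k arbitrary: x)
  case (Suc k)
  show ?case
  proof (cases "y \<le> lam * x")
    case True
    then have "f y - f x \<ge> - D x" using step Suc.prems by blast
    moreover have "real k * D x \<ge> 0" using D(2) Suc.prems by simp
    ultimately show ?thesis by (simp add: algebra_simps)
  next
    case False
    have le: "x \<le> lam * x" using \<open>lam > 1\<close> \<open>a > 0\<close> Suc.prems by simp
    have 1: "f (lam * x) - f x \<ge> - D x" using step[of x "lam * x"] Suc.prems le by simp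
    have "f y - f (lam * x) \<ge> - real k * D (lam * x)"
      using False Suc.prems le by (intro Suc.IH) (auto simp: mult_ac)
    moreover have "real k * D (lam * x) \<le> real k * D x" using D(1)[of x "lam * x"] Suc.prems le by (intro mult_left_mono) auto
    ultimately show ?thesis using 1 by (simp add: algebra_simps)
  qed
qed simp

lemma ereal_INF_pairs_le:
  assumes "P x y"
  shows "(INF (x, y)\<in>{(x, y). P x y}. ereal (g x y)) \<le> ereal (g x y)"
  by (rule INF_lower2[of "(x, y)"]) (use assms in auto)

lemma ereal_le_INF_pairs:
  assumes "\<And>x y. P x y \<Longrightarrow> c \<le> g x y"
  shows "ereal c \<le> (INF (x, y)\<in>{(x, y). P x y}. ereal (g x y))"
proof (rule INF_greatest)
  fix p assume "p \<in> {(x, y). P x y}"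
  then have "c \<le> g (fst p) (snd p)" by (intro assms) auto
  then show "ereal c \<le> (case p of (x, y) \<Rightarrow> ereal (g x y))" by (simp add: case_prod_beta)
qed

lemma nu_bar_nonneg: assumes "1 \<le> lam" "a > 0" shows "nu_bar f a lam \<ge> 0"
proof -
  have "(INF (x, y)\<in>{(x, y). a \<le> x \<and> x \<le> y \<and> y \<le> lam * x}. ereal (f y - f x)) \<le> ereal (f a - f a)"
    by (rule ereal_INF_pairs_le[of "\<lambda>x y. a \<le> x \<and> x \<le> y \<and> y \<le> lam * x" a a "\<lambda>x y. f y - f x"])
       (use assms in auto)
  also have "ereal (f a - f a) = 0" by simp
  finally show ?thesis unfolding nu_bar_def by (simp only: ereal_0_le_uminus_iff)
qed

lemma nu_bar_le:
  assumes "\<And>x y. a \<le> x \<Longrightarrow> x \<le> y \<Longrightarrow> y \<le> lam * x \<Longrightarrow> f y - f x \<ge> - c"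
  shows "nu_bar f a lam \<le> ereal c"
proof -
  have "ereal (- c) \<le> (INF (x, y)\<in>{(x, y). a \<le> x \<and> x \<le> y \<and> y \<le> lam * x}. ereal (f y - f x))"
    by (rule ereal_le_INF_pairs[of "\<lambda>x y. a \<le> x \<and> x \<le> y \<and> y \<le> lam * x" "- c" "\<lambda>x y. f y - f x"])
       (elim conjE, rule assms)
  then have "- (INF (x, y)\<in>{(x, y). a \<le> x \<and> x \<le> y \<and> y \<le> lam * x}. ereal (f y - f x)) \<le> - ereal (- c)"
    by (simp only: ereal_minus_le_minus)
  then show ?thesis unfolding nu_bar_def by (simp only: uminus_ereal.simps minus_minus)
qed

lemma drop_of_nu_bar:
  assumes "nu_bar f a lam = ereal c" "a \<le> x" "x \<le> y" "y \<le> lam * x"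
  shows "f y - f x \<ge> - c"
proof -
  have "(INF (x, y)\<in>{(x, y). a \<le> x \<and> x \<le> y \<and> y \<le> lam * x}. ereal (f y - f x)) \<le> ereal (f y - f x)"
    by (rule ereal_INF_pairs_le[of "\<lambda>x y. a \<le> x \<and> x \<le> y \<and> y \<le> lam * x" x y "\<lambda>x y. f y - f x"])
       (use assms in auto)
  moreover have "(INF (x, y)\<in>{(x, y). a \<le> x \<and> x \<le> y \<and> y \<le> lam * x}. ereal (f y - f x)) = - ereal c"
    using arg_cong[OF assms(1), of uminus] unfolding nu_bar_def by (simp only: ereal_uminus_uminus)
  ultimately have "- ereal c \<le> ereal (f y - f x)" by (simp only:)
  then show ?thesis by simp
qed

text \<open>Slow decrease supplies one ratio \<open>lam > 1\<close> for which the drop is at most 1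
  far out. Finitely many such steps cover the ratio \<open>L\<close>; on the remaining bounded range
  local boundedness gives a drop of at most 2B.\<close>

lemma nu_bar_finite:
  assumes sd: "slowly_decreasing f" and bdd: "\<And>X. \<exists>B. \<forall>x\<in>{1..X}. \<bar>f x\<bar> \<le> B" and L: "L > 1"
  shows "\<exists>c\<ge>0. nu_bar f 1 L = ereal c"
proof -
  have "\<forall>\<^sub>F lam in at_right 1. Liminf at_top (\<lambda>x. INF y\<in>{x..lam * x}. ereal (f y - f x)) > -1"
    using sd unfolding slowly_decreasing_def by (rule order_tendstoD) simp
  moreover have "\<forall>\<^sub>F lam in at_right (1::real). lam > 1" by (simp add: eventually_at_right_less)
  ultimately have "\<forall>\<^sub>F lam in at_right (1::real). lam > 1 \<and> Liminf at_top (\<lambda>x. INF y\<in>{x..lam * x}. ereal (f y - f x)) > -1"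
    by eventually_elim simp
  then obtain lam where lam: "lam > 1" "Liminf at_top (\<lambda>x. INF y\<in>{x..lam * x}. ereal (f y - f x)) > -1"
    using eventually_happens[of _ "at_right (1::real)"] by auto
  from less_LiminfD[OF lam(2)] obtain x0 where x0: "\<And>x. x \<ge> x0 \<Longrightarrow> (INF y\<in>{x..lam * x}. ereal (f y - f x)) > -1"
    unfolding eventually_at_top_linorder by blast
  define x1 where "x1 = max x0 1"
  have step: "f y - f x \<ge> - 1" if "x1 \<le> x" "x \<le> y" "y \<le> lam * x" for x y
  proof -
    have "-1 < ereal (f y - f x)"
      by (rule less_le_trans[OF x0]) (use that in \<open>auto simp: x1_def intro!: INF_lower\<close>)
    then show ?thesis by (simp add: one_ereal_def)
  qed
  obtain k where k: "L < lam ^ k" using real_arch_pow[OF lam(1)] by blast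
  have far: "f y - f x \<ge> - real k * 1" if "x1 \<le> x" "x \<le> y" "y \<le> L * x" for x y
  proof (rule iterate_drop[where f = f and D = "\<lambda>_. 1" and a = x1 and lam = lam])
    have "L * x \<le> lam ^ k * x" using k that by (intro mult_right_mono) (auto simp: x1_def)
    then show "y \<le> lam ^ k * x" using that by linarith
  qed (use step that lam in \<open>auto simp: x1_def\<close>)
  obtain B where B: "\<And>x. x \<in> {1..L * x1} \<Longrightarrow> \<bar>f x\<bar> \<le> B" using bdd by blast
  have "nu_bar f 1 L \<le> ereal (max (real k) (2 * B))"
  proof (rule nu_bar_le)
    fix x y assume xy: "1 \<le> x" "x \<le> y" "y \<le> L * x"
    show "- max (real k) (2 * B) \<le> f y - f x"
    proof (cases "x1 \<le> x")
      case True
      then show ?thesis using far[OF True xy(2,3)] by linarith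
    next
      case False
      then have "L * x \<le> L * x1" using L by (intro mult_left_mono) auto
      then have "\<bar>f x\<bar> \<le> B" "\<bar>f y\<bar> \<le> B" using xy by (auto intro!: B)
      then show ?thesis by linarith
    qed
  qed
  moreover define M where "M = max (real k) (2 * B)"
  ultimately have "nu_bar f 1 L \<le> ereal M" by (simp only:)
  moreover have "nu_bar f 1 L \<ge> 0" using L by (intro nu_bar_nonneg) auto
  ultimately show ?thesis by (cases "nu_bar f 1 L") auto
qed

text \<open>\<open>nu\<close> cannot be infinite, by the bound through the finite
  \<open>nu_bar\<close>, nor minus infinite, by the pair x = y. \<open>\<Psi>\<close> is nonnegative
  because it decreases to 0. Pairs x = y also give \<open>nu\<close> + \<open>\<Psi> x\<close> >= 0,
  and x tending to infinity yields \<open>nu\<close> >= 0.\<close>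

lemma decrease_remainderD:
  assumes dr: "decrease_remainder f 1 lam \<Psi>" and fin: "nu_bar f 1 lam \<le> ereal c" and lam: "lam \<ge> 1"
  shows "\<And>x y. 1 \<le> x \<Longrightarrow> x \<le> y \<Longrightarrow> y \<le> lam * x \<Longrightarrow> f y - f x \<ge> - (real_of_ereal (nu f lam) + \<Psi> x)"
    and "real_of_ereal (nu f lam) \<ge> 0" and "real_of_ereal (nu f lam) + \<Psi> 1 \<le> c"
    and "\<And>x y. 1 \<le> x \<Longrightarrow> x \<le> y \<Longrightarrow> \<Psi> y \<le> \<Psi> x" and "\<And>x. 1 \<le> x \<Longrightarrow> \<Psi> x \<ge> 0"
proof -
  have mono: "\<And>x y. 1 \<le> x \<Longrightarrow> x \<le> y \<Longrightarrow> \<Psi> y \<le> \<Psi> x" and lim: "(\<Psi> \<longlongrightarrow> 0) at_top"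
    using dr unfolding decrease_remainder_def by (auto simp: monotone_on_def)
  have 1: "ereal (f y - f x) \<ge> - nu f lam - ereal (\<Psi> x)" if "1 \<le> x" "x \<le> y" "y \<le> lam * x" for x y
    using dr that unfolding decrease_remainder_def by blast
  have 2: "- nu f lam - ereal (\<Psi> 1) \<ge> - nu_bar f 1 lam"
  proof -
    have "1 \<le> (1::real)" "1 \<le> lam * 1" using lam by auto
    then show ?thesis using dr unfolding decrease_remainder_def by blast
  qed
  have pos: "nu_bar f 1 lam \<ge> 0" using lam by (intro nu_bar_nonneg) auto
  obtain v where v: "nu f lam = ereal v"
  proof (cases "nu f lam")
    case PInf
    then show ?thesis using 2 fin pos by (cases "nu_bar f 1 lam") auto
  next
    case MInf
    then show ?thesis using 1[of 1 1] lam by simp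
  qed (use that in auto)
  show psi: "\<Psi> x \<ge> 0" if "1 \<le> x" for x
  proof -
    have "\<forall>\<^sub>F y in at_top. \<Psi> y \<le> \<Psi> x"
      using eventually_ge_at_top[of x] by eventually_elim (rule mono[OF that])
    from tendsto_upperbound[OF lim this] show ?thesis by simp
  qed
  show "f y - f x \<ge> - (real_of_ereal (nu f lam) + \<Psi> x)" if "1 \<le> x" "x \<le> y" "y \<le> lam * x" for x y
    using 1[OF that] by (simp add: v)
  have nn: "v + \<Psi> x \<ge> 0" if "x \<ge> 1" for x
  proof -
    have "x \<le> lam * x" using lam that by simp
    then show ?thesis using 1[of x x] that by (simp add: v)
  qed
  have "((\<lambda>x. v + \<Psi> x) \<longlongrightarrow> v + 0) at_top" by (intro tendsto_intros lim)
  moreover have "\<forall>\<^sub>F x in at_top. 0 \<le> v + \<Psi> x"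
    using eventually_ge_at_top[of "1::real"] by eventually_elim (rule nn)
  ultimately have "0 \<le> v + 0" by (rule tendsto_lowerbound) simp
  then have "v \<ge> 0" by simp
  then show "real_of_ereal (nu f lam) \<ge> 0" by (simp add: v)
  show "real_of_ereal (nu f lam) + \<Psi> 1 \<le> c"
  proof -
    obtain r where r: "nu_bar f 1 lam = ereal r" "r \<le> c" using fin pos by (cases "nu_bar f 1 lam") auto
    have "- r \<le> - v - \<Psi> 1" using 2 unfolding v r(1) by simp
    then show ?thesis using r(2) by (simp add: v)
  qed
  show "\<And>x y. 1 \<le> x \<Longrightarrow> x \<le> y \<Longrightarrow> \<Psi> y \<le> \<Psi> x" by (rule mono)
qed

section \<open>The theorem\<close>

lemma fourier_scale:
  assumes "T > 0" shows "fourier (\<lambda>u. H (u / T)) \<tau> = of_real T * fourier H (T * \<tau>)"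
proof -
  have "fourier (\<lambda>u. H (u / T)) \<tau> = \<bar>T\<bar> *\<^sub>R (LINT u|lborel. cis (- (\<tau> * (0 + T * u))) * H ((0 + T * u) / T))"
    unfolding fourier_def using assms by (intro lborel_integral_real_affine) auto
  then show ?thesis using assms by (simp add: fourier_def scaleR_conv_of_real mult_ac)
qed

text \<open>The factor \<open>T\<close> from the dilation is exactly the Jacobian of the change of
  frequency, so no power of \<open>T\<close> appears.\<close>

lemma fourier_scale_L1:
  assumes "T > 0"
  shows "(LINT \<tau>|lborel. indicator {-1..1} \<tau> *\<^sub>R norm (fourier (\<lambda>u. H (u / T)) \<tau>))
    = (LINT \<tau>|lborel. indicator {-T..T} \<tau> *\<^sub>R norm (fourier H \<tau>))"
proof -
  have "(LINT \<tau>|lborel. indicator {-T..T} \<tau> *\<^sub>R norm (fourier H \<tau>))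
      = \<bar>T\<bar> *\<^sub>R (LINT \<tau>|lborel. indicator {-T..T} (0 + T * \<tau>) *\<^sub>R norm (fourier H (0 + T * \<tau>)))"
    using assms by (intro lborel_integral_real_affine) auto
  also have "\<dots> = (LINT \<tau>|lborel. T * (indicator {-T..T} (T * \<tau>) * norm (fourier H (T * \<tau>))))"
    using assms by simp
  also have "\<dots> = (LINT \<tau>|lborel. indicator {-1..1} \<tau> *\<^sub>R norm (fourier (\<lambda>u. H (u / T)) \<tau>))"
  proof (rule Bochner_Integration.integral_cong[OF refl])
    fix \<tau> :: real
    have "indicator {-T..T} (T * \<tau>) = (indicator {-1..1} \<tau> :: real)"
      using assms mult_le_cancel_left_pos[of T "-1" \<tau>] mult_le_cancel_left_pos[of T \<tau> 1] by (auto simp: indicator_def)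
    then show "T * (indicator {-T..T} (T * \<tau>) * norm (fourier H (T * \<tau>)))
        = indicator {-1..1} \<tau> *\<^sub>R norm (fourier (\<lambda>u. H (u / T)) \<tau>)"
      using assms by (simp add: fourier_scale norm_mult)
  qed
  finally show ?thesis by simp
qed

lemma exp_Complex: "exp (- (Complex a \<tau> * of_real t)) = of_real (exp (- (a * t))) * cis (- (\<tau> * t))"
proof -
  have "- (Complex a \<tau> * of_real t) = of_real (- (a * t)) + \<i> * of_real (- (\<tau> * t))"
    by (simp add: complex_eq_iff)
  then show ?thesis by (simp only: exp_add exp_of_real cis_conv_exp)
qed

text \<open>Twice the real part is the sum of two conjugate exponentials; each shifts the argument
  of the Laplace transform of a power by plus or minus ib.\<close>

lemma has_bochner_integral_oscillation:
  fixes c s :: complex and b w :: real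
  assumes w: "w > -1" and s: "Re s > 0"
  shows "has_bochner_integral lborel
    (\<lambda>t. indicator {0..} t *\<^sub>R (of_real (t powr w / Gamma (w + 1) * (2 * Re (c * exp (- \<i> * of_real (b * t))))) * exp (- (s * of_real t))))
    (c / (s + \<i> * of_real b) powr of_real (w + 1) + cnj c / (s - \<i> * of_real b) powr of_real (w + 1))"
proof -
  have G: "Gamma (w + 1) > 0" using w by (intro Gamma_real_pos) auto
  have L: "has_bochner_integral lborel (\<lambda>t. indicator {0..} t *\<^sub>R (of_real (t powr w) * exp (- (a * of_real t))) * (d / of_real (Gamma (w + 1))))
     (d / a powr of_real (w + 1))" if "Re a > 0" for a d :: complex
    using has_bochner_integral_mult_left[OF has_bochner_integral_laplace_powr[OF w that], of "d / of_real (Gamma (w + 1))"] G by simp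
  have "has_bochner_integral lborel (\<lambda>t. indicator {0..} t *\<^sub>R (of_real (t powr w) * exp (- ((s + \<i> * of_real b) * of_real t))) * (c / of_real (Gamma (w + 1)))
      + indicator {0..} t *\<^sub>R (of_real (t powr w) * exp (- ((s - \<i> * of_real b) * of_real t))) * (cnj c / of_real (Gamma (w + 1))))
     (c / (s + \<i> * of_real b) powr of_real (w + 1) + cnj c / (s - \<i> * of_real b) powr of_real (w + 1))"
    using s by (intro has_bochner_integral_add L) auto
  moreover have "indicator {0..} t *\<^sub>R (of_real (t powr w) * exp (- ((s + \<i> * of_real b) * of_real t))) * (c / of_real (Gamma (w + 1)))
      + indicator {0..} t *\<^sub>R (of_real (t powr w) * exp (- ((s - \<i> * of_real b) * of_real t))) * (cnj c / of_real (Gamma (w + 1)))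
     = indicator {0..} t *\<^sub>R (of_real (t powr w / Gamma (w + 1) * (2 * Re (c * exp (- \<i> * of_real (b * t))))) * exp (- (s * of_real t)))" for t
  proof -
    let ?z = "c * exp (- \<i> * of_real (b * t))"
    have 1: "exp (- ((s + \<i> * of_real b) * of_real t)) = exp (- (s * of_real t)) * exp (- \<i> * of_real (b * t))"
      by (simp add: mult_exp_exp algebra_simps)
    have 2: "exp (- ((s - \<i> * of_real b) * of_real t)) = exp (- (s * of_real t)) * cnj (exp (- \<i> * of_real (b * t)))"
      by (simp add: mult_exp_exp exp_cnj algebra_simps)
    have 3: "of_real (2 * Re ?z) = ?z + cnj ?z" by (rule complex_add_cnj[symmetric])
    have "of_real (t powr w / Gamma (w + 1) * (2 * Re ?z)) = of_real (t powr w) / of_real (Gamma (w + 1)) * (?z + cnj ?z)"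
      unfolding of_real_mult[of "t powr w / Gamma (w + 1)"] 3 by simp
    then show ?thesis unfolding 1 2
      by (simp add: scaleR_conv_of_real ring_distribs add_divide_distrib mult_ac)
  qed
  ultimately show ?thesis by (simp only:)
qed

definition oscillation :: "nat \<Rightarrow> (nat \<Rightarrow> nat) \<Rightarrow> (nat \<Rightarrow> nat \<Rightarrow> complex) \<Rightarrow>
    (nat \<Rightarrow> nat \<Rightarrow> real) \<Rightarrow> (nat \<Rightarrow> real) \<Rightarrow> real \<Rightarrow> real" where
  "oscillation n m c om b t = (\<Sum>k=0..n. \<Sum>l=1..m k.
     t powr om k l / Gamma (om k l + 1) * (2 * Re (c k l * exp (- \<i> * of_real (b k * t)))))"

lemma measurable_oscillation [measurable]: "oscillation n m c om b \<in> borel_measurable borel"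
  unfolding oscillation_def by measurable

lemma main_term_eq: "main_term n m c om b x = x * oscillation n m c om b (ln x)"
  by (simp add: main_term_def oscillation_def)

lemma wt_oscillation_bounds:
  fixes c :: "nat \<Rightarrow> nat \<Rightarrow> complex" and b :: "nat \<Rightarrow> real" and n :: nat and m :: "nat \<Rightarrow> nat"
  assumes X: "X \<ge> 1" and om: "\<forall>k\<le>n. \<forall>l\<in>{1..m k}. -1 < om k l \<and> om k l \<le> Om"
  defines "K \<equiv> 160 * exp 2 * (\<Sum>k=0..n. \<Sum>l=1..m k. norm (c k l) * (1 + \<bar>b k\<bar>))"
  shows "t \<ge> 0 \<Longrightarrow> \<bar>wt X t * oscillation n m c om b t\<bar> \<le> K * X powr max Om 0"
    and "t \<ge> X / 4 \<Longrightarrow> t' \<ge> X / 4 \<Longrightarrow>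
      \<bar>wt X t * oscillation n m c om b t - wt X t' * oscillation n m c om b t'\<bar> \<le> K * X powr max Om 0 * \<bar>t - t'\<bar>"
proof -
  define f where "f = (\<lambda>k l t. wt X t * (t powr om k l / Gamma (om k l + 1) * (2 * Re (c k l * exp (- \<i> * of_real (b k * t))))))"
  define Y where "Y = X powr max Om 0"
  have eq: "wt X t * oscillation n m c om b t = (\<Sum>k=0..n. \<Sum>l=1..m k. f k l t)" for t
    by (simp add: oscillation_def f_def sum_distrib_left)
  have KY: "K * Y = (\<Sum>k=0..n. \<Sum>l=1..m k. 160 * exp 2 * (norm (c k l) * (1 + \<bar>b k\<bar>)) * Y)"
    by (simp add: K_def sum_distrib_left sum_distrib_right)
  have powr: "160 * exp 2 * (norm (c k l) * (1 + \<bar>b k\<bar>)) * X powr max (om k l) 0 \<le> 160 * exp 2 * (norm (c k l) * (1 + \<bar>b k\<bar>)) * Y"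
    if "k \<in> {0..n}" "l \<in> {1..m k}" for k l
    unfolding Y_def using om[rule_format, of k l] that X by (intro mult_left_mono powr_mono) auto
  show "\<bar>wt X t * oscillation n m c om b t\<bar> \<le> K * X powr max Om 0" if t: "t \<ge> 0"
    unfolding eq Y_def[symmetric] KY
  proof (intro order_trans[OF sum_abs] sum_mono)
    fix k l assume kl: "k \<in> {0..n}" "l \<in> {1..m k}"
    show "\<bar>f k l t\<bar> \<le> 160 * exp 2 * (norm (c k l) * (1 + \<bar>b k\<bar>)) * Y"
      unfolding f_def using om[rule_format, of k l] kl
      by (intro order_trans[OF wt_term_bounds(1)[OF X _ t] powr[OF kl]]) auto
  qed
  show "\<bar>wt X t * oscillation n m c om b t - wt X t' * oscillation n m c om b t'\<bar> \<le> K * X powr max Om 0 * \<bar>t - t'\<bar>"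
    if t: "t \<ge> X / 4" "t' \<ge> X / 4"
  proof -
    have "K * Y * \<bar>t - t'\<bar> = (\<Sum>k=0..n. \<Sum>l=1..m k. 160 * exp 2 * (norm (c k l) * (1 + \<bar>b k\<bar>)) * Y * \<bar>t - t'\<bar>)"
      unfolding KY by (simp add: sum_distrib_right)
    moreover have "\<bar>(\<Sum>k=0..n. \<Sum>l=1..m k. f k l t - f k l t')\<bar> \<le> (\<Sum>k=0..n. \<Sum>l=1..m k. 160 * exp 2 * (norm (c k l) * (1 + \<bar>b k\<bar>)) * Y * \<bar>t - t'\<bar>)"
    proof (intro order_trans[OF sum_abs] sum_mono)
      fix k l assume kl: "k \<in> {0..n}" "l \<in> {1..m k}"
      have "\<bar>f k l t - f k l t'\<bar> \<le> 160 * exp 2 * (norm (c k l) * (1 + \<bar>b k\<bar>)) * X powr max (om k l) 0 * \<bar>t - t'\<bar>"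
        unfolding f_def using om[rule_format, of k l] kl by (intro wt_term_bounds(2)[OF X _ t]) auto
      also have "\<dots> \<le> 160 * exp 2 * (norm (c k l) * (1 + \<bar>b k\<bar>)) * Y * \<bar>t - t'\<bar>"
        by (intro mult_right_mono powr[OF kl]) auto
      finally show "\<bar>f k l t - f k l t'\<bar> \<le> 160 * exp 2 * (norm (c k l) * (1 + \<bar>b k\<bar>)) * Y * \<bar>t - t'\<bar>" .
    qed
    ultimately show ?thesis unfolding eq Y_def[symmetric] by (simp add: sum_subtractf)
  qed
qed

lemma G_fun_laplace:
  assumes A: "locally_bounded_variation A" and zero: "\<And>x. x < 1 \<Longrightarrow> A x = 0"
    and L: "\<exists>L. has_mellin A (s + 1) L" and s: "Re s > 0"
    and meas: "(\<lambda>t. A (exp t) * exp (- t)) \<in> borel_measurable borel"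
    and growth: "\<And>\<sigma>. \<sigma> > 0 \<Longrightarrow> \<exists>M\<ge>0. \<forall>t\<ge>0. \<bar>A (exp t) * exp (- t)\<bar> \<le> M * exp (\<sigma> * t)"
    and om: "\<And>k l. k \<le> n \<Longrightarrow> l \<in> {1..m k} \<Longrightarrow> -1 < om k l"
  shows "has_bochner_integral lborel
    (\<lambda>t. indicator {0..} t *\<^sub>R (of_real (A (exp t) * exp (- t) - oscillation n m c om b t) * exp (- (s * of_real t))))
    (G_fun A n m c om b s)"
proof -
  have int: "set_integrable lborel {0..} (\<lambda>t. of_real (A (exp t) * exp (- t)) * exp (- (s * of_real t)))"
    by (rule set_integrable_laplace[OF meas growth s])
  have "s + 1 \<noteq> 0" using s by (metis add.inverse_inverse add_eq_0_iff one_complex.simps(1) uminus_complex.simps(1) less_minus_one_simps(3) order_less_asym)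
  then have m: "1 / (s + 1) * mellin A (s + 1) = (LINT t:{0..}|lborel. of_real (A (exp t) * exp (- t)) * exp (- (s * of_real t)))"
    using mellin_eq_laplace[OF A zero L s meas growth] by simp
  have 1: "has_bochner_integral lborel (\<lambda>t. indicator {0..} t *\<^sub>R (of_real (A (exp t) * exp (- t)) * exp (- (s * of_real t)))) (1 / (s + 1) * mellin A (s + 1))"
    using int unfolding m has_bochner_integral_iff set_integrable_def set_lebesgue_integral_def by simp
  have 2: "has_bochner_integral lborel
     (\<lambda>t. \<Sum>k=0..n. \<Sum>l=1..m k. indicator {0..} t *\<^sub>R (of_real (t powr om k l / Gamma (om k l + 1) * (2 * Re (c k l * exp (- \<i> * of_real (b k * t))))) * exp (- (s * of_real t))))
     (\<Sum>k=0..n. \<Sum>l=1..m k. c k l / (s + \<i> * of_real (b k)) powr of_real (om k l + 1) +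
        cnj (c k l) / (s - \<i> * of_real (b k)) powr of_real (om k l + 1))"
    by (intro has_bochner_integral_sum has_bochner_integral_oscillation s) (use om in auto)
  have eq: "(\<lambda>t. indicator {0..} t *\<^sub>R (of_real (A (exp t) * exp (- t)) * exp (- (s * of_real t)))
     - (\<Sum>k=0..n. \<Sum>l=1..m k. indicator {0..} t *\<^sub>R (of_real (t powr om k l / Gamma (om k l + 1) * (2 * Re (c k l * exp (- \<i> * of_real (b k * t))))) * exp (- (s * of_real t)))))
    = (\<lambda>t. indicator {0..} t *\<^sub>R (of_real (A (exp t) * exp (- t) - oscillation n m c om b t) * exp (- (s * of_real t))))"
    unfolding oscillation_def of_real_diff of_real_sum left_diff_distrib sum_distrib_right scaleR_diff_right scaleR_sum_right by (rule refl)
  show ?thesis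
    using has_bochner_integral_diff[OF 1 2] unfolding eq G_fun_def .
qed

lemma fourier_weighted:
  assumes "X > 0"
    and G: "\<And>s. Re s > 0 \<Longrightarrow> has_bochner_integral lborel (\<lambda>t. indicator {0..} t *\<^sub>R (of_real (h t) * exp (- (s * of_real t)))) (G s)"
  defines "H \<equiv> \<lambda>t. if t < 0 then 0 else wt X t * h t"
  shows "integrable lborel H"
    and "fourier (\<lambda>t. of_real (H t)) \<tau> = G (Complex (1 / X) \<tau>) - G (Complex (2 * (1 / X)) \<tau>)"
proof -
  have B: "has_bochner_integral lborel (\<lambda>t. cis (- (\<tau> * t)) * of_real (H t)) (G (Complex (1 / X) \<tau>) - G (Complex (2 * (1 / X)) \<tau>))" for \<tau>
  proof -
    have "has_bochner_integral lborel (\<lambda>t. indicator {0..} t *\<^sub>R (of_real (h t) * exp (- (Complex (1 / X) \<tau> * of_real t)))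
        - indicator {0..} t *\<^sub>R (of_real (h t) * exp (- (Complex (2 * (1 / X)) \<tau> * of_real t)))) (G (Complex (1 / X) \<tau>) - G (Complex (2 * (1 / X)) \<tau>))"
      using assms(1) by (intro has_bochner_integral_diff G) auto
    moreover have "indicator {0..} t *\<^sub>R (of_real (h t) * exp (- (Complex (1 / X) \<tau> * of_real t)))
        - indicator {0..} t *\<^sub>R (of_real (h t) * exp (- (Complex (2 * (1 / X)) \<tau> * of_real t))) = cis (- (\<tau> * t)) * of_real (H t)" for t
      unfolding exp_Complex by (simp add: H_def wt_def indicator_def algebra_simps)
    ultimately show ?thesis by (simp only:)
  qed
  show "fourier (\<lambda>t. of_real (H t)) \<tau> = G (Complex (1 / X) \<tau>) - G (Complex (2 * (1 / X)) \<tau>)"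
    using B unfolding fourier_def by (simp add: has_bochner_integral_iff)
  have "integrable lborel (\<lambda>t. complex_of_real (H t))"
    using B[of 0] by (simp add: has_bochner_integral_iff)
  then show "integrable lborel H" using integrable_Re by fastforce
qed

lemma eta_eq_fourier:
  fixes H :: "real \<Rightarrow> real"
  assumes H: "integrable lborel H"
    and F: "\<And>\<tau>. fourier (\<lambda>t. of_real (H t)) \<tau> = G (Complex \<sigma> \<tau>) - G (Complex (2 * \<sigma>) \<tau>)"
  shows "eta G \<sigma> T = (LINT \<tau>|lborel. indicator {-T..T} \<tau> *\<^sub>R norm (fourier (\<lambda>t. of_real (H t)) \<tau>))"
proof -
  have H': "integrable lborel (\<lambda>t. complex_of_real (H t))" using H by simp
  have "set_integrable lborel {-T..T} (\<lambda>\<tau>. norm (fourier (\<lambda>t. of_real (H t)) \<tau>))"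
    unfolding set_integrable_def
    by (rule integrable_bounded_Icc) (use H' in \<open>auto intro!: norm_fourier_le\<close>)
  from set_borel_integral_eq_integral(2)[OF this] show ?thesis
    unfolding eta_def set_lebesgue_integral_def F by (simp add: norm_minus_commute)
qed

text \<open>The summand 1 in \<open>K\<close> makes the bound for the weighted main term positive
  even if all coefficients vanish, as the locale demands.\<close>

lemma tauberian_mellin:
  fixes n :: nat and m :: "nat \<Rightarrow> nat" and c :: "nat \<Rightarrow> nat \<Rightarrow> complex" and b :: "nat \<Rightarrow> real"
    and A :: "real \<Rightarrow> real" and T N S X Om :: real
  assumes A: "locally_bounded_variation A" and zero: "\<And>x. x < 1 \<Longrightarrow> A x = 0"
    and mell: "\<And>s. Re s > 1 \<Longrightarrow> \<exists>L. has_mellin A s L" and T: "T > 0"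
    and om: "\<And>k l. k \<le> n \<Longrightarrow> l \<in> {1..m k} \<Longrightarrow> -1 < om k l \<and> om k l \<le> Om"
    and dr: "decrease_remainder (\<lambda>x. A x / x) 1 (exp (1 / T)) \<Psi>"
    and N: "nu_bar (\<lambda>x. A x / x) 1 (exp 1) = ereal N" "N \<ge> 0" and S: "\<bar>A 1\<bar> \<le> S"
    and X: "X \<ge> 1" and TX: "T * X \<ge> 17"
  defines "K \<equiv> 160 * exp 2 * (\<Sum>k=0..n. \<Sum>l=1..m k. norm (c k l) * (1 + \<bar>b k\<bar>)) + 1"
  shows "\<bar>A (exp X) - exp X * oscillation n m c om b X\<bar> \<le>
    (exp 20 * 10 ^ 8 * (1 + 2 * N + S + 2 * K) / (exp (-1) - exp (-2))) *
      (exp X * (real_of_ereal (nu (\<lambda>x. A x / x) (exp (1 / T))) + \<Psi> (exp (X / 2))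
        + eta (G_fun A n m c om b) (1 / X) T + X powr max Om 0 / T))"
proof -
  define f where "f = (\<lambda>x. A x / x)"
  define F where "F = (\<lambda>t. A (exp t) * exp (- t))"
  define P where "P = oscillation n m c om b"
  define G where "G = G_fun A n m c om b"
  define \<nu> where "\<nu> = real_of_ereal (nu f (exp (1 / T)))"
  define \<eta> where "\<eta> = eta G (1 / X) T"
  define Y where "Y = X powr max Om 0"
  define D where "D = (\<lambda>u. \<nu> + \<Psi> (exp (u / T)))"
  have fF: "f (exp t) = F t" for t by (simp add: f_def F_def exp_minus field_simps)
  have Y: "Y \<ge> 1" using X unfolding Y_def by (simp add: ge_one_powr_ge_zero)
  have K: "K \<ge> 1" unfolding K_def by (auto intro!: mult_nonneg_nonneg sum_nonneg)
  have S0: "S \<ge> 0" using S by linarith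
  have one_lt: "exp (1 / T) > 1" using T by simp
  have unit_drop: "f y - f x \<ge> - N" if "1 \<le> x" "x \<le> y" "y \<le> exp 1 * x" for x y
    using drop_of_nu_bar[OF N(1) that] by (simp add: f_def)
  \<comment> \<open>Logarithmic length \<open>r\<close> is covered by at most 1 + r steps of ratio
    e. Everything is thus measured by \<open>nu_bar\<close> at the ratio e, whatever
    \<open>T\<close> is.\<close>
  have long_drop: "f y - f x \<ge> - ((1 + r) * N)" if "1 \<le> x" "x \<le> y" "y \<le> exp r * x" "r \<ge> 0" for x y r
  proof -
    define k where "k = nat \<lceil>r\<rceil>"
    have k: "r \<le> real k" "real k \<le> 1 + r" using that(4) by (auto simp: k_def) linarith
    have "exp r * x \<le> exp 1 ^ k * x"
      using k that by (intro mult_right_mono) (auto simp: exp_of_nat_mult[symmetric])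
    then have "y \<le> exp 1 ^ k * x" using that by linarith
    then have "f y - f x \<ge> - real k * N"
      using iterate_drop[where f = f and D = "\<lambda>_. N" and a = 1 and lam = "exp 1" and k = k] unit_drop N(2) that by simp
    moreover have "real k * N \<le> (1 + r) * N" using k N(2) by (intro mult_right_mono)
    ultimately show ?thesis by (simp add: algebra_simps)
  qed
  obtain W where W: "\<And>x y. 1 \<le> x \<Longrightarrow> x \<le> y \<Longrightarrow> \<bar>A y - A x\<bar> \<le> W y - W x"
    using locally_bounded_variation_majorant[OF A] by blast
  have [measurable]: "(\<lambda>t. A (exp t)) \<in> borel_measurable borel"
    by (rule measurable_of_majorant[of _ "\<lambda>t. W (exp t)"]) (use W zero in auto)
  have meas: "(\<lambda>t. A (exp t) * exp (- t)) \<in> borel_measurable borel" by measurable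
  have F_lower: "F t \<ge> - (S + N) * (1 + t)" if "t \<ge> 0" for t
  proof -
    have "F t - F 0 \<ge> - ((1 + t) * N)" using long_drop[of 1 "exp t" t] that fF[of 0] fF[of t] by simp
    moreover have "F 0 \<ge> - S" using S by (simp add: F_def)
    moreover have "S * 1 \<le> S * (1 + t)" using S0 that by (intro mult_left_mono) auto
    ultimately show ?thesis by (simp add: algebra_simps)
  qed
  have growth: "\<exists>M\<ge>0. \<forall>t\<ge>0. \<bar>A (exp t) * exp (- t)\<bar> \<le> M * exp (\<sigma> * t)" if sg: "\<sigma> > 0" for \<sigma>
  proof -
    obtain L where L: "has_mellin A (of_real (1 + \<sigma>)) L" using mell[of "of_real (1 + \<sigma>)"] sg by auto
    show ?thesis
      by (rule exp_growth_of_mellin[OF A zero L sg, of "S + N"]) (use F_lower S0 N in \<open>auto simp: F_def\<close>)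
  qed
  have "nu_bar f 1 (exp (1 / T)) \<le> ereal ((1 + 1 / T) * N)"
    by (rule nu_bar_le, rule long_drop) (use T in auto)
  note rem = decrease_remainderD[OF dr[folded f_def] this less_imp_le[OF one_lt], folded \<nu>_def]
  have D_anti: "D t' \<le> D t" if "0 \<le> t" "t \<le> t'" for t t'
    unfolding D_def using that T by (intro add_left_mono rem(4)) (auto simp: divide_right_mono)
  have D_nn: "0 \<le> D t" if "0 \<le> t" for t
    unfolding D_def using that T rem(2) rem(5)[of "exp (t / T)"] by simp
  have D_drop: "F (t' / T) - F (t / T) \<ge> - (1 + t' - t) * D t" if t: "0 \<le> t" "t \<le> t'" for t t'
  proof -
    define k where "k = nat \<lceil>t' - t\<rceil>"
    have k: "t' - t \<le> real k" "real k \<le> 1 + t' - t" using t by (auto simp: k_def) linarith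
    have "exp (t' / T) \<le> exp (1 / T) ^ k * exp (t / T)"
      using k T by (simp add: exp_of_nat_mult[symmetric] mult_exp_exp field_simps)
    then have "f (exp (t' / T)) - f (exp (t / T)) \<ge> - real k * (\<nu> + \<Psi> (exp (t / T)))"
      using iterate_drop[where f = f and D = "\<lambda>x. \<nu> + \<Psi> x" and a = 1 and lam = "exp (1 / T)" and k = k]
        rem one_lt t T by (simp add: divide_right_mono)
    moreover have "real k * D t \<le> (1 + t' - t) * D t" using k D_nn[OF t(1)] by (intro mult_right_mono)
    ultimately show ?thesis by (simp add: fF D_def algebra_simps)
  qed
  have Lap: "has_bochner_integral lborel (\<lambda>t. indicator {0..} t *\<^sub>R (of_real (F t - P t) * exp (- (s * of_real t)))) (G s)"
    if "Re s > 0" for s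
    unfolding F_def P_def G_def
    by (rule G_fun_laplace[OF A zero mell that meas growth]) (use that om in auto)
  define H1 where "H1 = (\<lambda>t. if t < 0 then 0 else wt X t * (F t - P t))"
  have H1: "integrable lborel H1" "\<And>\<tau>. fourier (\<lambda>t. of_real (H1 t)) \<tau> = G (Complex (1 / X) \<tau>) - G (Complex (2 * (1 / X)) \<tau>)"
    unfolding H1_def using fourier_weighted[OF _ Lap] X by auto
  define H where H_eq: "H = (\<lambda>u. H1 (u / T))"
  define p where "p = (\<lambda>u. wt X (u / T) * P (u / T))"
  define \<Lambda> where "\<Lambda> = T * X"
  have wtX: "wt \<Lambda> u = wt X (u / T)" for u using T by (simp add: wt_def \<Lambda>_def)
  have intH: "integrable lborel H"
    using lborel_integrable_real_affine[OF H1(1), of "1 / T" 0] T by (simp add: H_eq)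
  have smoothed: "\<bar>LINT t|lborel. H t * jackson (y - t)\<bar> \<le> \<eta>" for y
  proof -
    have "norm (LINT t|lborel. complex_of_real (H t) * of_real (jackson (y - t)))
        \<le> (LINT \<tau>|lborel. indicator {-1..1} \<tau> *\<^sub>R norm (fourier (\<lambda>t. of_real (H t)) \<tau>))"
      using intH by (intro norm_integral_jackson_le) simp
    also have "\<dots> = \<eta>"
      unfolding H_eq \<eta>_def fourier_scale_L1[OF T, of "\<lambda>t. of_real (H1 t)"] by (rule eta_eq_fourier[OF H1, symmetric])
    also have "(LINT t|lborel. complex_of_real (H t) * of_real (jackson (y - t))) = of_real (LINT t|lborel. H t * jackson (y - t))"
      by (simp flip: of_real_mult)
    finally show ?thesis by simp
  qed
  have om': "\<forall>k\<le>n. \<forall>l\<in>{1..m k}. -1 < om k l \<and> om k l \<le> Om" using om by blast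
  note bounds = wt_oscillation_bounds[where c = c and b = b and n = n and m = m and om = om and Om = Om, OF X om']
  have KY: "(K - 1) * Y \<le> K * Y" using Y by (intro mult_right_mono) auto
  have p_bound: "\<bar>wt X t * P t\<bar> \<le> K * Y" if "t \<ge> 0" for t
  proof -
    have "\<bar>wt X t * P t\<bar> \<le> (K - 1) * Y"
      using bounds(1)[OF that] unfolding K_def P_def Y_def by simp
    then show ?thesis using KY by linarith
  qed
  have p_lip: "\<bar>p t - p t'\<bar> \<le> K * Y / T * \<bar>t - t'\<bar>" if "\<Lambda> / 4 \<le> t" "\<Lambda> / 4 \<le> t'" for t t'
  proof -
    have 1: "t / T \<ge> X / 4" "t' / T \<ge> X / 4" using that T by (auto simp: \<Lambda>_def field_simps)
    have "\<bar>p t - p t'\<bar> \<le> (K - 1) * Y * \<bar>t / T - t' / T\<bar>"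
      using bounds(2)[OF 1] unfolding K_def p_def P_def Y_def by simp
    also have "\<dots> \<le> K * Y * \<bar>t / T - t' / T\<bar>" using Y by (intro mult_right_mono) auto
    also have "\<dots> = K * Y / T * \<bar>t - t'\<bar>" using T by (simp add: diff_divide_distrib[symmetric])
    finally show ?thesis .
  qed
  \<comment> \<open>Growth at rate 1/X is exactly balanced by the weight. The resulting
    \<open>M\<close> is not controlled and does not reach the final constant.\<close>
  have bounded: "\<exists>B. \<forall>t. \<bar>H t\<bar> \<le> B"
  proof -
    obtain M where M: "M \<ge> 0" "\<And>t. t \<ge> 0 \<Longrightarrow> \<bar>F t\<bar> \<le> M * exp (1 / X * t)"
      using growth[of "1 / X"] X unfolding F_def by auto
    have "\<bar>H1 t\<bar> \<le> M + K * Y" for t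
    proof (cases "t < 0")
      case True
      then show ?thesis using M(1) K Y by (simp add: H1_def)
    next
      case False
      have "\<bar>wt X t\<bar> \<le> exp (- t / X)" using wt_nonneg[of X t] wt_le_exp[of X t] False X by simp
      then have "\<bar>wt X t\<bar> * \<bar>F t\<bar> \<le> exp (- t / X) * (M * exp (1 / X * t))"
        using M False by (intro mult_mono) auto
      also have "\<dots> = M" by (simp add: mult_exp_exp)
      finally have "\<bar>wt X t * F t\<bar> \<le> M" by (simp add: abs_mult)
      moreover have "H1 t = wt X t * F t - wt X t * P t" using False by (simp add: H1_def right_diff_distrib)
      ultimately show ?thesis using p_bound[of t] False by auto
    qed
    then show ?thesis unfolding H_eq by blast
  qed
  interpret tauberian \<Lambda> \<eta> "K * Y / T" S "K * Y" "\<lambda>u. F (u / T)" p D H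
  proof
    show "17 \<le> \<Lambda>" using TX by (simp add: \<Lambda>_def)
    show "H = (\<lambda>t. if t < 0 then 0 else wt \<Lambda> t * F (t / T) - p t)"
      using T by (auto simp: H_eq H1_def wtX p_def fun_eq_iff right_diff_distrib divide_less_0_iff)
    show "\<bar>F (0 / T)\<bar> \<le> S" using S by (simp add: F_def)
    show "\<bar>p t\<bar> \<le> K * Y" if "0 \<le> t" for t unfolding p_def using p_bound[of "t / T"] that T by simp
    show "K * Y > 0" "K * Y / T \<ge> 0" using K Y T by auto
  qed (use intH bounded smoothed D_drop D_anti D_nn p_lip in auto)
  \<comment> \<open>At the point of interest the weight is an absolute constant, so it can be
    divided out.\<close>
  have w: "wt \<Lambda> \<Lambda> = exp (-1) - exp (-2)" using T X by (simp add: wt_def \<Lambda>_def)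
  have w_pos: "exp (-1) - exp (-2::real) > 0" by simp
  have \<Lambda>_pos: "\<Lambda> > 0" using TX by (simp add: \<Lambda>_def)
  have H\<Lambda>: "H \<Lambda> = (exp (-1) - exp (-2)) * (F X - P X)"
    using w \<Lambda>_pos T wtX[of \<Lambda>] X by (simp add: H_eq H1_def \<Lambda>_def)
  define R where "R = \<nu> + \<Psi> (exp (X / 2)) + \<eta> + Y / T"
  have half: "D (\<Lambda> / 2) = \<nu> + \<Psi> (exp (X / 2))" using T by (simp add: D_def \<Lambda>_def)
  have YT: "Y / T > 0" using Y T by simp
  have nn: "\<nu> + \<Psi> (exp (X / 2)) \<ge> 0" "\<eta> \<ge> 0" using D_nn[of "\<Lambda> / 2"] \<Lambda>_pos half smoothed[of 0] by auto
  have R: "R \<ge> 0" "Y / T \<le> R" "\<nu> + \<Psi> (exp (X / 2)) + \<eta> \<le> R" using nn YT unfolding R_def by linarith+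
  have inv_le: "1 / \<Lambda> \<le> Y / T"
  proof -
    have "1 / \<Lambda> \<le> 1 / T" using X T by (simp add: \<Lambda>_def field_simps)
    also have "\<dots> \<le> Y / T" using Y T by (simp add: divide_right_mono)
    finally show ?thesis .
  qed
  have inv2_le: "(1 / T) / \<Lambda> \<le> Y / T"
  proof -
    have "(1 / T) / \<Lambda> \<le> (1 / T) / 1" using T TX by (intro divide_left_mono) (auto simp: \<Lambda>_def)
    also have "\<dots> \<le> Y / T" using Y T by (simp add: divide_right_mono)
    finally show ?thesis .
  qed
  have YL: "Y / \<Lambda> \<le> Y / T" using X T Y by (simp add: \<Lambda>_def field_simps)
  \<comment> \<open>All global data are absorbed into the term X^max(Om,0) / T of the remainder.
    \<open>D 0\<close> carries N and N/T: the first uses X >= 1, the second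
    \<open>\<Lambda> \<ge> 17\<close>.\<close>
  have Zle: "Z / \<Lambda> \<le> (2 * N + S + K) * (Y / T)"
  proof -
    have "D 0 \<le> (1 + 1 / T) * N" using rem(3) by (simp add: D_def)
    then have "Z \<le> (1 + 1 / T) * N + S + K * Y" unfolding Z_def by linarith
    then have "Z / \<Lambda> \<le> ((1 + 1 / T) * N + S + K * Y) / \<Lambda>" using \<Lambda>_pos by (intro divide_right_mono) auto
    also have "\<dots> = N * (1 / \<Lambda>) + N * ((1 / T) / \<Lambda>) + S * (1 / \<Lambda>) + K * (Y / \<Lambda>)"
      by (simp add: add_divide_distrib distrib_right)
    also have "\<dots> \<le> N * (Y / T) + N * (Y / T) + S * (Y / T) + K * (Y / T)"
      using N(2) S0 K inv_le inv2_le YL by (intro add_mono mult_left_mono) auto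
    also have "\<dots> = (2 * N + S + K) * (Y / T)" by (simp add: algebra_simps)
    finally show ?thesis .
  qed
  have "E \<Lambda> = (\<nu> + \<Psi> (exp (X / 2)) + \<eta>) + K * (Y / T) + Z / \<Lambda>" unfolding E_def half by simp
  also have "\<dots> \<le> R + K * R + (2 * N + S + K) * R"
  proof (intro add_mono R(3))
    show "K * (Y / T) \<le> K * R" using R K by (intro mult_left_mono) auto
    have "(2 * N + S + K) * (Y / T) \<le> (2 * N + S + K) * R" using R K N S0 by (intro mult_left_mono) auto
    then show "Z / \<Lambda> \<le> (2 * N + S + K) * R" using Zle by linarith
  qed
  also have "\<dots> = (1 + 2 * N + S + 2 * K) * R" by (simp add: algebra_simps)
  finally have E_le: "E \<Lambda> \<le> (1 + 2 * N + S + 2 * K) * R" .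
  have "(exp (-1) - exp (-2)) * \<bar>F X - P X\<bar> = \<bar>H \<Lambda>\<bar>" using w_pos unfolding H\<Lambda> abs_mult by simp
  also have "\<dots> \<le> exp 20 * 10 ^ 8 * E \<Lambda>" by (rule H_bound)
  also have "\<dots> \<le> exp 20 * 10 ^ 8 * ((1 + 2 * N + S + 2 * K) * R)" by (intro mult_left_mono E_le) simp
  finally have "\<bar>F X - P X\<bar> \<le> exp 20 * 10 ^ 8 * ((1 + 2 * N + S + 2 * K) * R) / (exp (-1) - exp (-2))"
    using w_pos by (simp add: pos_le_divide_eq mult.commute)
  then have "exp X * \<bar>F X - P X\<bar> \<le> exp X * (exp 20 * 10 ^ 8 * ((1 + 2 * N + S + 2 * K) * R) / (exp (-1) - exp (-2)))"
    by (intro mult_left_mono) auto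
  moreover have "exp X * \<bar>F X - P X\<bar> = \<bar>A (exp X) - exp X * P X\<bar>"
  proof -
    have "exp X * \<bar>F X - P X\<bar> = \<bar>exp X * (F X - P X)\<bar>" by (simp add: abs_mult)
    also have "exp X * (F X - P X) = A (exp X) - exp X * P X"
      by (simp add: F_def right_diff_distrib mult_exp_exp mult.left_commute)
    finally show ?thesis .
  qed
  ultimately show ?thesis
    unfolding R_def P_def \<nu>_def \<eta>_def G_def Y_def f_def by (simp only: times_divide_eq_right times_divide_eq_left mult_ac)
qed

lemma eta_nonneg: "eta G \<sigma> T \<ge> 0"
  unfolding eta_def by (cases "(\<lambda>\<tau>. norm (G (Complex (2 * \<sigma>) \<tau>) - G (Complex \<sigma> \<tau>))) integrable_on {-T..T}")
    (auto intro: Henstock_Kurzweil_Integration.integral_nonneg simp: not_integrable_integral)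

lemma le_max_exponent:
  assumes "k \<le> n" "l \<in> {1..m k}" shows "om k l \<le> max_exponent n m om"
proof -
  have "{om k l | k l. k \<le> n \<and> 1 \<le> l \<and> l \<le> m k} = (\<lambda>(k, l). om k l) ` (SIGMA k:{..n}. {1..m k})"
    by force
  then have "finite {om k l | k l. k \<le> n \<and> 1 \<le> l \<and> l \<le> m k}" by simp
  then show ?thesis unfolding max_exponent_def using assms by (intro Max_ge) auto
qed

lemma locally_bounded_variation_bounded:
  assumes "locally_bounded_variation A"
  shows "\<exists>B. \<forall>x\<in>{1..X}. \<bar>A x\<bar> \<le> B"
proof -
  obtain W where W: "\<And>x y. 1 \<le> x \<Longrightarrow> x \<le> y \<Longrightarrow> \<bar>A y - A x\<bar> \<le> W y - W x"
    using locally_bounded_variation_majorant[OF assms] by blast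
  have "\<bar>A x\<bar> \<le> \<bar>A 1\<bar> + (W X - W 1)" if "x \<in> {1..X}" for x
    using W[of 1 x] W[of x X] that by auto
  then show ?thesis by blast
qed

text \<open>\<open>\<Psi>\<close> does not increase, so its value at sqrt x is at most the geometric
  mean of its values at 1 and sqrt x.\<close>

lemma rho_rem_ge:
  assumes T: "T > 0" and x: "x \<ge> exp 1" and \<nu>: "real_of_ereal (nu f (exp (1 / T))) \<ge> 0"
    and \<Psi>: "\<And>x y. 1 \<le> x \<Longrightarrow> x \<le> y \<Longrightarrow> \<Psi> y \<le> \<Psi> x" "\<And>x. 1 \<le> x \<Longrightarrow> \<Psi> x \<ge> 0"
  shows "real_of_ereal (nu f (exp (1 / T))) + \<Psi> (sqrt x) + eta G (1 / ln x) T + ln x powr max Om 0 / T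
    \<le> rho_rem f G \<Psi> om Om T x"
proof -
  have "x > 0" using x exp_gt_zero[of "1::real"] by linarith
  then have ln1: "ln x \<ge> 1" using x by (simp add: ln_ge_iff)
  have x1: "x \<ge> 1" using x exp_ge_add_one_self[of 1] by linarith
  have "\<Psi> (sqrt x) * \<Psi> (sqrt x) \<le> \<Psi> 1 * \<Psi> (sqrt x)" using \<Psi> x1 by (intro mult_right_mono) auto
  then have 1: "\<Psi> (sqrt x) \<le> sqrt (\<Psi> 1 * \<Psi> (sqrt x))" by (intro real_le_rsqrt) (simp add: power2_eq_square)
  have 2: "eta G (1 / ln x) T \<le> (1 + 1 / T) * eta G (1 / ln x) T"
    using T eta_nonneg[of G "1 / ln x" T] by (simp add: distrib_right)
  have 3: "ln x powr max Om 0 / T \<le> (ln x powr max Om 0 + ln (ln x)) / T"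
    using T ln1 by (intro divide_right_mono) auto
  have 4: "0 \<le> 1 / (T powr (om + 1) * ln x)" "0 \<le> 1 / (T powr (Om + 1) * ln x)" using ln1 by auto
  have 5: "real_of_ereal (nu f (exp (1 / T))) + eta G (1 / ln x) T + ln x powr max Om 0 / T \<le> R_rem f G om Om T x"
    unfolding R_rem_def using 2 3 4 by linarith
  have "0 \<le> ln x powr max Om 0 / T" using T by simp
  then have "0 \<le> R_rem f G om Om T x" using 5 \<nu> eta_nonneg[of G "1 / ln x" T] by linarith
  then have "0 \<le> sqrt (\<Psi> 1 * R_rem f G om Om T x)" using \<Psi>(2)[of 1] by simp
  then show ?thesis unfolding rho_rem_def using 1 5 by linarith
qed

text \<open>The order of quantifiers expresses the dependence of the implicit constant:
  \<open>C\<close> is chosen after the coefficients, the frequencies and the prescribed values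
  \<open>N\<close>, \<open>S\<close>, \<open>M2\<close>, \<open>K\<close>, but before
  \<open>A\<close>, \<open>T\<close>, the exponents and \<open>\<Psi>\<close>.\<close>

theorem theorem6p4:
  fixes n :: nat and m :: "nat \<Rightarrow> nat" and c :: "nat \<Rightarrow> nat \<Rightarrow> complex" and b :: "nat \<Rightarrow> real"
    and N :: ereal and S :: real and M2 :: complex and K :: real
  assumes "n \<ge> 1" and "\<forall>k\<le>n. m k \<ge> 1" and "b 0 = 0" and "\<forall>k\<in>{1..n}. b k > 0"
  shows "\<exists>C::real. \<forall>(A :: real \<Rightarrow> real) (T :: real) (om :: nat \<Rightarrow> nat \<Rightarrow> real) (\<Psi> :: real \<Rightarrow> real).
     locally_bounded_variation A \<and>
     (\<forall>x<1. A x = 0) \<and>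
     (\<forall>s. Re s > 1 \<longrightarrow> (\<exists>L. has_mellin A s L)) \<and>
     T > 0 \<and>
     (\<forall>k\<le>n. \<forall>l\<in>{1..m k}. om k l > -1) \<and>
     slowly_decreasing (\<lambda>x. A x / x) \<and>
     decrease_remainder (\<lambda>x. A x / x) 1 (exp (1 / T)) \<Psi> \<and>
     (\<forall>\<sigma>. 0 < \<sigma> \<and> \<sigma> < 1 \<longrightarrow>
        eta (G_fun A n m c om b) \<sigma> T \<le> K * \<sigma> powr (- max (max_exponent n m om) 0)) \<and>
     nu_bar (\<lambda>x. A x / x) 1 (exp 1) = N \<and>
     (SUP x\<in>{1..exp 1}. \<bar>A x\<bar>) = S \<and>
     mellin A 2 = M2
     \<longrightarrow> (\<forall>x. x \<ge> max (exp 1) (max (exp (17 / T)) (exp (17 / sqrt T))) \<longrightarrow>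
          \<bar>A x - main_term n m c om b x\<bar>
            \<le> C * (x * rho_rem (\<lambda>x. A x / x) (G_fun A n m c om b) \<Psi>
                        (min_exponent n m om) (max_exponent n m om) T x))"
proof -
  define K0 where "K0 = 160 * exp 2 * (\<Sum>k=0..n. \<Sum>l=1..m k. norm (c k l) * (1 + \<bar>b k\<bar>)) + (1::real)"
  \<comment> \<open>For every admissible \<open>A\<close> the value \<open>N\<close> is finite, by
    slow decrease; the default of \<open>real_of_ereal\<close> at an infinity is therefore
    harmless.\<close>
  define C where "C = exp 20 * 10 ^ 8 * (1 + 2 * real_of_ereal N + S + 2 * K0) / (exp (-1) - exp (-2))"
  show ?thesis
  proof (intro exI[of _ C] allI impI, elim conjE)
    fix A :: "real \<Rightarrow> real" and T :: real and om :: "nat \<Rightarrow> nat \<Rightarrow> real" and \<Psi> :: "real \<Rightarrow> real" and x :: real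
    assume A: "locally_bounded_variation A" and zero: "\<forall>x<1. A x = 0"
      and mell: "\<forall>s. Re s > 1 \<longrightarrow> (\<exists>L. has_mellin A s L)" and T: "T > 0"
      and om: "\<forall>k\<le>n. \<forall>l\<in>{1..m k}. om k l > -1"
      and sd: "slowly_decreasing (\<lambda>x. A x / x)"
      and dr: "decrease_remainder (\<lambda>x. A x / x) 1 (exp (1 / T)) \<Psi>"
      and N: "nu_bar (\<lambda>x. A x / x) 1 (exp 1) = N" and S: "(SUP x\<in>{1..exp 1}. \<bar>A x\<bar>) = S"
      and x: "x \<ge> max (exp 1) (max (exp (17 / T)) (exp (17 / sqrt T)))"
    have bounded: "\<exists>B. \<forall>x\<in>{1..X}. \<bar>A x / x\<bar> \<le> B" for X
    proof -
      obtain B where B: "\<forall>x\<in>{1..X}. \<bar>A x\<bar> \<le> B" using locally_bounded_variation_bounded[OF A] by blast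
      have "\<bar>A x / x\<bar> \<le> B" if "x \<in> {1..X}" for x
      proof -
        have "\<bar>A x\<bar> / x \<le> \<bar>A x\<bar> / 1" using that by (intro divide_left_mono) auto
        then show ?thesis using that B by fastforce
      qed
      then show ?thesis by blast
    qed
    obtain N' where N': "N' \<ge> 0" "nu_bar (\<lambda>x. A x / x) 1 (exp 1) = ereal N'"
      using nu_bar_finite[OF sd bounded, of "exp 1"] by auto
    obtain c1 where c1: "nu_bar (\<lambda>x. A x / x) 1 (exp (1 / T)) = ereal c1"
      using nu_bar_finite[OF sd bounded, of "exp (1 / T)"] T by auto
    have "N = ereal N'" using N N'(2) by (simp only:)
    then have NN: "real_of_ereal N = N'" by simp
    \<comment> \<open>The supremum of reals bounds the values only for a set bounded above, which
      local bounded variation ensures.\<close>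
    have S1: "\<bar>A 1\<bar> \<le> S"
    proof -
      obtain B where "\<forall>x\<in>{1..exp 1}. \<bar>A x\<bar> \<le> B" using locally_bounded_variation_bounded[OF A] by blast
      then have "bdd_above ((\<lambda>x. \<bar>A x\<bar>) ` {1..exp 1})" by (auto intro!: bdd_aboveI2)
      then show ?thesis unfolding S[symmetric] by (intro cSUP_upper) auto
    qed
    have "exp (1 / T) \<ge> 1" using T by simp
    note rem = decrease_remainderD[OF dr _ this, of c1, unfolded c1, OF order_refl]
    define X where "X = ln x"
    have x0: "x > 0" using x by (smt (verit) exp_gt_zero max.bounded_iff)
    then have eX: "exp X = x" by (simp add: X_def)
    have X: "X \<ge> 1" "X \<ge> 17 / T" using x x0 by (simp_all add: X_def ln_ge_iff)
    then have TX: "T * X \<ge> 17" using T by (simp add: field_simps)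
    have sq: "exp (X / 2) = sqrt x"
      using real_sqrt_unique[of "exp (X / 2)" x] eX by (simp add: power2_eq_square mult_exp_exp)
    have "\<bar>A (exp X) - exp X * oscillation n m c om b X\<bar> \<le> C *
      (exp X * (real_of_ereal (nu (\<lambda>x. A x / x) (exp (1 / T))) + \<Psi> (exp (X / 2))
        + eta (G_fun A n m c om b) (1 / X) T + X powr max (max_exponent n m om) 0 / T))"
      unfolding C_def NN K0_def
    proof (rule tauberian_mellin[OF A _ _ T _ dr N'(2,1) S1 X(1) TX])
      show "-1 < om k l \<and> om k l \<le> max_exponent n m om" if "k \<le> n" "l \<in> {1..m k}" for k l
        using om that le_max_exponent by blast
    qed (use zero mell in auto)
    then have "\<bar>A x - main_term n m c om b x\<bar> \<le> C *
      (x * (real_of_ereal (nu (\<lambda>x. A x / x) (exp (1 / T))) + \<Psi> (sqrt x)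
        + eta (G_fun A n m c om b) (1 / ln x) T + ln x powr max (max_exponent n m om) 0 / T))"
      unfolding main_term_eq eX sq X_def[symmetric] .
    also have "\<dots> \<le> C * (x * rho_rem (\<lambda>x. A x / x) (G_fun A n m c om b) \<Psi> (min_exponent n m om) (max_exponent n m om) T x)"
    proof (intro mult_left_mono rho_rem_ge[OF T _ rem(2,4,5)])
      have "K0 \<ge> 0" unfolding K0_def by (auto intro!: add_nonneg_nonneg mult_nonneg_nonneg sum_nonneg)
      then show "0 \<le> C" unfolding C_def NN using N'(1) S1 by (intro divide_nonneg_nonneg mult_nonneg_nonneg) auto
    qed (use x x0 in auto)
    finally show "\<bar>A x - main_term n m c om b x\<bar>
      \<le> C * (x * rho_rem (\<lambda>x. A x / x) (G_fun A n m c om b) \<Psi> (min_exponent n m om) (max_exponent n m om) T x)" .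
  qed
qed

end
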